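(* Let $(c_*,\lambda_* )\in\Lambda$. As $(\mu,\lambda,c)\in\Omega$ tends to $(\mu_0(c_*,\lambda_* ),\lambda_*,c_* )$, so that $\delta:=(v_3-v_2)/2\to0$, the Hessian of the action has the asymptotic behavior $$\frac{1}{\pi Y^0}\nabla^2\Theta=\alpha_0\,\mathbf{V}_0\otimes\mathbf{V}_0+\beta_0\,(\mathbf{V}_0\otimes\mathbf{W}_0+\mathbf{W}_0\otimes\mathbf{V}_0)+\frac{a_0^2}{2}\,\mathbf{W}_0\otimes\mathbf{W}_0-\mathbf{T}_0\otimes\mathbf{T}_0+\frac{a_0^2}{4}\,(\mathbf{V}_0\otimes\mathbf{Z}_0+\mathbf{Z}_0\otimes\mathbf{V}_0)+\mathcal{O}(\delta),$$ where $$\alpha_0:=\frac{1}{Y^0}\Big(b_0\,(Y^0_v+2Y^0_z)+a_0^2\big(\tfrac14Y^0_{vv}+Y^0_{zz}-Y^0_{wz}\big)\Big),\qquad \beta_0:=b_0+\frac{a_0^2}{2}\,\frac{Y^0_v}{Y^0}.$$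
   Context: **Potential.** $N\in\{1,2\}$, $b\neq0$ is a real number, $I\subset\mathbb{R}$ is an open interval, $f,\kappa:I\to\mathbb{R}$ are smooth with $\kappa>0$, and if $N=2$, $\tau:I\to\mathbb{R}$ is smooth with $\tau>0$. Parameters are $\mu\in\mathbb{R}$, $\lambda\in\mathbb{R}^N$, $c\in\mathbb{R}$. For $N=2$: $g(v;c,\lambda_2):=-\big((c/b)v+\lambda_2\big)/\tau(v)$, $q(v;c,\lambda_2):=v\,g(v;c,\lambda_2)/b$, $\mathcal{W}(v;c,\lambda):=-f(v)+\tfrac12\tau(v)g(v;c,\lambda_2)^2-\lambda_1 v$. For $N=1$: $q(v):=v^2/(2b)$, $\mathcal{W}(v;c,\lambda):=-f(v)-\tfrac{c}{2b}v^2-\lambda v$. **Standing assumption.** $\Lambda\subset\mathbb{R}^{N+1}$ is open, and there are smooth functions $v_0,v_s,v^s:\Lambda\to I$ such that for all $(c,\lambda)\in\Lambda$: $v_s<v_0<v^s$; $\mu_0(c,\lambda):=\mathcal{W}(v_0;c,\lambda)<\mu_s(c,\lambda):=\mathcal{W}(v_s;c,\lambda)=\mathcal{W}(v^s;c,\lambda)$; $\partial_v\mathcal{W}(v_0;c,\lambda)=\partial_v\mathcal{W}(v_s;c,\lambda)=0$; $\partial_v^2\mathcal{W}(v_s;c,\lambda)<0<\partial_v^2\mathcal{W}(v_0;c,\lambda)$; $\partial_v\mathcal{W}<0$ on $(v_s,v_0)$ and $\partial_v\mathcal{W}>0$ on $(v_0,v^s]$. Let $\Omega:=\{(\mu,\lambda,c):(c,\lambda)\in\Lambda,\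 \mu_0(c,\lambda)<\mu<\mu_s(c,\lambda)\}$, and let $v_1,v_2,v_3:\Omega\to I$ be smooth with $v_1<v_s<v_2<v_0<v_3<v^s$, $\mathcal{W}(v_i(\mu,\lambda,c);c,\lambda)=\mu$ for $i=1,2,3$, and $\partial_v\mathcal{W}(\cdot;c,\lambda)>0$ on $[v_1(\mu,\lambda,c),v_s(c,\lambda))$. **Action.** $\Theta(\mu,\lambda,c)=2\int_{v_2}^{v_3}\sqrt{2\kappa(v)(\mu-\mathcal{W}(v;c,\lambda))}\,dv$ on $\Omega$; $\nabla^2\Theta$ is the $(N+2)\times(N+2)$ Hessian with respect to $(\mu,\lambda,c)$. **Notation.** $\mathbf{X}\otimes\mathbf{Y}:=\mathbf{X}\mathbf{Y}^T$. All quantities with index $0$ are functions of $(c,\lambda)$, with $v_0=v_0(c,\lambda)$. $a_0:=\sqrt{2/\partial_v^2\mathcal{W}(v_0;c,\lambda)}$, $b_0:=-\tfrac13\,\partial_v^3\mathcal{W}(v_0;c,\lambda)/(\partial_v^2\mathcal{W}(v_0;c,\lambda))^2$. For $N=2$ (with $g,g_v,g_{vv},q,q_v,q_{vv}$ and $\tau$ evaluated at $v=v_0$): $\mathbf{V}_0=(1,v_0,g,q)^T$, $\mathbf{W}_0=(0,1,g_v,q_v)^T$, $\mathbf{Z}_0=(0,0,g_{vv},q_{vv})^T$, $\mathbf{T}_0=\tau(v_0)^{-1/2}(0,0,1,v_0/b)^T$. For $N=1$: $\mathbf{V}_0=(1,v_0,q)^T$, $\mathbf{W}_0=(0,1,q_v)^T$,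 $\mathbf{Z}_0=(0,0,q_{vv})^T$, $\mathbf{T}_0=0$. $$R(v,w,z;c,\lambda):=\int_0^1\!\!\int_0^1 t\,\partial_v^2\mathcal{W}(w+t(z-w)+ts(v-z);c,\lambda)\,ds\,dt,\qquad Y(v,w,z;c,\lambda):=\sqrt{2\kappa(v)/|R(v,w,z;c,\lambda)|}.$$ A superscript $0$ on $Y$ or its partial derivatives (denoted by subscripts $v,w,z$) means evaluation at $v=w=z=v_0(c,\lambda)$. *)

theory Defs
  imports "HOL-Analysis.Analysis" "HOL-Library.Landau_Symbols"
begin

primrec Ck_on :: "nat \<Rightarrow> 'a::euclidean_space set \<Rightarrow> ('a \<Rightarrow> real) \<Rightarrow> bool" where
  "Ck_on 0 S F \<longleftrightarrow> continuous_on S F"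
| "Ck_on (Suc k) S F \<longleftrightarrow>
     (\<forall>x\<in>S. F differentiable (at x)) \<and>
     (\<forall>h. Ck_on k S (\<lambda>x. frechet_derivative F (at x) h))"

definition smooth_on :: "'a::euclidean_space set \<Rightarrow> ('a \<Rightarrow> real) \<Rightarrow> bool" where
  "smooth_on S F \<longleftrightarrow> (\<forall>k. Ck_on k S F)"

text \<open>Square matrices on a Euclidean space are represented by the associated bilinear forms;
  the matrix entries are their values at pairs of elements of \<^const>\<open>Basis\<close>.\<close>

definition hessian :: "('a::euclidean_space \<Rightarrow> real) \<Rightarrow> 'a \<Rightarrow> 'a \<Rightarrow> 'a \<Rightarrow> real" where
  "hessian F p i j = frechet_derivative (\<lambda>x. frechet_derivative F (at x) j) (at p) i"

definition twice_differentiable_on :: "'a::euclidean_space set \<Rightarrow> ('a \<Rightarrow> real) \<Rightarrow> bool" where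
  "twice_differentiable_on S F \<longleftrightarrow>
     (\<forall>x\<in>S. F differentiable (at x) \<and>
        (\<forall>h. (\<lambda>y. frechet_derivative F (at y) h) differentiable (at x)))"

definition outer :: "'a::euclidean_space \<Rightarrow> 'a \<Rightarrow> 'a \<Rightarrow> 'a \<Rightarrow> real" where
  "outer X Y i j = (X \<bullet> i) * (Y \<bullet> j)"

text \<open>The parameter \<open>l\<close> (usually \<open>\<lambda>\<close>) ranges over a space \<open>'l\<close>, which is \<open>\<real>\<close> for
  \<open>N = 1\<close> and \<open>\<real> \<times> \<real>\<close> for \<open>N = 2\<close>.  Potentials are functions \<open>W v (c, l)\<close>.  Parameters are
  ordered as \<open>(c, l)\<close> in \<open>L\<close>, but as \<open>(\<mu>, l, c)\<close> in \<open>Omega\<close>.  The functions \<open>v\<^sub>s\<close> and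
  \<open>v\<^sup>s\<close> are written \<open>vs\<close> and \<open>vS\<close>.\<close>

definition dW :: "nat \<Rightarrow> (real \<Rightarrow> real \<times> 'l \<Rightarrow> real) \<Rightarrow> real \<Rightarrow> real \<times> 'l \<Rightarrow> real" where
  "dW k W v cl = (deriv ^^ k) (\<lambda>u. W u cl) v"

definition potential_wells ::
  "real set \<Rightarrow> (real \<Rightarrow> real \<times> 'l::euclidean_space \<Rightarrow> real) \<Rightarrow> (real \<times> 'l) set \<Rightarrow>
   (real \<times> 'l \<Rightarrow> real) \<Rightarrow> (real \<times> 'l \<Rightarrow> real) \<Rightarrow> (real \<times> 'l \<Rightarrow> real) \<Rightarrow> bool" where
  "potential_wells I W L v0 vs vS \<longleftrightarrow>
     open L \<and> smooth_on L v0 \<and> smooth_on L vs \<and> smooth_on L vS \<and>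
     (\<forall>p\<in>L. v0 p \<in> I \<and> vs p \<in> I \<and> vS p \<in> I \<and>
        vs p < v0 p \<and> v0 p < vS p \<and>
        W (v0 p) p < W (vs p) p \<and> W (vs p) p = W (vS p) p \<and>
        dW 1 W (v0 p) p = 0 \<and> dW 1 W (vs p) p = 0 \<and>
        dW 2 W (vs p) p < 0 \<and> 0 < dW 2 W (v0 p) p \<and>
        (\<forall>v\<in>{vs p<..<v0 p}. dW 1 W v p < 0) \<and>
        (\<forall>v\<in>{v0 p<..vS p}. dW 1 W v p > 0))"

definition Omega ::
  "(real \<Rightarrow> real \<times> 'l \<Rightarrow> real) \<Rightarrow> (real \<times> 'l) set \<Rightarrow> (real \<times> 'l \<Rightarrow> real) \<Rightarrow>
   (real \<times> 'l \<Rightarrow> real) \<Rightarrow> (real \<times> 'l \<times> real) set" where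
  "Omega W L v0 vs =
     {(\<mu>, l, c). (c, l) \<in> L \<and> W (v0 (c, l)) (c, l) < \<mu> \<and> \<mu> < W (vs (c, l)) (c, l)}"

definition energy_roots ::
  "real set \<Rightarrow> (real \<Rightarrow> real \<times> 'l::euclidean_space \<Rightarrow> real) \<Rightarrow> (real \<times> 'l) set \<Rightarrow>
   (real \<times> 'l \<Rightarrow> real) \<Rightarrow> (real \<times> 'l \<Rightarrow> real) \<Rightarrow> (real \<times> 'l \<Rightarrow> real) \<Rightarrow>
   (real \<times> 'l \<times> real \<Rightarrow> real) \<Rightarrow> (real \<times> 'l \<times> real \<Rightarrow> real) \<Rightarrow>
   (real \<times> 'l \<times> real \<Rightarrow> real) \<Rightarrow> bool" where
  "energy_roots I W L v0 vs vS v1 v2 v3 \<longleftrightarrow>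
     smooth_on (Omega W L v0 vs) v1 \<and> smooth_on (Omega W L v0 vs) v2 \<and>
     smooth_on (Omega W L v0 vs) v3 \<and>
     (\<forall>(\<mu>, l, c)\<in>Omega W L v0 vs.
        v1 (\<mu>, l, c) \<in> I \<and> v2 (\<mu>, l, c) \<in> I \<and> v3 (\<mu>, l, c) \<in> I \<and>
        v1 (\<mu>, l, c) < vs (c, l) \<and> vs (c, l) < v2 (\<mu>, l, c) \<and>
        v2 (\<mu>, l, c) < v0 (c, l) \<and> v0 (c, l) < v3 (\<mu>, l, c) \<and>
        v3 (\<mu>, l, c) < vS (c, l) \<and>
        W (v1 (\<mu>, l, c)) (c, l) = \<mu> \<and> W (v2 (\<mu>, l, c)) (c, l) = \<mu> \<and>
        W (v3 (\<mu>, l, c)) (c, l) = \<mu> \<and>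
        (\<forall>v\<in>{v1 (\<mu>, l, c)..<vs (c, l)}. dW 1 W v (c, l) > 0))"

fun action ::
  "(real \<Rightarrow> real) \<Rightarrow> (real \<Rightarrow> real \<times> 'l \<Rightarrow> real) \<Rightarrow> (real \<times> 'l \<times> real \<Rightarrow> real) \<Rightarrow>
   (real \<times> 'l \<times> real \<Rightarrow> real) \<Rightarrow> real \<times> 'l \<times> real \<Rightarrow> real" where
  "action \<kappa> W v2 v3 (\<mu>, l, c) =
     2 * integral {v2 (\<mu>, l, c)..v3 (\<mu>, l, c)} (\<lambda>v. sqrt (2 * \<kappa> v * (\<mu> - W v (c, l))))"

definition RR ::
  "(real \<Rightarrow> real \<times> 'l \<Rightarrow> real) \<Rightarrow> real \<Rightarrow> real \<Rightarrow> real \<Rightarrow> real \<times> 'l \<Rightarrow> real" where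
  "RR W v w z cl =
     integral {0..1} (\<lambda>t. integral {0..1}
       (\<lambda>s. t * dW 2 W (w + t * (z - w) + t * s * (v - z)) cl))"

definition YY ::
  "(real \<Rightarrow> real) \<Rightarrow> (real \<Rightarrow> real \<times> 'l \<Rightarrow> real) \<Rightarrow> real \<Rightarrow> real \<Rightarrow> real \<Rightarrow> real \<times> 'l \<Rightarrow> real" where
  "YY \<kappa> W v w z cl = sqrt (2 * \<kappa> v / \<bar>RR W v w z cl\<bar>)"

context
  fixes \<kappa> :: "real \<Rightarrow> real" and W :: "real \<Rightarrow> real \<times> 'l \<Rightarrow> real"
    and v0 :: "real \<times> 'l \<Rightarrow> real"
begin

definition Y0 :: "real \<times> 'l \<Rightarrow> real" where
  "Y0 p = YY \<kappa> W (v0 p) (v0 p) (v0 p) p"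

definition Y0_v :: "real \<times> 'l \<Rightarrow> real" where
  "Y0_v p = deriv (\<lambda>v. YY \<kappa> W v (v0 p) (v0 p) p) (v0 p)"

definition Y0_z :: "real \<times> 'l \<Rightarrow> real" where
  "Y0_z p = deriv (\<lambda>z. YY \<kappa> W (v0 p) (v0 p) z p) (v0 p)"

definition Y0_vv :: "real \<times> 'l \<Rightarrow> real" where
  "Y0_vv p = (deriv ^^ 2) (\<lambda>v. YY \<kappa> W v (v0 p) (v0 p) p) (v0 p)"

definition Y0_zz :: "real \<times> 'l \<Rightarrow> real" where
  "Y0_zz p = (deriv ^^ 2) (\<lambda>z. YY \<kappa> W (v0 p) (v0 p) z p) (v0 p)"

definition Y0_wz :: "real \<times> 'l \<Rightarrow> real" where
  "Y0_wz p = deriv (\<lambda>z. deriv (\<lambda>w. YY \<kappa> W (v0 p) w z p) (v0 p)) (v0 p)"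

definition a0 :: "real \<times> 'l \<Rightarrow> real" where
  "a0 p = sqrt (2 / dW 2 W (v0 p) p)"

definition b0 :: "real \<times> 'l \<Rightarrow> real" where
  "b0 p = - (1 / 3) * dW 3 W (v0 p) p / (dW 2 W (v0 p) p)\<^sup>2"

definition alpha0 :: "real \<times> 'l \<Rightarrow> real" where
  "alpha0 p = 1 / Y0 p *
     (b0 p * (Y0_v p + 2 * Y0_z p) + (a0 p)\<^sup>2 * (Y0_vv p / 4 + Y0_zz p - Y0_wz p))"

definition beta0 :: "real \<times> 'l \<Rightarrow> real" where
  "beta0 p = b0 p + (a0 p)\<^sup>2 / 2 * (Y0_v p / Y0 p)"

end

text \<open>The suffix 1 or 2 is \<open>N\<close>.  \<open>V_N\<close>, \<open>W_N\<close>, \<open>Z_N\<close>, \<open>T_N\<close> have components in the order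
  \<open>(\<mu>, l, c)\<close>.  \<open>V_N\<close> is the gradient of \<open>\<mu> - W v (c, l)\<close> in these parameters, and \<open>W_N\<close>,
  \<open>Z_N\<close> are its first and second derivatives in \<open>v\<close>.\<close>

definition q1 :: "real \<Rightarrow> real \<Rightarrow> real" where
  "q1 b v = v\<^sup>2 / (2 * b)"

fun W1 :: "real \<Rightarrow> (real \<Rightarrow> real) \<Rightarrow> real \<Rightarrow> real \<times> real \<Rightarrow> real" where
  "W1 b f v (c, l) = - f v - c / (2 * b) * v\<^sup>2 - l * v"

definition V_N1 :: "real \<Rightarrow> real \<Rightarrow> real \<times> real \<times> real" where
  "V_N1 b v = (1, v, q1 b v)"

definition W_N1 :: "real \<Rightarrow> real \<Rightarrow> real \<times> real \<times> real" where
  "W_N1 b v = (0, 1, deriv (q1 b) v)"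

definition Z_N1 :: "real \<Rightarrow> real \<Rightarrow> real \<times> real \<times> real" where
  "Z_N1 b v = (0, 0, (deriv ^^ 2) (q1 b) v)"

definition T_N1 :: "real \<times> real \<times> real" where
  "T_N1 = 0"

definition g2 :: "real \<Rightarrow> (real \<Rightarrow> real) \<Rightarrow> real \<Rightarrow> real \<Rightarrow> real \<Rightarrow> real" where
  "g2 b \<tau> c l2 v = - (c / b * v + l2) / \<tau> v"

definition q2 :: "real \<Rightarrow> (real \<Rightarrow> real) \<Rightarrow> real \<Rightarrow> real \<Rightarrow> real \<Rightarrow> real" where
  "q2 b \<tau> c l2 v = v * g2 b \<tau> c l2 v / b"

fun W2 :: "real \<Rightarrow> (real \<Rightarrow> real) \<Rightarrow> (real \<Rightarrow> real) \<Rightarrow> real \<Rightarrow> real \<times> (real \<times> real) \<Rightarrow> real" where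
  "W2 b f \<tau> v (c, (l1, l2)) = - f v + 1 / 2 * \<tau> v * (g2 b \<tau> c l2 v)\<^sup>2 - l1 * v"

fun V_N2 :: "real \<Rightarrow> (real \<Rightarrow> real) \<Rightarrow> real \<Rightarrow> real \<times> (real \<times> real) \<Rightarrow> real \<times> (real \<times> real) \<times> real" where
  "V_N2 b \<tau> v (c, (l1, l2)) = (1, (v, g2 b \<tau> c l2 v), q2 b \<tau> c l2 v)"

fun W_N2 :: "real \<Rightarrow> (real \<Rightarrow> real) \<Rightarrow> real \<Rightarrow> real \<times> (real \<times> real) \<Rightarrow> real \<times> (real \<times> real) \<times> real" where
  "W_N2 b \<tau> v (c, (l1, l2)) = (0, (1, deriv (g2 b \<tau> c l2) v), deriv (q2 b \<tau> c l2) v)"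

fun Z_N2 :: "real \<Rightarrow> (real \<Rightarrow> real) \<Rightarrow> real \<Rightarrow> real \<times> (real \<times> real) \<Rightarrow> real \<times> (real \<times> real) \<times> real" where
  "Z_N2 b \<tau> v (c, (l1, l2)) = (0, (0, (deriv ^^ 2) (g2 b \<tau> c l2) v), (deriv ^^ 2) (q2 b \<tau> c l2) v)"

definition T_N2 :: "real \<Rightarrow> (real \<Rightarrow> real) \<Rightarrow> real \<Rightarrow> real \<times> (real \<times> real) \<times> real" where
  "T_N2 b \<tau> v = \<tau> v powr (- 1 / 2) *\<^sub>R (0, (0, 1), v / b)"

end

theory Submission
  imports Defs
begin

text \<open>
  Near the bottom \<open>v0\<close> of a well, \<open>W - \<mu>0 = \<phi>\<^sup>2\<close> with \<open>\<phi>\<close> smooth and strictly increasing in \<open>v\<close>, also as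
  a function of the parameters.  In the coordinate \<open>x = \<phi>\<close>, with inverse \<open>v = \<psi>(x)\<close>, the turning points are
  \<open>x = \<plusminus>h\<close> with \<open>h = sqrt (\<mu> - \<mu>0)\<close>, and \<open>x = h sin t\<close> removes the square root singularities of the action:
  it becomes an integral over \<open>[-\<pi>/2, \<pi>/2]\<close> of a function that is smooth in all parameters as long as \<open>h > 0\<close>.
  An integration by parts gives \<open>\<partial>\<^sub>j\<Theta> = \<integral> \<Phi>\<^sub>j (h sin t) dt\<close> with \<open>\<Phi>\<^sub>j = sqrt (2\<kappa>) \<psi>' V\<^sub>j\<close>.  One more derivative produces
  \<open>\<partial>\<^sub>i h = V\<^sub>i / (2h)\<close>, whose singular factor is compensated because \<open>sin\<close> is odd; Taylor expansion in \<open>x\<close> yields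
  \<open>\<partial>\<^sub>i\<partial>\<^sub>j\<Theta> = \<pi> (V\<^sub>i \<Phi>\<^sub>j'' / 4 + \<partial>\<^sub>i\<Phi>\<^sub>j) + O(h)\<close> at \<open>x = 0\<close>, and \<open>h\<close> is comparable to \<open>\<delta>\<close>.  The derivatives of
  \<open>\<psi>\<close> at \<open>0\<close> follow from differentiating \<open>W(\<psi>(x)) = \<mu>0 + x\<^sup>2\<close>, and the coefficients are matched with those
  expressed through \<open>Y\<close> by computing the derivatives of \<open>R\<close> on the diagonal.
\<close>

section \<open>Smooth functions\<close>

text \<open>Differentiating the substituted action produces the parameter derivative of
  \<open>G = k(\<psi>) \<psi>'\<close>, which does not occur in the claim. The integration by parts
  can remove it because \<open>k(v) dv\<close> is exact: with \<open>K' = k\<close>, both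
  \<open>G\<close> and \<open>M q\<close>, which is \<open>k(\<psi>)\<close> times the
  \<open>q\<close>-derivative of \<open>\<psi>\<close>, are partial derivatives of
  \<open>K(\<psi>(x, p))\<close>. Hence the \<open>q\<close>-derivative of \<open>G\<close> equals
  the \<open>x\<close>-derivative of \<open>M q\<close>, and along \<open>x = h sin t\<close> this
  is a total derivative in \<open>t\<close> up to known factors. What remains contains
  \<open>2 x M\<close>, and implicit differentiation of \<open>u(\<psi>) = \<mu>0 + x^2\<close>
  rewrites it through the values of \<open>Vf j\<close> at \<open>\<psi>\<close> and at
  \<open>v0\<close>. The quarter in the limit is the 1/2 of the derivative of \<open>h\<close> times
  the mean 1/2 of \<open>sin^2\<close> over the half turn. In the limit the parameters move together
  with \<open>\<mu>\<close>. The error is therefore measured against the form at the current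
  parameters, and all constants come from one compact neighbourhood of \<open>(0, p0)\<close>, on
  which \<open>\<psi>'\<close> stays away from 0.\<close>

definition ddir :: "'a::euclidean_space \<Rightarrow> ('a \<Rightarrow> real) \<Rightarrow> 'a \<Rightarrow> real" where
  "ddir h F x = frechet_derivative F (at x) h"

lemma Ck_on_Suc_ddir:
  "Ck_on (Suc k) S F \<longleftrightarrow> (\<forall>x\<in>S. F differentiable (at x)) \<and> (\<forall>h. Ck_on k S (ddir h F))"
  by (simp add: ddir_def[abs_def])

declare Ck_on.simps(2)[simp del]

lemma ddir_eqI: "(F has_derivative F') (at x) \<Longrightarrow> ddir h F x = F' h"
  unfolding ddir_def by (metis frechet_derivative_at)

lemma has_derivative_ddir: "F differentiable (at x) \<Longrightarrow> (F has_derivative (\<lambda>h. ddir h F x)) (at x)"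
  unfolding ddir_def by (simp add: frechet_derivative_works)

text \<open>Holds also where \<open>F\<close> is not differentiable:
  \<open>frechet_derivative\<close> is chosen from the set of derivatives at \<open>x\<close>, and
  functions that agree near \<open>x\<close> share this set.\<close>

lemma ddir_cong:
  assumes "open S" "x \<in> S" "\<And>y. y \<in> S \<Longrightarrow> F y = G y"
  shows "ddir h F x = ddir h G x"
proof -
  have "(F has_derivative D) (at x) \<longleftrightarrow> (G has_derivative D) (at x)" for D
    using has_derivative_transform_within_open[of F D x UNIV S G]
      has_derivative_transform_within_open[of G D x UNIV S F] assms by auto
  then show ?thesis
    unfolding ddir_def frechet_derivative_def by simp
qed

lemma differentiable_cong_open:
  assumes "open S" "x \<in> S" "\<And>y. y \<in> S \<Longrightarrow> F y = G y"
  shows "F differentiable (at x) \<longleftrightarrow> G differentiable (at x)"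
proof -
  have "(F has_derivative D) (at x) \<longleftrightarrow> (G has_derivative D) (at x)" for D
    using has_derivative_transform_within_open[of F D x UNIV S G]
      has_derivative_transform_within_open[of G D x UNIV S F] assms by auto
  then show ?thesis by (simp add: differentiable_def)
qed

lemma Ck_on_cong:
  assumes "open S" "\<And>x. x \<in> S \<Longrightarrow> F x = G x"
  shows "Ck_on k S F \<longleftrightarrow> Ck_on k S G"
  using assms(2)
proof (induction k arbitrary: F G)
  case 0
  then show ?case by (auto cong: continuous_on_cong)
next
  case (Suc k)
  have "Ck_on k S (ddir h F) \<longleftrightarrow> Ck_on k S (ddir h G)" for h
    by (rule Suc.IH) (use ddir_cong[OF assms(1)] Suc.prems in blast)
  then show ?case
    unfolding Ck_on_Suc_ddir using differentiable_cong_open[OF assms(1)] Suc.prems by blast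
qed

lemma Ck_on_subset: "Ck_on k S F \<Longrightarrow> T \<subseteq> S \<Longrightarrow> Ck_on k T F"
  by (induction k arbitrary: F) (auto simp: Ck_on_Suc_ddir intro: continuous_on_subset)

lemma Ck_on_SucD: "Ck_on (Suc k) S F \<Longrightarrow> Ck_on k S F"
proof (induction k arbitrary: F)
  case 0
  then show ?case
    by (simp add: Ck_on_Suc_ddir differentiable_imp_continuous_on differentiable_on_def
        differentiable_at_withinI)
qed (subst Ck_on_Suc_ddir, simp add: Ck_on_Suc_ddir)

lemma Ck_on_continuous_on: "Ck_on k S F \<Longrightarrow> continuous_on S F"
  by (induction k) (auto dest: Ck_on_SucD)

text \<open>The working form of the recursion: an explicit formula replaces the chosen derivative
  \<open>ddir h F\<close>, so that a closure property becomes an induction on \<open>k\<close> with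
  the usual differentiation rule as its step.\<close>

lemma Ck_on_SucI:
  assumes "open S" "\<And>x. x \<in> S \<Longrightarrow> (F has_derivative F' x) (at x)"
    and "\<And>h. Ck_on k S (\<lambda>x. F' x h)"
  shows "Ck_on (Suc k) S F"
  unfolding Ck_on_Suc_ddir
proof (intro conjI ballI allI)
  fix x assume "x \<in> S"
  then show "F differentiable (at x)" using assms(2) by (auto simp: differentiable_def)
next
  fix h
  have "Ck_on k S (\<lambda>x. F' x h) \<longleftrightarrow> Ck_on k S (ddir h F)"
    by (rule Ck_on_cong[OF assms(1)]) (use ddir_eqI[OF assms(2)] in metis)
  then show "Ck_on k S (ddir h F)" using assms(3) by simp
qed

lemma Ck_on_has_derivative:
  "Ck_on (Suc k) S F \<Longrightarrow> x \<in> S \<Longrightarrow> (F has_derivative (\<lambda>h. ddir h F x)) (at x)"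
  by (rule has_derivative_ddir) (simp add: Ck_on_Suc_ddir)

lemma Ck_on_const: "open S \<Longrightarrow> Ck_on k S (\<lambda>x. c)"
proof (induction k arbitrary: c)
  case (Suc k)
  then show ?case by (intro Ck_on_SucI[where F'="\<lambda>x h. 0"]) auto
qed simp

lemma Ck_on_bounded_linear:
  assumes "open S" "bounded_linear F" shows "Ck_on k S F"
proof (cases k)
  case 0
  then show ?thesis using assms by (simp add: linear_continuous_on)
next
  case (Suc k')
  show ?thesis unfolding Suc
    by (rule Ck_on_SucI[where F'="\<lambda>x. F"])
       (use assms in \<open>auto intro: bounded_linear_imp_has_derivative Ck_on_const\<close>)
qed

lemma Ck_on_add:
  assumes "open S" shows "Ck_on k S F \<Longrightarrow> Ck_on k S G \<Longrightarrow> Ck_on k S (\<lambda>x. F x + G x)"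
proof (induction k arbitrary: F G)
  case 0
  then show ?case by (auto intro: continuous_on_add)
next
  case (Suc k)
  show ?case
    by (rule Ck_on_SucI[OF assms has_derivative_add[OF Ck_on_has_derivative[OF Suc.prems(1)]
            Ck_on_has_derivative[OF Suc.prems(2)]]])
       (use Suc Ck_on_Suc_ddir in blast)+
qed

lemma Ck_on_mult:
  assumes "open S" shows "Ck_on k S F \<Longrightarrow> Ck_on k S G \<Longrightarrow> Ck_on k S (\<lambda>x. F x * G x)"
proof (induction k arbitrary: F G)
  case 0
  then show ?case by (auto intro: continuous_on_mult)
next
  case (Suc k)
  have *: "Ck_on k S F" "Ck_on k S G" "\<And>h. Ck_on k S (ddir h F)" "\<And>h. Ck_on k S (ddir h G)"
    using Suc.prems Ck_on_SucD Ck_on_Suc_ddir by blast+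
  show ?case
  proof (rule Ck_on_SucI[OF assms has_derivative_mult[OF Ck_on_has_derivative[OF Suc.prems(1)]
            Ck_on_has_derivative[OF Suc.prems(2)]]])
    show "Ck_on k S (\<lambda>x. F x * ddir h G x + ddir h F x * G x)" for h
      by (intro Ck_on_add assms Suc.IH *)
  qed
qed

lemma Ck_on_sum:
  assumes "open S" shows "(\<And>i. i \<in> B \<Longrightarrow> Ck_on k S (F i)) \<Longrightarrow> Ck_on k S (\<lambda>x. \<Sum>i\<in>B. F i x)"
  by (induction B rule: infinite_finite_induct) (auto intro: Ck_on_const Ck_on_add assms)

text \<open>By the chain rule the derivative is a sum of products of a coordinate derivative of
  \<open>\<Gamma>\<close> with \<open>ddir b g\<close> composed with the same
  \<open>\<Gamma>\<close>. The induction therefore generalises over \<open>g\<close> and keeps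
  \<open>\<Gamma>\<close> fixed.\<close>

lemma Ck_on_compose:
  fixes g :: "'b::euclidean_space \<Rightarrow> real" and \<Gamma> :: "'a::euclidean_space \<Rightarrow> 'b"
  assumes "open S" "\<Gamma> ` S \<subseteq> T"
  shows "Ck_on k T g \<Longrightarrow> (\<And>b. b \<in> Basis \<Longrightarrow> Ck_on k S (\<lambda>x. \<Gamma> x \<bullet> b)) \<Longrightarrow> Ck_on k S (\<lambda>x. g (\<Gamma> x))"
proof (induction k arbitrary: g)
  case 0
  then have "continuous_on S \<Gamma>"
    by (subst continuous_on_componentwise) auto
  then show ?case using 0 assms(2) by (auto intro: continuous_on_compose2)
next
  case (Suc k)
  let ?d = "\<lambda>x h. \<Sum>b\<in>Basis. ddir h (\<lambda>x. \<Gamma> x \<bullet> b) x *\<^sub>R b"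
  have \<Gamma>: "(\<Gamma> has_derivative ?d x) (at x)" if "x \<in> S" for x
    apply (subst has_derivative_componentwise_within)
    using Ck_on_has_derivative[OF Suc.prems(2) that]
    by (auto simp: inner_sum_left inner_Basis if_distrib sum.If_cases Int_absorb1 cong: if_cong)
  have g: "(g has_derivative (\<lambda>h. ddir h g (\<Gamma> x))) (at (\<Gamma> x))" if "x \<in> S" for x
    using Ck_on_has_derivative[OF Suc.prems(1)] that assms(2) by blast
  have "((\<lambda>x. g (\<Gamma> x)) has_derivative
      (\<lambda>h. \<Sum>b\<in>Basis. ddir h (\<lambda>x. \<Gamma> x \<bullet> b) x * ddir b g (\<Gamma> x))) (at x)" if "x \<in> S" for x
  proof -
    have "linear (\<lambda>h. ddir h g (\<Gamma> x))"
      using g[OF that] has_derivative_linear by blast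
    then have "ddir (?d x h) g (\<Gamma> x) = (\<Sum>b\<in>Basis. ddir h (\<lambda>x. \<Gamma> x \<bullet> b) x * ddir b g (\<Gamma> x))" for h
      by (simp add: linear_sum[OF \<open>linear _\<close>] linear_scale[OF \<open>linear _\<close>])
    then show ?thesis
      using has_derivative_compose[OF \<Gamma>[OF that] g[OF that]] by (simp add: o_def)
  qed
  then show ?case
  proof (rule Ck_on_SucI[OF assms(1)])
    fix h
    show "Ck_on k S (\<lambda>x. \<Sum>b\<in>Basis. ddir h (\<lambda>x. \<Gamma> x \<bullet> b) x * ddir b g (\<Gamma> x))"
    proof (intro Ck_on_sum Ck_on_mult assms)
      fix b :: 'b assume b: "b \<in> Basis"
      show "Ck_on k S (ddir h (\<lambda>x. \<Gamma> x \<bullet> b))"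
        using Suc.prems(2)[OF b] by (simp add: Ck_on_Suc_ddir)
      show "Ck_on k S (\<lambda>x. ddir b g (\<Gamma> x))"
        by (rule Suc.IH) (use Suc.prems(1) Ck_on_SucD[OF Suc.prems(2)] in \<open>auto simp: Ck_on_Suc_ddir\<close>)
    qed
  qed
qed

text \<open>The derivative is a polynomial in the function itself, so smoothness of order
  \<open>k\<close> raises itself to order \<open>k + 1\<close>. For \<open>sqrt\<close> the
  derivative involves the inverse of the function, and \<open>sin\<close> and \<open>cos\<close>
  have to be treated together.\<close>

lemma Ck_on_inverse: "Ck_on k (- {0}) (inverse :: real \<Rightarrow> real)"
proof (induction k)
  case 0
  then show ?case by (auto intro!: continuous_intros)
next
  case (Suc k)
  show ?case
  proof (rule Ck_on_SucI)
    fix x :: real assume "x \<in> - {0}"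
    then show "(inverse has_derivative (\<lambda>h. (- h) * (inverse x * inverse x))) (at x)"
      by (auto intro!: derivative_eq_intros simp: ac_simps)
  next
    show "Ck_on k (- {0}) (\<lambda>x::real. (- h) * (inverse x * inverse x))" for h
      by (intro Ck_on_mult Ck_on_const Suc) auto
  qed auto
qed

lemma Ck_on_sqrt: "Ck_on k {0<..} sqrt"
proof (induction k)
  case 0
  then show ?case by (auto intro!: continuous_intros)
next
  case (Suc k)
  have i: "Ck_on k {0<..} (\<lambda>x. inverse (sqrt x))"
    by (rule Ck_on_compose[OF _ _ Ck_on_inverse]) (auto intro: Suc)
  show ?case
  proof (rule Ck_on_SucI)
    fix x :: real assume "x \<in> {0<..}"
    then show "(sqrt has_derivative (\<lambda>h. (h / 2) * inverse (sqrt x))) (at x)"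
      by (auto intro!: derivative_eq_intros simp: divide_simps)
  next
    show "Ck_on k {0<..} (\<lambda>x::real. (h / 2) * inverse (sqrt x))" for h
      by (intro Ck_on_mult Ck_on_const i) auto
  qed auto
qed

lemma Ck_on_sin_cos: "Ck_on k UNIV (sin :: real \<Rightarrow> real) \<and> Ck_on k UNIV (cos :: real \<Rightarrow> real)"
proof (induction k)
  case 0
  then show ?case by (auto intro!: continuous_intros)
next
  case (Suc k)
  have "(sin has_derivative (\<lambda>h. h * cos x)) (at x)"
    "(cos has_derivative (\<lambda>h. (- h) * sin x)) (at x)" for x :: real
    by (auto intro!: derivative_eq_intros)
  with Suc show ?case
    by (intro conjI Ck_on_SucI[OF open_UNIV, of sin] Ck_on_SucI[OF open_UNIV, of cos])
       (assumption | intro Ck_on_mult Ck_on_const open_UNIV | simp)+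
qed

subsection \<open>Closure properties\<close>

text \<open>\<open>Ck_on\<close> speaks of real-valued functions; the inner maps of compositions
  take values in product spaces and are treated by coordinates.\<close>

definition smooth_map :: "'a::euclidean_space set \<Rightarrow> ('a \<Rightarrow> 'b::euclidean_space) \<Rightarrow> bool" where
  "smooth_map S \<Gamma> \<longleftrightarrow> (\<forall>b\<in>Basis. smooth_on S (\<lambda>x. \<Gamma> x \<bullet> b))"

lemma smooth_map_real [simp]: "smooth_map S (F :: _ \<Rightarrow> real) \<longleftrightarrow> smooth_on S F"
  by (simp add: smooth_map_def)

lemma smooth_map_Pair:
  assumes "smooth_map S A" "smooth_map S B" shows "smooth_map S (\<lambda>x. (A x, B x))"
  using assms by (auto simp: smooth_map_def Basis_prod_def)

lemma smooth_map_bounded_linear: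
  assumes "open S" "bounded_linear F" shows "smooth_map S F"
  unfolding smooth_map_def smooth_on_def
  by (intro ballI allI Ck_on_bounded_linear assms bounded_linear_inner_left_comp)

lemma smooth_on_const: "open S \<Longrightarrow> smooth_on S (\<lambda>x. c)"
  by (simp add: smooth_on_def Ck_on_const)

lemma smooth_map_const: "open S \<Longrightarrow> smooth_map S (\<lambda>x. c)"
  by (simp add: smooth_map_def smooth_on_const)

lemma smooth_map_id: "open S \<Longrightarrow> smooth_map S (\<lambda>x. x)"
  and smooth_map_fst: "open T \<Longrightarrow> smooth_map T (\<lambda>x. fst x)"
  and smooth_map_snd: "open T \<Longrightarrow> smooth_map T (\<lambda>x. snd x)"
  by (intro smooth_map_bounded_linear bounded_linear_ident bounded_linear_fst bounded_linear_snd; simp)+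

lemma smooth_on_bounded_linear: "open S \<Longrightarrow> bounded_linear F \<Longrightarrow> smooth_on S F"
  by (simp add: smooth_on_def Ck_on_bounded_linear)

lemma smooth_on_compose:
  assumes "smooth_on T g" "open S" "smooth_map S \<Gamma>" "\<And>x. x \<in> S \<Longrightarrow> \<Gamma> x \<in> T"
  shows "smooth_on S (\<lambda>x. g (\<Gamma> x))"
  using assms unfolding smooth_on_def smooth_map_def
  by (auto intro: Ck_on_compose[where T=T and g=g])

context
  fixes S :: "'a::euclidean_space set"
  assumes S: "open S"
begin

lemma smooth_on_add: "smooth_on S F \<Longrightarrow> smooth_on S G \<Longrightarrow> smooth_on S (\<lambda>x. F x + G x)"
  and smooth_on_mult: "smooth_on S F \<Longrightarrow> smooth_on S G \<Longrightarrow> smooth_on S (\<lambda>x. F x * G x)"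
  using Ck_on_add[OF S] Ck_on_mult[OF S] by (auto simp: smooth_on_def)

lemma smooth_on_minus: "smooth_on S F \<Longrightarrow> smooth_on S (\<lambda>x. - F x)"
  using smooth_on_mult[OF smooth_on_const[OF S, of "-1"]] by simp

lemma smooth_on_diff: "smooth_on S F \<Longrightarrow> smooth_on S G \<Longrightarrow> smooth_on S (\<lambda>x. F x - G x)"
  using smooth_on_add[OF _ smooth_on_minus, of F G] by simp

lemma smooth_on_power: "smooth_on S F \<Longrightarrow> smooth_on S (\<lambda>x. F x ^ n)"
  by (induction n) (auto intro: smooth_on_const[OF S] smooth_on_mult)

lemma smooth_on_inverse:
  "smooth_on S F \<Longrightarrow> (\<And>x. x \<in> S \<Longrightarrow> F x \<noteq> 0) \<Longrightarrow> smooth_on S (\<lambda>x. inverse (F x))"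
  by (rule smooth_on_compose[where T="- {0}"]) (use S Ck_on_inverse in \<open>auto simp: smooth_on_def[of _ inverse]\<close>)

lemma smooth_on_divide:
  "smooth_on S F \<Longrightarrow> smooth_on S G \<Longrightarrow> (\<And>x. x \<in> S \<Longrightarrow> G x \<noteq> 0) \<Longrightarrow> smooth_on S (\<lambda>x. F x / G x)"
  unfolding divide_inverse by (intro smooth_on_mult smooth_on_inverse)

lemma smooth_on_sqrt:
  "smooth_on S F \<Longrightarrow> (\<And>x. x \<in> S \<Longrightarrow> F x > 0) \<Longrightarrow> smooth_on S (\<lambda>x. sqrt (F x))"
  by (rule smooth_on_compose[where T="{0<..}"]) (use S Ck_on_sqrt in \<open>auto simp: smooth_on_def[of _ sqrt]\<close>)

lemma smooth_on_sin: "smooth_on S F \<Longrightarrow> smooth_on S (\<lambda>x. sin (F x))"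
  and smooth_on_cos: "smooth_on S F \<Longrightarrow> smooth_on S (\<lambda>x. cos (F x))"
  by (rule smooth_on_compose[where T=UNIV]; use S Ck_on_sin_cos in
      \<open>auto simp: smooth_on_def[of _ sin] smooth_on_def[of _ cos]\<close>)+

lemma smooth_on_cong: "(\<And>x. x \<in> S \<Longrightarrow> F x = G x) \<Longrightarrow> smooth_on S F \<longleftrightarrow> smooth_on S G"
  unfolding smooth_on_def by (intro all_cong1 Ck_on_cong[OF S])

end

lemma smooth_on_subset: "smooth_on S F \<Longrightarrow> T \<subseteq> S \<Longrightarrow> smooth_on T F"
  unfolding smooth_on_def by (auto intro: Ck_on_subset)

lemma smooth_map_subset: "smooth_map S F \<Longrightarrow> T \<subseteq> S \<Longrightarrow> smooth_map T F"
  unfolding smooth_map_def by (auto intro: smooth_on_subset)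

lemma smooth_on_ddir: "smooth_on S F \<Longrightarrow> smooth_on S (ddir h F)"
  unfolding smooth_on_def
proof
  fix k assume "\<forall>k. Ck_on k S F"
  then have "Ck_on (Suc k) S F" by blast
  then show "Ck_on k S (ddir h F)" by (simp add: Ck_on_Suc_ddir)
qed

lemma smooth_on_has_derivative:
  "smooth_on S F \<Longrightarrow> x \<in> S \<Longrightarrow> (F has_derivative (\<lambda>h. ddir h F x)) (at x)"
  unfolding smooth_on_def by (rule Ck_on_has_derivative[of 0]) simp_all

lemma smooth_on_differentiable: "smooth_on S F \<Longrightarrow> x \<in> S \<Longrightarrow> F differentiable (at x)"
  by (rule differentiableI[OF smooth_on_has_derivative])

lemma smooth_on_continuous_on: "smooth_on S F \<Longrightarrow> continuous_on S F"
  unfolding smooth_on_def by (auto intro: Ck_on_continuous_on)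

lemma smooth_map_continuous_on: "smooth_map S F \<Longrightarrow> continuous_on S F"
  by (subst continuous_on_componentwise) (auto simp: smooth_map_def smooth_on_continuous_on)

lemma linear_ddir: "F differentiable (at x) \<Longrightarrow> linear (\<lambda>h. ddir h F x)"
  by (rule has_derivative_linear[OF has_derivative_ddir])

lemma ddir_compose:
  assumes "g differentiable (at (\<Gamma> x))" "(\<Gamma> has_derivative \<Gamma>') (at x)"
  shows "ddir h (\<lambda>x. g (\<Gamma> x)) x = ddir (\<Gamma>' h) g (\<Gamma> x)"
  by (rule ddir_eqI[OF has_derivative_compose[OF assms(2) has_derivative_ddir[OF assms(1)]]])

lemma ddir_vector_derivative:
  assumes "g differentiable (at (\<Gamma> t))" "(\<Gamma> has_vector_derivative \<Gamma>') (at t)"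
  shows "((\<lambda>t. g (\<Gamma> t)) has_real_derivative ddir \<Gamma>' g (\<Gamma> t)) (at t)"
proof -
  have "ddir (h *\<^sub>R \<Gamma>') g (\<Gamma> t) = h * ddir \<Gamma>' g (\<Gamma> t)" for h
    using linear_scale[OF linear_ddir[OF assms(1)]] by simp
  then show ?thesis
    using has_derivative_compose[OF assms(2)[unfolded has_vector_derivative_def] has_derivative_ddir[OF assms(1)]]
    by (simp add: has_field_derivative_def mult_commute_abs o_def)
qed

subsection \<open>Parametric integrals\<close>

text \<open>The product \<open>S \<times> cbox a b\<close> is in general not open because the box is
  closed. Allowing a larger \<open>D\<close> lets the smoothness of \<open>F\<close> be proved on an
  open set, where the closure rules apply.\<close>

lemma
  fixes F :: "'a::euclidean_space \<times> 'b::euclidean_space \<Rightarrow> real"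
  assumes S: "open S" and D: "S \<times> cbox a b \<subseteq> D" and F: "Ck_on (Suc k) D F" and x: "x \<in> S"
  shows has_derivative_parametric: "((\<lambda>x. integral (cbox a b) (\<lambda>t. F (x, t))) has_derivative
      (\<lambda>h. integral (cbox a b) (\<lambda>t. ddir (h, 0) F (x, t)))) (at x)"
proof -
  obtain r where r: "r > 0" "ball x r \<subseteq> S" using S x open_contains_ball by blast
  define U where "U = ball x r"
  have U: "open U" "convex U" "x \<in> U" "U \<subseteq> S" using r by (auto simp: U_def)
  have contF: "continuous_on D (ddir h F)" for h
    using F Ck_on_Suc_ddir Ck_on_continuous_on by blast
  have der: "(F has_derivative (\<lambda>h. ddir h F y)) (at y)" if "y \<in> D" for y
    using F Ck_on_has_derivative that by blast
  \<comment> \<open>The Leibniz rule asks for continuity of the derivative in operator norm, hence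
    the bounded linear functions; in finite dimension this is checked direction by
    direction.\<close>
  define fx where "fx = (\<lambda>y t. Blinfun (\<lambda>h. ddir (h, 0) F (y, t)))"
  have der': "((\<lambda>y. F (y, t)) has_derivative (\<lambda>h. ddir (h, 0) F (y, t))) (at y)"
    if "y \<in> U" "t \<in> cbox a b" for y t
  proof -
    have "((\<lambda>y. (y, t)) has_derivative (\<lambda>h. (h, 0))) (at y)"
      by (auto intro!: derivative_eq_intros)
    from has_derivative_compose[OF this der] show ?thesis using that D U by auto
  qed
  then have fx: "blinfun_apply (fx y t) = (\<lambda>h. ddir (h, 0) F (y, t))" if "y \<in> U" "t \<in> cbox a b" for y t
    using that unfolding fx_def by (auto intro!: bounded_linear_Blinfun_apply has_derivative_bounded_linear)
  have cfx: "continuous_on (U \<times> cbox a b) (\<lambda>(y, t). fx y t)"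
  proof (rule continuous_on_blinfun_componentwise)
    fix i :: 'a
    have "continuous_on (U \<times> cbox a b) (ddir (i, 0) F)"
      using contF D U by (blast intro: continuous_on_subset)
    then show "continuous_on (U \<times> cbox a b) (\<lambda>z. blinfun_apply (case z of (y, t) \<Rightarrow> fx y t) i)"
      by (rule continuous_on_eq) (auto simp: fx)
  qed
  have "continuous_on (cbox a b) (\<lambda>t. case (x, t) of (y, t) \<Rightarrow> fx y t)"
    by (rule continuous_on_compose2[OF cfx]) (use U in \<open>auto intro!: continuous_on_Pair continuous_on_const continuous_on_id\<close>)
  then have int: "fx x integrable_on cbox a b"
    by (simp add: integrable_continuous)
  have "continuous_on (cbox a b) (\<lambda>t. F (y, t))" if "y \<in> U" for y
    by (rule continuous_on_compose2[OF Ck_on_continuous_on[OF F]])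
       (use that D U in \<open>auto intro!: continuous_on_Pair continuous_on_const continuous_on_id\<close>)
  then have "(\<lambda>t. F (y, t)) integrable_on cbox a b" if "y \<in> U" for y
    using that by (simp add: integrable_continuous)
  moreover have "((\<lambda>y. F (y, t)) has_derivative blinfun_apply (fx y t)) (at y within U)"
    if "y \<in> U" "t \<in> cbox a b" for y t
    unfolding fx[OF that] by (rule has_derivative_at_withinI[OF der'[OF that]])
  ultimately have "((\<lambda>x. integral (cbox a b) (\<lambda>t. F (x, t))) has_derivative blinfun_apply (integral (cbox a b) (fx x)))
      (at x within U)"
    using cfx U(3,2) by (intro leibniz_rule[where f="\<lambda>y t. F (y, t)"])
  also have "blinfun_apply (integral (cbox a b) (fx x)) = (\<lambda>h. integral (cbox a b) (\<lambda>t. ddir (h, 0) F (x, t)))"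
  proof
    fix h
    show "blinfun_apply (integral (cbox a b) (fx x)) h = integral (cbox a b) (\<lambda>t. ddir (h, 0) F (x, t))"
      unfolding blinfun_apply_integral[OF int] by (rule integral_cong) (simp add: fx[OF U(3)])
  qed
  finally show ?thesis using at_within_open[OF U(3,1)] by simp
qed

lemma Ck_on_parametric:
  fixes F :: "'a::euclidean_space \<times> 'b::euclidean_space \<Rightarrow> real"
  assumes S: "open S" and D: "S \<times> cbox a b \<subseteq> D"
  shows "Ck_on k D F \<Longrightarrow> Ck_on k S (\<lambda>x. integral (cbox a b) (\<lambda>t. F (x, t)))"
proof (induction k arbitrary: F)
  case 0
  then have "continuous_on (S \<times> cbox a b) (\<lambda>(x, t). F (x, t))"
    using D continuous_on_subset by auto
  then show ?case using integral_continuous_on_param[of S a b "\<lambda>x t. F (x, t)"] by simp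
next
  case (Suc k)
  show ?case
    by (rule Ck_on_SucI[OF S has_derivative_parametric[OF S D Suc.prems]])
       (use Suc Ck_on_Suc_ddir in blast)+
qed

lemma smooth_on_parametric:
  fixes F :: "'a::euclidean_space \<times> 'b::euclidean_space \<Rightarrow> real"
  assumes "open S" "S \<times> cbox a b \<subseteq> D" "smooth_on D F"
  shows "smooth_on S (\<lambda>x. integral (cbox a b) (\<lambda>t. F (x, t)))"
    and "x \<in> S \<Longrightarrow> ddir h (\<lambda>x. integral (cbox a b) (\<lambda>t. F (x, t))) x
      = integral (cbox a b) (\<lambda>t. ddir (h, 0) F (x, t))"
proof -
  show "smooth_on S (\<lambda>x. integral (cbox a b) (\<lambda>t. F (x, t)))"
    using assms(3) Ck_on_parametric[OF assms(1,2)] by (simp add: smooth_on_def)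
  have "Ck_on (Suc 0) D F" using assms(3) unfolding smooth_on_def by blast
  from ddir_eqI[OF has_derivative_parametric[OF assms(1,2) this]]
  show "x \<in> S \<Longrightarrow> ddir h (\<lambda>x. integral (cbox a b) (\<lambda>t. F (x, t))) x
      = integral (cbox a b) (\<lambda>t. ddir (h, 0) F (x, t))" by blast
qed

section \<open>Further rules for smooth maps and directional derivatives\<close>

lemma smooth_map_add:
  assumes "open S" "smooth_map S A" "smooth_map S B" shows "smooth_map S (\<lambda>x. A x + B x)"
  using assms by (auto simp: smooth_map_def inner_add_left intro: smooth_on_add)

lemma smooth_map_scaleR:
  assumes "open S" "smooth_on S A" "smooth_map S B" shows "smooth_map S (\<lambda>x. A x *\<^sub>R B x)"
  using assms by (auto simp: smooth_map_def intro: smooth_on_mult)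

lemma open_preimage:
  assumes "open A" "continuous_on A \<Gamma>" "open T" shows "open {z\<in>A. \<Gamma> z \<in> T}"
  using assms continuous_on_open_vimage[OF assms(1), of \<Gamma>]
  by (auto simp: vimage_def Collect_conj_eq Int_commute)

lemma ddir_scaleR: "F differentiable (at x) \<Longrightarrow> ddir (c *\<^sub>R h) F x = c * ddir h F x"
  using linear_scale[OF linear_ddir] by fastforce

lemma ddir_add_dir: "F differentiable (at x) \<Longrightarrow> ddir (h + k) F x = ddir h F x + ddir k F x"
  by (rule linear_add[OF linear_ddir])

lemma ddir_prod_split:
  fixes F :: "real \<times> 'p::euclidean_space \<Rightarrow> real"
  assumes "F differentiable (at x)"
  shows "ddir (s, q) F x = s * ddir (1, 0) F x + ddir (0, q) F x"
  using ddir_add_dir[OF assms, of "s *\<^sub>R (1, 0)" "(0, q)"] ddir_scaleR[OF assms, of s "(1,0)"] by simp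

context
  fixes F G :: "'a::euclidean_space \<Rightarrow> real" and x :: 'a
  assumes FG: "F differentiable (at x)" "G differentiable (at x)"
begin

lemma ddir_diff: "ddir h (\<lambda>x. F x - G x) x = ddir h F x - ddir h G x"
  and ddir_mult: "ddir h (\<lambda>x. F x * G x) x = F x * ddir h G x + ddir h F x * G x"
  by (rule ddir_eqI derivative_eq_intros has_derivative_ddir FG refl ext | simp)+

end

lemma ddir_real_has_field_derivative:
  fixes F :: "real \<Rightarrow> real"
  assumes "F differentiable (at x)"
  shows "(F has_real_derivative ddir 1 F x) (at x)"
  using ddir_vector_derivative[of F "\<lambda>t. t" x 1] assms by simp

lemma has_real_derivative_fst:
  assumes "F differentiable (at (v, p))"
  shows "((\<lambda>v. F (v, p)) has_real_derivative ddir (1, 0) F (v, p)) (at v)"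
  using assms by (rule ddir_vector_derivative) (auto intro!: derivative_eq_intros simp: has_vector_derivative_def)

lemma ddir_snd:
  assumes "F differentiable (at (v, p))"
  shows "ddir q (\<lambda>p. F (v, p)) p = ddir (0, q) F (v, p)"
  using assms by (rule ddir_compose) (auto intro!: derivative_eq_intros)

subsection \<open>Symmetry of second derivatives\<close>

lemma fundamental_theorem_segment:
  fixes F :: "'a::euclidean_space \<Rightarrow> real"
  assumes "smooth_on S F" "\<And>s. s \<in> {0..1} \<Longrightarrow> y + s *\<^sub>R k \<in> S"
  shows "((\<lambda>s. ddir k F (y + s *\<^sub>R k)) has_integral F (y + k) - F y) {0..1}"
proof -
  have "((\<lambda>s. F (y + s *\<^sub>R k)) has_real_derivative ddir k F (y + s *\<^sub>R k)) (at s)" if "s \<in> {0..1}" for s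
    by (rule ddir_vector_derivative)
      (use assms that in \<open>auto intro!: smooth_on_differentiable derivative_eq_intros simp: has_vector_derivative_def\<close>)
  then have "((\<lambda>s. F (y + s *\<^sub>R k)) has_vector_derivative ddir k F (y + s *\<^sub>R k)) (at s within {0..1})" if "s \<in> {0..1}" for s
    using that by (simp add: has_real_derivative_iff_has_vector_derivative has_vector_derivative_at_within)
  from fundamental_theorem_of_calculus[OF _ this] show ?thesis by simp
qed

text \<open>\<open>F (y + t k) - F y\<close> is \<open>t\<close> times an integral mean of
  \<open>ddir k F\<close> over the segment. Differentiating this in \<open>y\<close> under the
  integral shows that the difference quotient of \<open>ddir h F\<close> in direction
  \<open>k\<close> is a mean of \<open>ddir h (ddir k F)\<close>, and
  \<open>t \<rightarrow> 0\<close> gives the claim.\<close>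

theorem ddir_commute:
  fixes F :: "'a::euclidean_space \<Rightarrow> real"
  assumes S: "open S" "x \<in> S" and F: "smooth_on S F"
  shows "ddir h (ddir k F) x = ddir k (ddir h F) x"
proof -
  obtain r where r: "r > 0" "ball x r \<subseteq> S" using S open_contains_ball by blast
  \<comment> \<open>Half of the radius is left for the base point \<open>y\<close> and half for the
    displacement; the \<open>+ 1\<close> covers \<open>k = 0\<close>.\<close>
  define \<epsilon> where "\<epsilon> = r / (2 * (norm k + 1))"
  have \<epsilon>: "\<epsilon> > 0" using r by (simp add: \<epsilon>_def add_nonneg_pos)
  define U where "U = ball x (r / 2)"
  have U: "open U" "x \<in> U" using r by (auto simp: U_def)
  have small: "y + (s * t) *\<^sub>R k \<in> S" if "y \<in> U" "s \<in> {0..1}" "\<bar>t\<bar> < \<epsilon>" for y s t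
  proof -
    have "norm ((s * t) *\<^sub>R k) \<le> \<bar>t\<bar> * norm k"
      using that by (simp add: abs_mult mult_left_le_one_le mult_right_mono)
    also have "\<dots> \<le> \<epsilon> * (norm k + 1)" using that by (intro mult_mono) auto
    also have "\<dots> = r / 2" by (simp add: \<epsilon>_def field_simps add_nonneg_eq_0_iff)
    finally have "dist x (y + (s * t) *\<^sub>R k) < r"
      using that(1) norm_triangle_ineq4[of "x - y" "(s * t) *\<^sub>R k"]
      by (simp add: U_def dist_norm algebra_simps)
    then show ?thesis using r by auto
  qed
  define Hk where "Hk = ddir h (ddir k F)"
  have sHk: "smooth_on S Hk" and sk: "smooth_on S (ddir k F)"
    using F by (auto simp: Hk_def intro: smooth_on_ddir)
  have eq: "ddir h F (x + t *\<^sub>R k) - ddir h F x = t * integral {0..1} (\<lambda>s. Hk (x + (s * t) *\<^sub>R k))"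
    if t: "\<bar>t\<bar> < \<epsilon>" for t
  proof -
    define D where "D = {z \<in> UNIV. fst z + (snd z * t) *\<^sub>R k \<in> S}"
    have D: "open D" unfolding D_def by (rule open_preimage) (auto intro!: continuous_intros S)
    have UD: "U \<times> cbox 0 1 \<subseteq> D" using small t by (auto simp: D_def)
    have map: "smooth_map D (\<lambda>z. fst z + (snd z * t) *\<^sub>R k)"
      using D by (intro smooth_map_add smooth_map_scaleR smooth_on_mult smooth_on_const smooth_map_const
          smooth_map_fst smooth_on_bounded_linear bounded_linear_snd)
    have sm: "smooth_on D (\<lambda>z. ddir k F (fst z + (snd z * t) *\<^sub>R k))"
      by (rule smooth_on_compose[OF sk D map]) (simp add: D_def)
    have dd: "ddir (h, 0) (\<lambda>z. ddir k F (fst z + (snd z * t) *\<^sub>R k)) (x, s) = Hk (x + (s * t) *\<^sub>R k)"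
      if "s \<in> {0..1}" for s
      unfolding Hk_def
      by (subst ddir_compose[where \<Gamma>="\<lambda>z. fst z + (snd z * t) *\<^sub>R k" and \<Gamma>'="\<lambda>z. fst z + (snd z * t) *\<^sub>R k"])
         (use small[OF U(2) that t] sk in \<open>auto intro!: smooth_on_differentiable derivative_eq_intros\<close>)
    have diffF: "F (y + t *\<^sub>R k) - F y = t * integral {0..1} (\<lambda>s. ddir k F (y + (s * t) *\<^sub>R k))" if "y \<in> U" for y
    proof -
      have "((\<lambda>s. ddir (t *\<^sub>R k) F (y + s *\<^sub>R (t *\<^sub>R k))) has_integral F (y + t *\<^sub>R k) - F y) {0..1}"
        by (rule fundamental_theorem_segment[OF F]) (use small[OF that _ t] in auto)
      then have "integral {0..1} (\<lambda>s. ddir (t *\<^sub>R k) F (y + s *\<^sub>R (t *\<^sub>R k))) = F (y + t *\<^sub>R k) - F y"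
        by (rule integral_unique)
      moreover have "integral {0..1} (\<lambda>s. ddir (t *\<^sub>R k) F (y + s *\<^sub>R (t *\<^sub>R k))) =
        integral {0..1} (\<lambda>s. t * ddir k F (y + (s * t) *\<^sub>R k))"
        by (rule integral_cong) (use small[OF that _ t] F in \<open>auto simp: ddir_scaleR smooth_on_differentiable\<close>)
      ultimately show ?thesis by simp
    qed
    have tk: "x + t *\<^sub>R k \<in> S" using small[OF U(2) _ t, of 1] by simp
    have "ddir h F (x + t *\<^sub>R k) - ddir h F x = ddir h (\<lambda>y. F (y + t *\<^sub>R k) - F y) x"
    proof -
      have c: "((\<lambda>y. y + t *\<^sub>R k) has_derivative (\<lambda>y. y)) (at x)" by (auto intro!: derivative_eq_intros)
      have F': "F differentiable at (x + t *\<^sub>R k)" "F differentiable at x"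
        using F tk S by (auto intro: smooth_on_differentiable)
      have "(\<lambda>y. F (y + t *\<^sub>R k)) differentiable at x"
        using has_derivative_compose[OF c has_derivative_ddir[OF F'(1)]] by (rule differentiableI)
      then show ?thesis
        using F' by (simp add: ddir_diff ddir_compose[where \<Gamma>="\<lambda>y. y + t *\<^sub>R k", OF _ c])
    qed
    also have "\<dots> = ddir h (\<lambda>y. t * integral (cbox 0 1) (\<lambda>s. ddir k F (fst (y, s) + (snd (y, s) * t) *\<^sub>R k))) x"
      by (rule ddir_cong[OF U]) (use diffF in simp)
    also have "\<dots> = t * ddir h (\<lambda>y. integral (cbox 0 1) (\<lambda>s. ddir k F (fst (y, s) + (snd (y, s) * t) *\<^sub>R k))) x"
      by (subst ddir_mult) (use smooth_on_parametric(1)[OF U(1) UD sm] U in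
          \<open>auto intro!: smooth_on_differentiable simp: ddir_eqI[OF has_derivative_const]\<close>)
    also have "ddir h (\<lambda>y. integral (cbox 0 1) (\<lambda>s. ddir k F (fst (y, s) + (snd (y, s) * t) *\<^sub>R k))) x
       = integral (cbox 0 1) (\<lambda>s. ddir (h, 0) (\<lambda>z. ddir k F (fst z + (snd z * t) *\<^sub>R k)) (x, s))"
      by (rule smooth_on_parametric(2)[OF U(1) UD sm U(2)])
    also have "\<dots> = integral (cbox 0 1) (\<lambda>s. Hk (x + (s * t) *\<^sub>R k))"
      by (rule integral_cong) (use dd in simp)
    finally show ?thesis by simp
  qed
  \<comment> \<open>At \<open>t = 0\<close> the mean is the value \<open>Hk x\<close> itself, so
    continuity in \<open>t\<close> evaluates the limit.\<close>
  define J where "J = (\<lambda>t. integral (cbox 0 1) (\<lambda>s. Hk (x + (s * t) *\<^sub>R k)))"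
  have "continuous_on {-\<epsilon><..<\<epsilon>} J" unfolding J_def
  proof (rule integral_continuous_on_param)
    show "continuous_on ({-\<epsilon><..<\<epsilon>} \<times> cbox 0 1) (\<lambda>(t, s). Hk (x + (s * t) *\<^sub>R k))"
      unfolding split_beta
      by (rule continuous_on_compose2[OF smooth_on_continuous_on[OF sHk]])
         (use small[OF U(2)] in \<open>auto intro!: continuous_intros\<close>)
  qed
  then have "isCont J 0" using \<epsilon> by (simp add: continuous_on_eq_continuous_at)
  then have J: "J \<midarrow>0\<rightarrow> Hk x" unfolding isCont_def by (simp add: J_def)
  have tr: "\<forall>\<^sub>F t in at 0. J t = (ddir h F (x + t *\<^sub>R k) - ddir h F x) / t"
    unfolding eventually_at using \<epsilon> eq by (intro exI[of _ \<epsilon>]) (auto simp: J_def dist_real_def)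
  have "((\<lambda>t. ddir h F (x + t *\<^sub>R k)) has_real_derivative ddir k (ddir h F) (x + 0 *\<^sub>R k)) (at 0)"
    by (rule ddir_vector_derivative)
      (use S F in \<open>auto intro!: smooth_on_differentiable smooth_on_ddir derivative_eq_intros simp: has_vector_derivative_def\<close>)
  then have "(\<lambda>t. (ddir h F (x + t *\<^sub>R k) - ddir h F x) / t) \<midarrow>0\<rightarrow> ddir k (ddir h F) x"
    by (simp add: has_field_derivative_iff)
  moreover have "(\<lambda>t. (ddir h F (x + t *\<^sub>R k) - ddir h F x) / t) \<midarrow>0\<rightarrow> Hk x"
    using Lim_transform_eventually[OF J tr] .
  ultimately show ?thesis
    using LIM_unique unfolding Hk_def by blast
qed

lemma smooth_on_deriv:
  fixes G :: "real \<Rightarrow> real"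
  assumes "open I" "smooth_on I G"
  shows "smooth_on I (deriv G)" and "v \<in> I \<Longrightarrow> (G has_real_derivative deriv G v) (at v)"
proof -
  have d: "(G has_real_derivative ddir 1 G v) (at v)" if "v \<in> I" for v
    by (rule ddir_real_has_field_derivative[OF smooth_on_differentiable[OF assms(2) that]])
  have "smooth_on I (deriv G) \<longleftrightarrow> smooth_on I (ddir 1 G)"
    by (rule smooth_on_cong[OF assms(1)]) (rule DERIV_imp_deriv[OF d])
  then show "smooth_on I (deriv G)" using smooth_on_ddir[OF assms(2)] by blast
  show "v \<in> I \<Longrightarrow> (G has_real_derivative deriv G v) (at v)"
    using d DERIV_imp_deriv[OF d] by simp
qed

section \<open>The normal form of a potential well\<close>

text \<open>An arbitrary Euclidean parameter space covers \<open>N = 1\<close> and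
  \<open>N = 2\<close> at once. \<open>\<mu>\<close> is not among the parameters \<open>p\<close>;
  \<open>vs\<close> and \<open>vS\<close> delimit the open set \<open>D\<close> on which the slope
  of the well changes sign only at \<open>v0\<close>.\<close>

locale potential_well =
  fixes I :: "real set" and u :: "real \<times> 'p::euclidean_space \<Rightarrow> real" and L :: "'p set"
    and v0 vs vS :: "'p \<Rightarrow> real" and \<kappa> :: "real \<Rightarrow> real"
  assumes open_I: "open I" and interval_I: "is_interval I" and open_L: "open L"
    and smooth_u: "smooth_on (I \<times> L) u" and smooth_v0: "smooth_on L v0"
    and cont_vs: "continuous_on L vs" and cont_vS: "continuous_on L vS"
    and smooth_\<kappa>: "smooth_on I \<kappa>" and \<kappa>_pos: "\<And>v. v \<in> I \<Longrightarrow> \<kappa> v > 0"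
    and in_I: "\<And>p. p \<in> L \<Longrightarrow> vs p \<in> I" "\<And>p. p \<in> L \<Longrightarrow> vS p \<in> I"
    and order: "\<And>p. p \<in> L \<Longrightarrow> vs p < v0 p" "\<And>p. p \<in> L \<Longrightarrow> v0 p < vS p"
    and crit: "\<And>p. p \<in> L \<Longrightarrow> ddir (1, 0) u (v0 p, p) = 0"
    and nondeg: "\<And>p. p \<in> L \<Longrightarrow> ddir (1, 0) (ddir (1, 0) u) (v0 p, p) > 0"
    and decr: "\<And>p v. p \<in> L \<Longrightarrow> vs p < v \<Longrightarrow> v < v0 p \<Longrightarrow> ddir (1, 0) u (v, p) < 0"
    and incr: "\<And>p v. p \<in> L \<Longrightarrow> v0 p < v \<Longrightarrow> v < vS p \<Longrightarrow> ddir (1, 0) u (v, p) > 0"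
begin

definition D :: "(real \<times> 'p) set" where
  "D = {(v, p). p \<in> L \<and> vs p < v \<and> v < vS p}"

definition \<mu>0 where "\<mu>0 p = u (v0 p, p)"

definition u1 where "u1 = ddir (1, 0) u"
definition u2 where "u2 = ddir (1, 0) u1"

lemma v0_in_D: "p \<in> L \<Longrightarrow> (v0 p, p) \<in> D"
  using order by (simp add: D_def)

lemma D_subset: "D \<subseteq> I \<times> L"
proof
  fix z assume "z \<in> D"
  then obtain v p where z: "z = (v, p)" "p \<in> L" "vs p < v" "v < vS p" by (auto simp: D_def)
  then have "v \<in> I" using in_I interval_I[unfolded is_interval_1] by (meson less_imp_le)
  then show "z \<in> I \<times> L" using z by simp
qed

lemma open_IL: "open (I \<times> L)" using open_I open_L by (rule open_Times)

lemma open_D: "open D"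
proof -
  have *: "D = {z \<in> UNIV \<times> L. (fst z - vs (snd z), vS (snd z) - fst z) \<in> {0<..} \<times> {0<..}}"
    by (auto simp: D_def)
  have "continuous_on (UNIV \<times> L) (\<lambda>z. f (snd z))" if "continuous_on L f" for f :: "'p \<Rightarrow> real"
    by (rule continuous_on_compose2[OF that]) (auto intro!: continuous_intros)
  from this[OF cont_vs] this[OF cont_vS] show ?thesis unfolding *
    by (intro open_preimage open_Times open_greaterThan continuous_intros open_UNIV open_L)
qed

lemma smooth_u1: "smooth_on (I \<times> L) u1" and smooth_u2: "smooth_on (I \<times> L) u2"
  using smooth_u by (auto simp: u1_def u2_def intro: smooth_on_ddir)

lemma smooth_map_snd_compose:
  "smooth_on L f \<Longrightarrow> open S \<Longrightarrow> S \<subseteq> A \<times> L \<Longrightarrow> smooth_on S (\<lambda>z. f (snd z))"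
  by (rule smooth_on_compose[where T=L and \<Gamma>=snd]) (auto intro: smooth_map_snd)

lemma D_segment:
  assumes "(v, p) \<in> D" "t \<in> {0..1}" shows "(v0 p + t * (v - v0 p), p) \<in> D"
proof -
  have p: "p \<in> L" "vs p < v" "v < vS p" using assms by (auto simp: D_def)
  define w where "w = v0 p + t * (v - v0 p)"
  have *: "w = (1 - t) * v0 p + t * v" by (simp add: w_def algebra_simps)
  have "(1 - t) * min v (v0 p) + t * min v (v0 p) \<le> w" "w \<le> (1 - t) * max v (v0 p) + t * max v (v0 p)"
    unfolding * using assms(2) by (intro add_mono mult_left_mono; simp)+
  then have "min v (v0 p) \<le> w" "w \<le> max v (v0 p)" by (simp_all add: algebra_simps)
  then show ?thesis using p order[OF p(1)] by (auto simp: D_def w_def)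
qed

text \<open>Taylor's formula with integral remainder makes \<open>u - \<mu>0 = (v - v0)\<^sup>2 R\<close> with \<open>R\<close> smooth and
  positive across \<open>v0\<close>, so that the signed root \<open>\<phi>\<close> of \<open>u - \<mu>0\<close> is smooth there as well.\<close>

definition R :: "real \<times> 'p \<Rightarrow> real" where
  "R y = integral (cbox 0 1) (\<lambda>t. (1 - t) * u2 (v0 (snd y) + t * (fst y - v0 (snd y)), snd y))"

lemma smooth_R: "smooth_on D R"
proof -
  define \<Gamma> where "\<Gamma> = (\<lambda>z :: (real \<times> 'p) \<times> real.
    (v0 (snd (fst z)) + snd z * (fst (fst z) - v0 (snd (fst z))), snd (fst z)))"
  define A where "A = ((UNIV :: real set) \<times> L) \<times> (UNIV :: real set)"
  \<comment> \<open>An open set that contains \<open>D\<close> times the closed interval of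
    integration and on which the integrand is smooth.\<close>
  define T where "T = {z \<in> A. \<Gamma> z \<in> D}"
  have A: "open A" unfolding A_def by (intro open_Times open_UNIV open_L)
  have lin: "bounded_linear (\<lambda>z::(real \<times> 'p) \<times> real. fst (fst z))" "bounded_linear (\<lambda>z::(real \<times> 'p) \<times> real. snd (fst z))"
    by (intro bounded_linear_fst_comp bounded_linear_snd_comp bounded_linear_ident bounded_linear_fst)+
  have "smooth_on A (\<lambda>z. v0 (snd (fst z)))"
    by (rule smooth_on_compose[OF smooth_v0 A smooth_map_bounded_linear[OF A lin(2)]]) (auto simp: A_def)
  then have "smooth_map A \<Gamma>" unfolding \<Gamma>_def
    by (intro smooth_map_Pair[OF _ smooth_map_bounded_linear[OF A lin(2)]])
       (auto intro!: smooth_on_add[OF A] smooth_on_mult[OF A] smooth_on_diff[OF A]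
          smooth_on_bounded_linear[OF A lin(1)] smooth_on_bounded_linear[OF A bounded_linear_snd])
  then have TG: "open T" "smooth_map A \<Gamma>"
    unfolding T_def by (auto intro!: open_preimage A open_D smooth_map_continuous_on)
  have G: "smooth_map T \<Gamma>"
    by (rule smooth_map_subset[OF TG(2)]) (auto simp: T_def)
  have "smooth_on T (\<lambda>z. u2 (\<Gamma> z))"
    by (rule smooth_on_compose[OF smooth_on_subset[OF smooth_u2 D_subset] TG(1) G]) (simp add: T_def)
  then have "smooth_on T (\<lambda>z. (1 - snd z) * u2 (\<Gamma> z))"
    by (intro smooth_on_mult smooth_on_diff smooth_on_const TG(1)
        smooth_on_bounded_linear[OF TG(1) bounded_linear_snd])
  moreover have "D \<times> cbox 0 1 \<subseteq> T"
    using D_segment D_subset by (auto simp: T_def A_def \<Gamma>_def)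
  ultimately have "smooth_on D (\<lambda>y. integral (cbox 0 1) (\<lambda>t. (1 - snd (y, t)) * u2 (\<Gamma> (y, t))))"
    using open_D by (intro smooth_on_parametric(1))
  then show ?thesis by (simp add: R_def[abs_def] \<Gamma>_def)
qed

lemma deriv_u: "(v, p) \<in> I \<times> L \<Longrightarrow> ((\<lambda>v. u (v, p)) has_real_derivative u1 (v, p)) (at v)"
  and deriv_u1: "(v, p) \<in> I \<times> L \<Longrightarrow> ((\<lambda>v. u1 (v, p)) has_real_derivative u2 (v, p)) (at v)"
  unfolding u1_def u2_def
  by (intro has_real_derivative_fst smooth_on_differentiable[OF smooth_u]
      smooth_on_differentiable[OF smooth_on_ddir[OF smooth_u]]; assumption)+

lemma taylor_R:
  assumes "(v, p) \<in> D"
  shows "u (v, p) - \<mu>0 p = (v - v0 p)\<^sup>2 * R (v, p)"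
proof -
  let ?w = "\<lambda>t. v0 p + t * (v - v0 p)"
  have D: "(?w t, p) \<in> I \<times> L" if "t \<in> {0..1}" for t using D_segment[OF assms that] D_subset by auto
  have p: "p \<in> L" using assms by (simp add: D_def)
  \<comment> \<open>A primitive of the Taylor remainder: \<open>F 1 = u (v, p)\<close>, and
    \<open>F 0 = \<mu>0 p\<close> because the linear term carries \<open>u1\<close> at the critical
    point.\<close>
  define F where "F = (\<lambda>t. (1 - t) * (v - v0 p) * u1 (?w t, p) + u (?w t, p))"
  have "(F has_real_derivative (v - v0 p)\<^sup>2 * ((1 - t) * u2 (?w t, p))) (at t)" if "t \<in> {0..1}" for t
  proof -
    have w: "(?w has_real_derivative v - v0 p) (at t)" by (auto intro!: derivative_eq_intros)
    note [derivative_intros] = DERIV_chain2[where f="\<lambda>v. u (v, p)", OF deriv_u[OF D[OF that]] w]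
      DERIV_chain2[where f="\<lambda>v. u1 (v, p)", OF deriv_u1[OF D[OF that]] w]
    show ?thesis unfolding F_def
      by (rule derivative_eq_intros refl)+ (simp add: algebra_simps power2_eq_square)
  qed
  then have "(F has_vector_derivative (v - v0 p)\<^sup>2 * ((1 - t) * u2 (?w t, p))) (at t within {0..1})" if "t \<in> {0..1}" for t
    using that by (simp add: has_real_derivative_iff_has_vector_derivative has_vector_derivative_at_within)
  then have "((\<lambda>t. (v - v0 p)\<^sup>2 * ((1 - t) * u2 (?w t, p))) has_integral F 1 - F 0) {0..1}"
    by (intro fundamental_theorem_of_calculus) auto
  then have "integral {0..1} (\<lambda>t. (v - v0 p)\<^sup>2 * ((1 - t) * u2 (?w t, p))) = F 1 - F 0"
    by (rule integral_unique)
  moreover have "F 1 - F 0 = u (v, p) - \<mu>0 p"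
    using crit[OF p] by (simp add: F_def \<mu>0_def u1_def)
  ultimately show ?thesis by (simp add: R_def)
qed

lemma R_at_v0: "p \<in> L \<Longrightarrow> R (v0 p, p) = u2 (v0 p, p) / 2"
proof -
  have "((\<lambda>t::real. 1 - t) has_integral (1 - 1\<^sup>2 / 2) - (0 - 0\<^sup>2 / 2)) {0..1}"
    by (rule fundamental_theorem_of_calculus)
       (auto intro!: derivative_eq_intros simp flip: has_real_derivative_iff_has_vector_derivative)
  then have "integral {0..1} (\<lambda>t::real. 1 - t) = 1 / 2" by (simp add: integral_unique)
  then show ?thesis by (simp add: R_def)
qed

lemma u_gt_min:
  assumes "(v, p) \<in> D" "v \<noteq> v0 p" shows "u (v, p) > \<mu>0 p"
proof -
  have p: "p \<in> L" "vs p < v" "v < vS p" using assms by (auto simp: D_def)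
  have d: "((\<lambda>v. u (v, p)) has_real_derivative u1 (w, p)) (at w)" "isCont (\<lambda>v. u (v, p)) w"
    if "vs p < w" "w < vS p" for w
    using deriv_u[of w p] D_subset that p DERIV_isCont by (auto simp: D_def)
  show ?thesis
  proof (cases "v < v0 p")
    case True
    have "u (v0 p, p) < u (v, p)"
    proof (rule DERIV_neg_imp_decreasing_open[OF True])
      show "continuous_on {v..v0 p} (\<lambda>v. u (v, p))"
        using p order[OF p(1)] by (intro continuous_at_imp_continuous_on ballI d(2)) auto
      fix x assume "v < x" "x < v0 p"
      then show "\<exists>y. ((\<lambda>v. u (v, p)) has_real_derivative y) (at x) \<and> y < 0"
        using p order[OF p(1)] by (intro exI[of _ "u1 (x, p)"] conjI d(1)) (auto simp: u1_def intro: decr incr)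
    qed
    then show ?thesis by (simp add: \<mu>0_def)
  next
    case False
    then have less: "v0 p < v" using assms by simp
    have "u (v0 p, p) < u (v, p)"
    proof (rule DERIV_pos_imp_increasing_open[OF less])
      show "continuous_on {v0 p..v} (\<lambda>v. u (v, p))"
        using p order[OF p(1)] by (intro continuous_at_imp_continuous_on ballI d(2)) auto
      fix x assume "v0 p < x" "x < v"
      then show "\<exists>y. ((\<lambda>v. u (v, p)) has_real_derivative y) (at x) \<and> y > 0"
        using p order[OF p(1)] by (intro exI[of _ "u1 (x, p)"] conjI d(1)) (auto simp: u1_def intro: decr incr)
    qed
    then show ?thesis by (simp add: \<mu>0_def)
  qed
qed

text \<open>Off \<open>v0\<close> the sign follows from \<open>u > \<mu>0\<close> in Taylor's
  formula. At \<open>v0\<close> that formula says nothing, and nondegeneracy takes over.\<close>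

lemma R_pos: "y \<in> D \<Longrightarrow> R y > 0"
proof (cases y)
  case (Pair v p)
  assume y: "y \<in> D"
  then have p: "p \<in> L" by (auto simp: Pair D_def)
  show ?thesis
  proof (cases "v = v0 p")
    case True
    then show ?thesis using R_at_v0[OF p] nondeg[OF p] by (simp add: Pair u1_def u2_def)
  next
    case False
    then have "0 < (v - v0 p)\<^sup>2 * R (v, p)" using u_gt_min[of v p] taylor_R[of v p] y by (simp add: Pair)
    then show ?thesis using False by (simp add: Pair zero_less_mult_iff)
  qed
qed

definition \<phi> where
  "\<phi> y = (fst y - v0 (snd y)) * sqrt (R y)"

lemma smooth_\<phi>: "smooth_on D \<phi>"
  unfolding \<phi>_def[abs_def]
  by (intro smooth_on_mult smooth_on_diff smooth_on_sqrt smooth_R R_pos open_D smooth_on_bounded_linear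
      bounded_linear_fst smooth_map_snd_compose[OF smooth_v0 _ D_subset])

lemma \<phi>_sq: "(v, p) \<in> D \<Longrightarrow> (\<phi> (v, p))\<^sup>2 = u (v, p) - \<mu>0 p"
  using R_pos[of "(v, p)"] by (simp add: \<phi>_def taylor_R power_mult_distrib)

lemma \<phi>_v0 [simp]: "\<phi> (v0 p, p) = 0"
  by (simp add: \<phi>_def)

definition \<phi>1 where "\<phi>1 = ddir (1, 0) \<phi>"

lemma smooth_\<phi>1: "smooth_on D \<phi>1"
  unfolding \<phi>1_def by (rule smooth_on_ddir[OF smooth_\<phi>])

lemma deriv_\<phi>: "(v, p) \<in> D \<Longrightarrow> ((\<lambda>v. \<phi> (v, p)) has_real_derivative \<phi>1 (v, p)) (at v)"
  unfolding \<phi>1_def by (intro has_real_derivative_fst smooth_on_differentiable[OF smooth_\<phi>])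

lemma \<phi>1_v0: "p \<in> L \<Longrightarrow> \<phi>1 (v0 p, p) = sqrt (u2 (v0 p, p) / 2)"
proof -
  assume p: "p \<in> L"
  have R: "((\<lambda>v. R (v, p)) has_real_derivative ddir (1, 0) R (v0 p, p)) (at (v0 p))"
    by (intro has_real_derivative_fst smooth_on_differentiable[OF smooth_R] v0_in_D p)
  have "R (v0 p, p) > 0" using R_pos v0_in_D p by blast
  then have "((\<lambda>v. \<phi> (v, p)) has_real_derivative sqrt (R (v0 p, p))) (at (v0 p))"
    unfolding \<phi>_def fst_conv snd_conv
    by (auto intro!: derivative_eq_intros R)
  from DERIV_unique[OF this deriv_\<phi>[OF v0_in_D[OF p]]] show ?thesis
    using R_at_v0[OF p] by simp
qed

lemma \<phi>\<phi>1: "(v, p) \<in> D \<Longrightarrow> 2 * \<phi> (v, p) * \<phi>1 (v, p) = u1 (v, p)"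
proof -
  assume D: "(v, p) \<in> D"
  then have p: "p \<in> L" by (auto simp: D_def)
  have "((\<lambda>v. (\<phi> (v, p))\<^sup>2) has_real_derivative 2 * \<phi> (v, p) * \<phi>1 (v, p)) (at v)"
    by (auto intro!: derivative_eq_intros deriv_\<phi>[OF D])
  then have "((\<lambda>v. u (v, p) - \<mu>0 p) has_real_derivative 2 * \<phi> (v, p) * \<phi>1 (v, p)) (at v)"
    by (rule has_field_derivative_transform_within_open[where S="{vs p<..<vS p}"])
       (use D \<phi>_sq in \<open>auto simp: D_def\<close>)
  moreover have "((\<lambda>v. u (v, p) - \<mu>0 p) has_real_derivative u1 (v, p)) (at v)"
    using D_subset D by (auto intro!: derivative_eq_intros deriv_u)
  ultimately show ?thesis by (rule DERIV_unique)
qed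

text \<open>In \<open>2 \<phi> \<phi>1 = u1\<close> the factors \<open>\<phi>\<close> and
  \<open>u1\<close> change sign together at \<open>v0\<close>; at \<open>v0\<close> itself the
  equation is empty and the value comes from nondegeneracy.\<close>

lemma \<phi>1_pos: "y \<in> D \<Longrightarrow> \<phi>1 y > 0"
proof (cases y)
  case (Pair v p)
  assume y: "y \<in> D"
  then have p: "p \<in> L" "vs p < v" "v < vS p" by (auto simp: Pair D_def)
  have R: "sqrt (R (v, p)) > 0" using R_pos y Pair by simp
  consider "v = v0 p" | "v < v0 p" | "v > v0 p" by linarith
  then show ?thesis
  proof cases
    case 1
    then show ?thesis using \<phi>1_v0[OF p(1)] nondeg[OF p(1)] by (simp add: Pair u2_def u1_def)
  next
    case 2
    then have "\<phi> (v, p) < 0" using R by (simp add: \<phi>_def mult_less_0_iff)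
    moreover have "2 * \<phi> (v, p) * \<phi>1 (v, p) < 0"
      using \<phi>\<phi>1[of v p] y decr[OF p(1,2) 2] by (simp add: Pair u1_def)
    ultimately show ?thesis by (auto simp: Pair mult_less_0_iff)
  next
    case 3
    then have "\<phi> (v, p) > 0" using R by (simp add: \<phi>_def)
    moreover have "2 * \<phi> (v, p) * \<phi>1 (v, p) > 0"
      using \<phi>\<phi>1[of v p] y incr[OF p(1) 3 p(3)] by (simp add: Pair u1_def)
    ultimately show ?thesis by (auto simp: Pair zero_less_mult_iff)
  qed
qed

section \<open>Inversion of the coordinate change\<close>

lemma \<phi>_strict_mono:
  assumes "(v, p) \<in> D" "(w, p) \<in> D" "v < w" shows "\<phi> (v, p) < \<phi> (w, p)"
proof (rule DERIV_pos_imp_increasing[OF assms(3)])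
  fix x assume "v \<le> x" "x \<le> w"
  then have "(x, p) \<in> D" using assms by (auto simp: D_def)
  then show "\<exists>y. ((\<lambda>v. \<phi> (v, p)) has_real_derivative y) (at x) \<and> 0 < y"
    using deriv_\<phi> \<phi>1_pos by blast
qed

text \<open>Carrying the parameters along makes the family of one-dimensional coordinate changes a
  single injective map between spaces of equal dimension. Invariance of domain then gives an open
  image, and one inverse covers the dependence on \<open>x\<close> and on \<open>p\<close>.\<close>

definition \<Psi> :: "real \<times> 'p \<Rightarrow> real \<times> 'p" where "\<Psi> y = (\<phi> y, snd y)"

lemma inj_\<Psi>: "inj_on \<Psi> D"
proof (rule inj_onI)
  fix y z assume "y \<in> D" "z \<in> D" "\<Psi> y = \<Psi> z"
  then obtain v w p where "y = (v, p)" "z = (w, p)" "(v, p) \<in> D" "(w, p) \<in> D" "\<phi> (v, p) = \<phi> (w, p)"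
    by (cases y; cases z) (auto simp: \<Psi>_def)
  then show "y = z"
    using \<phi>_strict_mono[of v p w] \<phi>_strict_mono[of w p v] by (cases v w rule: linorder_cases) auto
qed

definition X where "X = \<Psi> ` D"

definition \<eta> where "\<eta> = inv_into D \<Psi>"

lemma cont_\<Psi>: "continuous_on D \<Psi>"
  unfolding \<Psi>_def[abs_def] by (intro continuous_intros smooth_on_continuous_on[OF smooth_\<phi>])

lemma open_X: "open X"
  unfolding X_def by (rule invariance_of_domain[OF cont_\<Psi> open_D inj_\<Psi>])

lemma \<eta>_\<Psi>: "y \<in> D \<Longrightarrow> \<eta> (\<Psi> y) = y"
  unfolding \<eta>_def by (rule inv_into_f_f[OF inj_\<Psi>])

lemma \<Psi>_\<eta>: "z \<in> X \<Longrightarrow> \<Psi> (\<eta> z) = z"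
  unfolding \<eta>_def X_def by (rule f_inv_into_f)

lemma \<eta>_in_D: "z \<in> X \<Longrightarrow> \<eta> z \<in> D"
  unfolding \<eta>_def X_def by (rule inv_into_into)

lemma snd_\<eta>: "z \<in> X \<Longrightarrow> snd (\<eta> z) = snd z"
  using arg_cong[OF \<Psi>_\<eta>, of z snd] by (simp add: \<Psi>_def)

text \<open>The first component solves \<open>dx = \<phi>1 dv + ddir (0, dp) \<phi>\<close> for
  \<open>dv\<close>, which is possible because \<open>\<phi>1 > 0\<close>.\<close>

lemma has_derivative_\<eta>:
  assumes "z \<in> X"
  shows "(\<eta> has_derivative (\<lambda>h. ((fst h - ddir (0, snd h) \<phi> (\<eta> z)) / \<phi>1 (\<eta> z), snd h))) (at z)"
    (is "(_ has_derivative ?g) _")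
proof -
  let ?y = "\<eta> z"
  have y: "?y \<in> D" using \<eta>_in_D assms by blast
  have \<phi>: "\<phi> differentiable (at ?y)" by (rule smooth_on_differentiable[OF smooth_\<phi> y])
  have der: "(\<Psi> has_derivative (\<lambda>h. (ddir h \<phi> ?y, snd h))) (at ?y)"
    unfolding \<Psi>_def[abs_def]
    by (intro has_derivative_Pair has_derivative_ddir[OF \<phi>] bounded_linear_imp_has_derivative bounded_linear_snd)
  have "(\<lambda>h. (ddir h \<phi> ?y, snd h)) \<circ> ?g = id"
  proof
    fix h
    show "((\<lambda>h. (ddir h \<phi> ?y, snd h)) \<circ> ?g) h = id h"
      using \<phi>1_pos[OF y] ddir_prod_split[OF \<phi>, of "fst (?g h)" "snd h"]
      by (simp add: \<phi>1_def)
  qed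
  from has_derivative_inverse_strong[OF open_D y cont_\<Psi> \<eta>_\<Psi> der this]
  show ?thesis by (simp add: \<Psi>_\<eta>[OF assms])
qed

text \<open>The derivative of \<open>F \<circ> \<eta>\<close> is again of the form
  \<open>B \<circ> \<eta>\<close> with \<open>B\<close> smooth on \<open>D\<close>. Stating the
  claim for all smooth \<open>F\<close> instead of for \<open>\<eta>\<close> alone therefore closes
  the induction.\<close>

lemma Ck_on_\<eta>:
  assumes "smooth_on D F" shows "Ck_on k X (\<lambda>z. F (\<eta> z))"
  using assms
proof (induction k arbitrary: F)
  case 0
  have "continuous_on X \<eta>"
    using has_derivative_\<eta> by (auto intro!: continuous_at_imp_continuous_on has_derivative_continuous)
  then show ?case
    using 0 by (auto intro!: continuous_on_compose2[OF smooth_on_continuous_on[OF 0]] \<eta>_in_D)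
next
  case (Suc k)
  let ?B = "\<lambda>h y. ((fst h - ddir (0, snd h) \<phi> y) / \<phi>1 y) * ddir (1, 0) F y + ddir (0, snd h) F y"
  show ?case
  proof (rule Ck_on_SucI[OF open_X])
    fix z assume z: "z \<in> X"
    note F = smooth_on_differentiable[OF Suc.prems \<eta>_in_D[OF z]]
    show "((\<lambda>z. F (\<eta> z)) has_derivative (\<lambda>h. ?B h (\<eta> z))) (at z)"
      using has_derivative_compose[OF has_derivative_\<eta>[OF z] has_derivative_ddir[OF F]]
      unfolding ddir_prod_split[OF F, of "(_ - _) / _"] .
  next
    fix h
    have nz: "\<And>y. y \<in> D \<Longrightarrow> \<phi>1 y \<noteq> 0" using \<phi>1_pos by fastforce
    show "Ck_on k X (\<lambda>z. ?B h (\<eta> z))"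
      by (rule Suc.IH[where F="?B h"])
         (intro smooth_on_add smooth_on_mult smooth_on_divide smooth_on_diff smooth_on_const open_D smooth_\<phi>1
            smooth_on_ddir smooth_\<phi> Suc.prems nz; assumption)
  qed
qed

lemma smooth_\<eta>: "smooth_on D F \<Longrightarrow> smooth_on X (\<lambda>z. F (\<eta> z))"
  using Ck_on_\<eta> by (simp add: smooth_on_def)

definition \<psi> where "\<psi> z = fst (\<eta> z)"

lemma \<eta>_eq: "z \<in> X \<Longrightarrow> \<eta> z = (\<psi> z, snd z)"
  using snd_\<eta> by (metis \<psi>_def prod.collapse)

lemma smooth_\<psi>: "smooth_on X \<psi>"
  unfolding \<psi>_def[abs_def] by (intro smooth_\<eta> smooth_on_bounded_linear open_D bounded_linear_fst)

lemma \<psi>_in_D: "z \<in> X \<Longrightarrow> (\<psi> z, snd z) \<in> D"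
  using \<eta>_in_D \<eta>_eq by metis

lemma \<psi>_\<phi>: "(v, p) \<in> D \<Longrightarrow> \<psi> (\<phi> (v, p), p) = v"
  using \<eta>_\<Psi>[of "(v, p)"] by (simp add: \<psi>_def \<Psi>_def)

lemma \<phi>_\<psi>: "z \<in> X \<Longrightarrow> \<phi> (\<psi> z, snd z) = fst z"
  using \<Psi>_\<eta>[of z] \<eta>_eq by (auto simp: \<Psi>_def prod_eq_iff)

lemma zero_in_X: "p \<in> L \<Longrightarrow> (0, p) \<in> X"
  using v0_in_D[of p] by (auto simp: X_def \<Psi>_def image_iff intro!: bexI[of _ "(v0 p, p)"])

lemma \<psi>_zero: "p \<in> L \<Longrightarrow> \<psi> (0, p) = v0 p"
  using \<psi>_\<phi>[OF v0_in_D] by simp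

lemma X_subset: "z \<in> X \<Longrightarrow> snd z \<in> L"
  using \<eta>_in_D[of z] snd_\<eta>[of z] by (auto simp: D_def split_beta)

lemma u_\<psi>: "z \<in> X \<Longrightarrow> u (\<psi> z, snd z) = \<mu>0 (snd z) + (fst z)\<^sup>2"
  using \<phi>_sq[OF \<psi>_in_D[of z]] \<phi>_\<psi>[of z] by simp

text \<open>By the intermediate value theorem a slice of \<open>X\<close> contains the whole segment
  between two of its points. Applied to the two turning points, this places every
  \<open>h sin t\<close> in the domain of \<open>\<psi>\<close>.\<close>

lemma X_interval:
  assumes v: "(v, p) \<in> D" and w: "(w, p) \<in> D" and x: "\<phi> (v, p) \<le> x" "x \<le> \<phi> (w, p)"
  shows "(x, p) \<in> X"
proof -
  have vw: "v \<le> w" using \<phi>_strict_mono[OF w v] x by linarith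
  have sub: "(y, p) \<in> D" if "y \<in> {v..w}" for y using that v w by (auto simp: D_def)
  have "continuous_on {v..w} (\<lambda>v. \<phi> (v, p))"
    using sub deriv_\<phi> by (intro continuous_at_imp_continuous_on ballI DERIV_isCont) blast
  from IVT'[OF x vw this] obtain y where "y \<in> {v..w}" "\<phi> (y, p) = x" by auto
  then show ?thesis using sub by (auto simp: X_def \<Psi>_def image_iff intro!: bexI[of _ "(y, p)"])
qed

end

section \<open>The action as a smooth parametric integral\<close>

context potential_well begin

definition k where "k v = sqrt (2 * \<kappa> v)"

lemma smooth_k: "smooth_on I k"
  unfolding k_def[abs_def]
  by (intro smooth_on_sqrt smooth_on_mult smooth_on_const open_I smooth_\<kappa>) (simp add: \<kappa>_pos)

lemma k_pos: "v \<in> I \<Longrightarrow> k v > 0"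
  by (simp add: k_def \<kappa>_pos)

lemma \<psi>_in_I: "z \<in> X \<Longrightarrow> \<psi> z \<in> I"
  using \<psi>_in_D D_subset by blast

lemma smooth_comp_\<psi>: "smooth_on (I \<times> L) F \<Longrightarrow> smooth_on X (\<lambda>z. F (\<psi> z, snd z))"
  using smooth_on_cong[OF open_X, of "\<lambda>z. F (\<psi> z, snd z)" "\<lambda>z. F (\<eta> z)"]
    smooth_\<eta>[OF smooth_on_subset[OF _ D_subset], of F] by (simp add: \<eta>_eq)

lemma smooth_k\<psi>: "smooth_on X (\<lambda>z. k (\<psi> z))"
  by (rule smooth_on_compose[OF smooth_k open_X]) (auto simp: smooth_\<psi> \<psi>_in_I)

definition \<psi>x where "\<psi>x = ddir (1, 0) \<psi>"

definition G where "G z = k (\<psi> z) * \<psi>x z"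

text \<open>The derivative of \<open>\<mu> - u\<close> at fixed \<open>v\<close> in the direction
  \<open>j\<close> of \<open>(\<mu>, p)\<close>. At \<open>v = v0\<close> it becomes the component
  of the vector \<open>V\<^sub>0\<close> along \<open>j\<close>.\<close>

definition Vf :: "real \<times> 'p \<Rightarrow> real \<times> 'p \<Rightarrow> real" where
  "Vf j y = fst j - ddir (0, snd j) u y"

definition \<Phi> :: "real \<times> 'p \<Rightarrow> real \<times> 'p \<Rightarrow> real" where
  "\<Phi> j z = G z * Vf j (\<psi> z, snd z)"

lemma smooth_\<psi>x: "smooth_on X \<psi>x"
  unfolding \<psi>x_def by (rule smooth_on_ddir[OF smooth_\<psi>])

lemma smooth_G: "smooth_on X G"
  unfolding G_def[abs_def] by (intro smooth_on_mult open_X smooth_k\<psi> smooth_\<psi>x)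

lemma smooth_Vf: "smooth_on (I \<times> L) (Vf j)"
  unfolding Vf_def[abs_def] by (intro smooth_on_diff smooth_on_const open_IL smooth_on_ddir smooth_u)

lemma smooth_\<Phi>: "smooth_on X (\<Phi> j)"
  unfolding \<Phi>_def[abs_def] by (intro smooth_on_mult open_X smooth_G smooth_comp_\<psi> smooth_Vf)

lemma smooth_\<mu>0: "smooth_on L \<mu>0"
  unfolding \<mu>0_def[abs_def]
  by (rule smooth_on_compose[OF smooth_u open_L smooth_map_Pair[OF _ smooth_map_id]])
     (use smooth_v0 v0_in_D D_subset open_L in auto)

text \<open>Envelope argument: the motion of \<open>v0\<close> contributes
  \<open>u1 (v0 p, p) = 0\<close>. Consequently the gradient of \<open>\<mu> - \<mu>0\<close> is
  \<open>Vf\<close> at \<open>v0\<close>.\<close>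

lemma ddir_\<mu>0: "p \<in> L \<Longrightarrow> ddir q \<mu>0 p = ddir (0, q) u (v0 p, p)"
proof -
  assume p: "p \<in> L"
  have y: "(v0 p, p) \<in> I \<times> L" using v0_in_D[OF p] D_subset by blast
  note u = smooth_on_differentiable[OF smooth_u y]
  have "((\<lambda>p. (v0 p, p)) has_derivative (\<lambda>q. (ddir q v0 p, q))) (at p)"
    by (intro has_derivative_Pair has_derivative_ident smooth_on_has_derivative[OF smooth_v0 p])
  then have "ddir q \<mu>0 p = ddir (ddir q v0 p, q) u (v0 p, p)"
    unfolding \<mu>0_def[abs_def] by (rule ddir_compose[where g=u and \<Gamma>="\<lambda>p. (v0 p, p)", OF u])
  also have "\<dots> = ddir (0, q) u (v0 p, p)"
    using ddir_prod_split[OF u, of "ddir q v0 p" q] crit[OF p] by simp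
  finally show ?thesis .
qed

text \<open>The \<open>x\<close>- and the parameter derivative of the identity
  \<open>u (\<psi> (x, p), p) = \<mu>0 p + x^2\<close>.\<close>

lemma ddir_u_\<psi>:
  assumes z: "z \<in> X"
  shows "u1 (\<psi> z, snd z) * \<psi>x z = 2 * fst z"
    and "u1 (\<psi> z, snd z) * ddir (0, q) \<psi> z + ddir (0, q) u (\<psi> z, snd z) = ddir q \<mu>0 (snd z)"
proof -
  have p: "snd z \<in> L" by (rule X_subset[OF z])
  have "(\<psi> z, snd z) \<in> I \<times> L" using \<psi>_in_D[OF z] D_subset by blast
  note u = smooth_on_differentiable[OF smooth_u this]
  have \<psi>: "((\<lambda>z. (\<psi> z, snd z)) has_derivative (\<lambda>h. (ddir h \<psi> z, snd h))) (at z)"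
    by (intro has_derivative_Pair smooth_on_has_derivative[OF smooth_\<psi> z] bounded_linear_imp_has_derivative bounded_linear_snd)
  have "ddir h (\<lambda>z. u (\<psi> z, snd z)) z = ddir h (\<lambda>z. \<mu>0 (snd z) + (fst z)\<^sup>2) z" for h
    by (rule ddir_cong[OF open_X z u_\<psi>])
  moreover have "ddir h (\<lambda>z. u (\<psi> z, snd z)) z = ddir h \<psi> z * u1 (\<psi> z, snd z) + ddir (0, snd h) u (\<psi> z, snd z)" for h
    using ddir_compose[where g=u and \<Gamma>="\<lambda>z. (\<psi> z, snd z)", OF u \<psi>, of h]
      ddir_prod_split[OF u, of "ddir h \<psi> z" "snd h"] by (simp add: u1_def)
  moreover have "ddir h (\<lambda>z. \<mu>0 (snd z) + (fst z)\<^sup>2) z = ddir (snd h) \<mu>0 (snd z) + 2 * fst z * fst h" for h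
  proof (rule ddir_eqI)
    have "((\<lambda>z. (fst z)\<^sup>2) has_derivative (\<lambda>h. 2 * fst z * fst h)) (at z)"
      by (auto intro!: derivative_eq_intros)
    then show "((\<lambda>z. \<mu>0 (snd z) + (fst z)\<^sup>2) has_derivative (\<lambda>h. ddir (snd h) \<mu>0 (snd z) + 2 * fst z * fst h)) (at z)"
      by (intro has_derivative_add has_derivative_compose[OF bounded_linear_imp_has_derivative[OF bounded_linear_snd]
            smooth_on_has_derivative[OF smooth_\<mu>0 p]])
  qed
  ultimately have eq: "ddir h \<psi> z * u1 (\<psi> z, snd z) + ddir (0, snd h) u (\<psi> z, snd z)
      = ddir (snd h) \<mu>0 (snd z) + 2 * fst z * fst h" for h
    by simp
  have zero: "ddir 0 u (\<psi> z, snd z) = 0" "ddir 0 \<mu>0 (snd z) = 0"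
    using linear_0[OF linear_ddir[OF u]] linear_0[OF linear_ddir[OF smooth_on_differentiable[OF smooth_\<mu>0 p]]] by auto
  show "u1 (\<psi> z, snd z) * \<psi>x z = 2 * fst z"
    using eq[of "(1, 0)"] zero by (simp add: \<psi>x_def zero_prod_def mult.commute)
  show "u1 (\<psi> z, snd z) * ddir (0, q) \<psi> z + ddir (0, q) u (\<psi> z, snd z) = ddir q \<mu>0 (snd z)"
    using eq[of "(0, q)"] by (simp add: mult.commute)
qed

definition M :: "'p \<Rightarrow> real \<times> 'p \<Rightarrow> real" where "M q z = k (\<psi> z) * ddir (0, q) \<psi> z"

lemma smooth_M: "smooth_on X (M q)"
  unfolding M_def[abs_def] by (intro smooth_on_mult open_X smooth_k\<psi> smooth_on_ddir smooth_\<psi>)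

text \<open>Since \<open>2 x = u1 \<psi>x\<close>, multiplying \<open>M\<close> by
  \<open>2 x\<close> yields \<open>G\<close> times \<open>u1 * ddir (0, q) \<psi>\<close>, and the
  second identity of \<open>ddir_u_\<psi>\<close> expresses the latter through \<open>Vf j\<close>
  at \<open>\<psi>\<close> and at \<open>v0\<close>.\<close>

lemma M_eq:
  assumes z: "z \<in> X"
  shows "2 * fst z * M (snd j) z = \<Phi> j z - Vf j (v0 (snd z), snd z) * G z"
proof -
  have "2 * fst z * M (snd j) z = G z * (u1 (\<psi> z, snd z) * ddir (0, snd j) \<psi> z)"
    unfolding ddir_u_\<psi>(1)[OF z, symmetric] by (simp add: M_def G_def)
  also have "u1 (\<psi> z, snd z) * ddir (0, snd j) \<psi> z = Vf j (\<psi> z, snd z) - Vf j (v0 (snd z), snd z)"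
    using ddir_u_\<psi>(2)[OF z, of "snd j"] ddir_\<mu>0[OF X_subset[OF z]] by (simp add: Vf_def)
  finally show ?thesis by (simp add: \<Phi>_def algebra_simps)
qed

text \<open>The mixed second derivatives of \<open>\<psi>\<close> commute, and on both sides the
  derivative of \<open>k (\<psi>)\<close> contributes the same product of first derivatives of
  \<open>\<psi>\<close>.\<close>

lemma ddir_G_M:
  assumes z: "z \<in> X" shows "ddir (0, q) G z = ddir (1, 0) (M q) z"
proof -
  note \<psi> = smooth_on_differentiable[OF smooth_\<psi> z]
    smooth_on_differentiable[OF smooth_on_ddir[OF smooth_\<psi>] z]
  note k\<psi> = smooth_on_differentiable[OF smooth_k\<psi> z]
  have k: "k differentiable (at (\<psi> z))" by (rule smooth_on_differentiable[OF smooth_k \<psi>_in_I[OF z]])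
  have dk: "ddir h (\<lambda>z. k (\<psi> z)) z = ddir h \<psi> z * ddir 1 k (\<psi> z)" for h
    using ddir_compose[OF k has_derivative_ddir[OF \<psi>(1)], of h] ddir_scaleR[OF k, of "ddir h \<psi> z" 1] by simp
  have "ddir (0, q) \<psi>x z = ddir (1, 0) (ddir (0, q) \<psi>) z"
    unfolding \<psi>x_def by (rule ddir_commute[OF open_X z smooth_\<psi>])
  then show ?thesis
    unfolding G_def[abs_def] M_def[abs_def]
    by (simp add: ddir_mult k\<psi> \<psi> dk smooth_on_differentiable[OF smooth_\<psi>x z]) (simp add: \<psi>x_def)
qed

end

section \<open>The action in the angular variable and its derivatives\<close>

locale well_action = potential_well I u L v0 vs vS \<kappa>
  for I :: "real set" and u :: "real \<times> 'p::euclidean_space \<Rightarrow> real" and L :: "'p set"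
    and v0 vs vS :: "'p \<Rightarrow> real" and \<kappa> :: "real \<Rightarrow> real" +
  fixes Om :: "(real \<times> 'p) set" and v2 v3 :: "real \<times> 'p \<Rightarrow> real"
  assumes open_Om: "open Om" and Om_L: "\<And>z. z \<in> Om \<Longrightarrow> snd z \<in> L"
    and v2_D: "\<And>z. z \<in> Om \<Longrightarrow> (v2 z, snd z) \<in> D" and v3_D: "\<And>z. z \<in> Om \<Longrightarrow> (v3 z, snd z) \<in> D"
    and v2_v0: "\<And>z. z \<in> Om \<Longrightarrow> v2 z < v0 (snd z)" and v0_v3: "\<And>z. z \<in> Om \<Longrightarrow> v0 (snd z) < v3 z"
    and u_v2: "\<And>z. z \<in> Om \<Longrightarrow> u (v2 z, snd z) = fst z" and u_v3: "\<And>z. z \<in> Om \<Longrightarrow> u (v3 z, snd z) = fst z"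
begin

definition h :: "real \<times> 'p \<Rightarrow> real" where "h z = sqrt (fst z - \<mu>0 (snd z))"

definition \<Theta> :: "real \<times> 'p \<Rightarrow> real" where
  "\<Theta> z = 2 * integral {v2 z..v3 z} (\<lambda>v. sqrt (2 * \<kappa> v * (fst z - u (v, snd z))))"

lemma above_min: "z \<in> Om \<Longrightarrow> \<mu>0 (snd z) < fst z"
  using u_gt_min[OF v3_D[of z]] v0_v3[of z] u_v3[of z] by simp

lemma h_pos: "z \<in> Om \<Longrightarrow> h z > 0" and h_sq: "z \<in> Om \<Longrightarrow> (h z)\<^sup>2 = fst z - \<mu>0 (snd z)"
  using above_min[of z] by (simp_all add: h_def)

lemma \<phi>_v3: assumes "z \<in> Om" shows "\<phi> (v3 z, snd z) = h z"
proof (rule power2_eq_imp_eq)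
  show "(\<phi> (v3 z, snd z))\<^sup>2 = (h z)\<^sup>2"
    using \<phi>_sq[OF v3_D] h_sq u_v3 assms by simp
  show "0 \<le> \<phi> (v3 z, snd z)"
    using \<phi>_strict_mono[OF v0_in_D[OF Om_L] v3_D v0_v3] assms by fastforce
qed (use h_pos[OF assms] in simp)

lemma \<phi>_v2: assumes "z \<in> Om" shows "\<phi> (v2 z, snd z) = - h z"
proof -
  have "- \<phi> (v2 z, snd z) = h z"
  proof (rule power2_eq_imp_eq)
    show "(- \<phi> (v2 z, snd z))\<^sup>2 = (h z)\<^sup>2"
      using \<phi>_sq[OF v2_D] h_sq u_v2 assms by simp
    show "0 \<le> - \<phi> (v2 z, snd z)"
      using \<phi>_strict_mono[OF v2_D v0_in_D[OF Om_L] v2_v0] assms by fastforce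
  qed (use h_pos[OF assms] in simp)
  then show ?thesis by simp
qed

lemma in_X: assumes "z \<in> Om" "\<bar>x\<bar> \<le> h z" shows "(x, snd z) \<in> X"
  using assms \<phi>_v2 \<phi>_v3 by (intro X_interval[OF v2_D v3_D]) (auto simp: abs_le_iff)

lemma \<psi>_h: assumes "z \<in> Om" shows "\<psi> (h z, snd z) = v3 z" "\<psi> (- h z, snd z) = v2 z"
  using \<psi>_\<phi>[OF v3_D[OF assms]] \<psi>_\<phi>[OF v2_D[OF assms]] \<phi>_v2 \<phi>_v3 assms by simp_all

lemma abs_h_sin: "z \<in> Om \<Longrightarrow> \<bar>h z * sin t\<bar> \<le> h z"
  using h_pos[of z] abs_sin_le_one[of t] by (simp add: abs_mult mult_left_le)

lemma h_sin_in_X: "z \<in> Om \<Longrightarrow> (h z * sin t, snd z) \<in> X"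
  by (intro in_X abs_h_sin)

lemma Om_subset: "Om \<subseteq> UNIV \<times> L" using Om_L by auto

lemma smooth_h: "smooth_on Om h"
  unfolding h_def[abs_def]
  by (intro smooth_on_sqrt smooth_on_diff open_Om smooth_map_snd_compose[OF smooth_\<mu>0 _ Om_subset]
      smooth_on_bounded_linear[OF open_Om bounded_linear_fst]) (simp add: above_min)

lemma ddir_h: assumes z: "z \<in> Om" shows "ddir j h z = Vf j (v0 (snd z), snd z) / (2 * h z)"
proof -
  note p = Om_L[OF z]
  have "((\<lambda>z. fst z - \<mu>0 (snd z)) has_derivative (\<lambda>j. fst j - ddir (snd j) \<mu>0 (snd z))) (at z)"
    by (intro has_derivative_diff has_derivative_compose[OF
          bounded_linear_imp_has_derivative[OF bounded_linear_snd] smooth_on_has_derivative[OF smooth_\<mu>0 p]]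
          bounded_linear_imp_has_derivative[OF bounded_linear_fst])
  moreover have "(sqrt has_derivative (\<lambda>x. x * inverse (sqrt (fst z - \<mu>0 (snd z))) / 2)) (at (fst z - \<mu>0 (snd z)))"
    by (rule has_derivative_eq_rhs[OF DERIV_real_sqrt[unfolded has_field_derivative_def]])
       (use above_min[OF z] in \<open>auto simp: fun_eq_iff\<close>)
  ultimately have "(h has_derivative (\<lambda>j. (fst j - ddir (snd j) \<mu>0 (snd z)) * inverse (sqrt (fst z - \<mu>0 (snd z))) / 2)) (at z)"
    unfolding h_def[abs_def] by (rule has_derivative_compose)
  from ddir_eqI[OF this, of j] have "ddir j h z = Vf j (v0 (snd z), snd z) * inverse (h z) / 2"
    unfolding Vf_def fst_conv snd_conv ddir_\<mu>0[OF p] h_def by simp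
  then show ?thesis using h_pos[OF z] by (simp add: field_simps)
qed

text \<open>Defined as a preimage, so that it is open and mapped into \<open>X\<close> by
  construction. Since \<open>h sin t\<close> never exceeds \<open>h\<close> in modulus, it is in
  fact all of \<open>Om \<times> UNIV\<close>.\<close>

definition T :: "((real \<times> 'p) \<times> real) set" where
  "T = {y \<in> Om \<times> UNIV. (h (fst y) * sin (snd y), snd (fst y)) \<in> X}"

lemma
  open_T: "open T" and
  smooth_lift: "smooth_on X F \<Longrightarrow> smooth_on T (\<lambda>y. F (h (fst y) * sin (snd y), snd (fst y)))" and
  smooth_h_fst: "smooth_on T (\<lambda>y. h (fst y))"
proof -
  define A where "A = Om \<times> (UNIV :: real set)"
  have A: "open A" unfolding A_def by (intro open_Times open_Om open_UNIV)
  have lin: "bounded_linear (\<lambda>z::(real \<times> 'p) \<times> real. snd (fst z))"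
    by (intro bounded_linear_snd_comp bounded_linear_fst)
  have h: "smooth_on A (\<lambda>y. h (fst y))"
    by (rule smooth_on_compose[OF smooth_h A smooth_map_bounded_linear[OF A bounded_linear_fst]]) (auto simp: A_def)
  have \<Gamma>: "smooth_map A (\<lambda>y. (h (fst y) * sin (snd y), snd (fst y)))"
    by (intro smooth_map_Pair[OF _ smooth_map_bounded_linear[OF A lin]])
       (auto intro!: smooth_on_mult[OF A] smooth_on_sin[OF A] smooth_on_bounded_linear[OF A bounded_linear_snd] h)
  show T: "open T"
    using open_preimage[OF A smooth_map_continuous_on[OF \<Gamma>] open_X] by (simp add: T_def A_def)
  have sub: "T \<subseteq> A" by (auto simp: T_def A_def)
  show "smooth_on T (\<lambda>y. h (fst y))" by (rule smooth_on_subset[OF h sub])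
  show "smooth_on X F \<Longrightarrow> smooth_on T (\<lambda>y. F (h (fst y) * sin (snd y), snd (fst y)))"
    by (erule smooth_on_compose[OF _ T smooth_map_subset[OF \<Gamma> sub]]) (simp add: T_def)
qed

lemma Om_T: "Om \<times> cbox a b \<subseteq> T"
  using h_sin_in_X by (auto simp: T_def)

lemma ddir_lift:
  assumes F: "smooth_on X F" and z: "z \<in> Om"
  shows "ddir (j, 0) (\<lambda>y. F (h (fst y) * sin (snd y), snd (fst y))) (z, t)
    = Vf j (v0 (snd z), snd z) / (2 * h z) * sin t * ddir (1, 0) F (h z * sin t, snd z)
      + ddir (0, snd j) F (h z * sin t, snd z)"
proof -
  note F' = smooth_on_differentiable[OF F h_sin_in_X[OF z, of t]]
  have hf: "((\<lambda>y. h (fst y)) has_derivative (\<lambda>y. ddir (fst y) h z)) (at (z, t))"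
    by (rule has_derivative_compose[OF bounded_linear_imp_has_derivative[OF bounded_linear_fst], where x="(z, t)", simplified])
       (rule smooth_on_has_derivative[OF smooth_h z])
  have "((\<lambda>y. (h (fst y) * sin (snd y), snd (fst y))) has_derivative
     (\<lambda>y. (h z * (snd y * cos t) + ddir (fst y) h z * sin t, snd (fst y)))) (at (z, t))"
    by (rule derivative_eq_intros hf refl | simp)+
  from ddir_compose[OF _ this, of F "(j, 0)"] F'
  have "ddir (j, 0) (\<lambda>y. F (h (fst y) * sin (snd y), snd (fst y))) (z, t)
    = ddir (ddir j h z * sin t, snd j) F (h z * sin t, snd z)" by simp
  then show ?thesis
    using ddir_prod_split[OF F', of "ddir j h z * sin t" "snd j"] by (simp add: ddir_h[OF z])
qed

text \<open>The substitution \<open>v = \<psi> (h sin t)\<close> turns the square root of \<open>\<mu> - u\<close> into \<open>h cos t\<close>.\<close>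

lemma action_eq:
  assumes z: "z \<in> Om"
  shows "\<Theta> z = integral (cbox (- (pi / 2)) (pi / 2)) (\<lambda>t. 2 * (h z)\<^sup>2 * (cos t)\<^sup>2 * G (h z * sin t, snd z))"
proof -
  define g where "g = (\<lambda>t. \<psi> (h z * sin t, snd z))"
  define f where "f = (\<lambda>v. sqrt (2 * \<kappa> v * (fst z - u (v, snd z))))"
  define g' where "g' = (\<lambda>t. h z * cos t * \<psi>x (h z * sin t, snd z))"
  have "(v, snd z) \<in> D" if "v \<in> {v2 z..v3 z}" for v
    using that v2_D[OF z] v3_D[OF z] by (auto simp: D_def)
  then have sub: "(v, snd z) \<in> I \<times> L" if "v \<in> {v2 z..v3 z}" for v
    using that D_subset by blast
  have "continuous_on {v2 z..v3 z} (\<lambda>v. u (v, snd z))"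
    by (rule continuous_on_compose2[OF smooth_on_continuous_on[OF smooth_u]]) (use sub in \<open>auto intro!: continuous_intros\<close>)
  moreover have "continuous_on {v2 z..v3 z} \<kappa>"
    by (rule continuous_on_subset[OF smooth_on_continuous_on[OF smooth_\<kappa>]]) (use sub in auto)
  ultimately have cf: "continuous_on {v2 z..v3 z} f"
    unfolding f_def by (intro continuous_intros)
  have dg: "(g has_real_derivative g' t) (at t)" for t
  proof -
    note \<psi> = smooth_on_differentiable[OF smooth_\<psi> h_sin_in_X[OF z, of t]]
    have "((\<lambda>t. (h z * sin t, snd z)) has_vector_derivative (h z * cos t, 0)) (at t)"
      by (auto simp: has_vector_derivative_def intro!: derivative_eq_intros)
    from ddir_vector_derivative[OF \<psi> this] show ?thesis
      using ddir_scaleR[OF \<psi>, of "h z * cos t" "(1, 0)"] by (simp add: g_def g'_def \<psi>x_def)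
  qed
  have g_in: "g ` {- (pi / 2)..pi / 2} \<subseteq> {v2 z..v3 z}"
  proof
    fix v assume "v \<in> g ` {- (pi / 2)..pi / 2}"
    then obtain t where v: "v = g t" by auto
    note X = h_sin_in_X[OF z, of t]
    have vD: "(v, snd z) \<in> D" using \<psi>_in_D[OF X] v by (simp add: g_def)
    have "\<phi> (v, snd z) = h z * sin t" using \<phi>_\<psi>[OF X] v by (simp add: g_def)
    then have "\<bar>\<phi> (v, snd z)\<bar> \<le> h z" using abs_h_sin[OF z] by simp
    then show "v \<in> {v2 z..v3 z}"
      using \<phi>_strict_mono[OF vD v2_D[OF z]] \<phi>_strict_mono[OF v3_D[OF z] vD] \<phi>_v2[OF z] \<phi>_v3[OF z] by force
  qed
  have "((\<lambda>t. g' t *\<^sub>R f (g t)) has_integral (integral {g (- (pi / 2))..g (pi / 2)} f - integral {g (pi / 2)..g (- (pi / 2))} f))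
      {- (pi / 2)..pi / 2}"
  \<comment> \<open>This substitution rule asks only that \<open>g\<close> map into the interval on
    which \<open>f\<close> is continuous, so no monotonicity of \<open>g\<close> has to be shown.
    Its second integral is over an empty interval because \<open>v2 < v3\<close>.\<close>
  proof (rule has_integral_substitution_general[of "{}", OF _ _ g_in cf])
    show "continuous_on {- (pi / 2)..pi / 2} g"
      by (intro continuous_at_imp_continuous_on ballI DERIV_isCont[OF dg])
    show "(g has_real_derivative g' t) (at t within {- (pi / 2)..pi / 2})" for t
      by (rule has_field_derivative_at_within[OF dg])
  qed simp_all
  then have "integral {- (pi / 2)..pi / 2} (\<lambda>t. g' t * f (g t)) = integral {v2 z..v3 z} f"
    using \<psi>_h[OF z] v2_v0[OF z] v0_v3[OF z] by (simp add: g_def integral_unique)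
  moreover have "integral {- (pi / 2)..pi / 2} (\<lambda>t. g' t * f (g t))
    = integral {- (pi / 2)..pi / 2} (\<lambda>t. (h z)\<^sup>2 * (cos t)\<^sup>2 * G (h z * sin t, snd z))"
  proof (rule integral_cong)
    fix t assume t: "t \<in> {- (pi / 2)..pi / 2}"
    note X = h_sin_in_X[OF z, of t]
    \<comment> \<open>The cosine is nonnegative on the half turn, so the root of
      \<open>(h cos t)^2\<close> is \<open>h cos t\<close> without an absolute value.\<close>
    have c: "h z * cos t \<ge> 0" using h_pos[OF z] cos_ge_zero[of t] t by simp
    have "fst z - u (g t, snd z) = (h z)\<^sup>2 - (h z * sin t)\<^sup>2"
      using u_\<psi>[OF X] h_sq[OF z] by (simp add: g_def)
    also have "\<dots> = (h z * cos t)\<^sup>2"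
      by (simp add: power_mult_distrib cos_squared_eq algebra_simps)
    finally have "f (g t) = k (g t) * (h z * cos t)"
      using c by (simp add: f_def k_def real_sqrt_mult)
    then show "g' t * f (g t) = (h z)\<^sup>2 * (cos t)\<^sup>2 * G (h z * sin t, snd z)"
      by (simp add: g'_def G_def g_def power2_eq_square)
  qed
  ultimately have "\<Theta> z = 2 * integral {- (pi / 2)..pi / 2} (\<lambda>t. (h z)\<^sup>2 * (cos t)\<^sup>2 * G (h z * sin t, snd z))"
    by (simp add: \<Theta>_def f_def)
  then show ?thesis by (simp flip: integral_mult_right add: mult.assoc)
qed

lemma smooth_action: "smooth_on Om \<Theta>"
  and ddir_action_integrand: "z \<in> Om \<Longrightarrow> ddir j \<Theta> z = integral (cbox (- (pi / 2)) (pi / 2)) (\<lambda>t.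
    ddir (j, 0) (\<lambda>y. 2 * (h (fst y))\<^sup>2 * (cos (snd y))\<^sup>2 * G (h (fst y) * sin (snd y), snd (fst y))) (z, t))"
proof -
  let ?F = "\<lambda>y. 2 * (h (fst y))\<^sup>2 * (cos (snd y))\<^sup>2 * G (h (fst y) * sin (snd y), snd (fst y))"
  have F: "smooth_on T ?F"
    by (intro smooth_on_mult smooth_on_power smooth_on_const open_T smooth_h_fst smooth_lift smooth_G smooth_on_cos
        smooth_on_bounded_linear[OF open_T bounded_linear_snd])
  have eq: "\<Theta> z = integral (cbox (- (pi / 2)) (pi / 2)) (\<lambda>t. ?F (z, t))" if "z \<in> Om" for z
    using action_eq[OF that] by simp
  show "smooth_on Om \<Theta>"
    by (rule iffD2[OF smooth_on_cong[OF open_Om eq] smooth_on_parametric(1)[OF open_Om Om_T F]])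
  show "z \<in> Om \<Longrightarrow> ddir j \<Theta> z = integral (cbox (- (pi / 2)) (pi / 2)) (\<lambda>t. ddir (j, 0) ?F (z, t))"
    using smooth_on_parametric(2)[OF open_Om Om_T F] ddir_cong[OF open_Om _ eq] by simp
qed

text \<open>The integrand of \<^term>\<open>ddir j \<Theta>\<close> differs from \<^term>\<open>\<Phi> j\<close> by the total derivative of
  \<open>cos t * (V sin t G + 2 h M)\<close>, where \<open>V\<close> is the value of \<^term>\<open>Vf j\<close> at \<open>v0\<close>.\<close>

lemma ddir_action:
  assumes z: "z \<in> Om"
  shows "ddir j \<Theta> z = integral (cbox (- (pi / 2)) (pi / 2)) (\<lambda>t. \<Phi> j (h z * sin t, snd z))"
proof -
  define V where "V = Vf j (v0 (snd z), snd z)"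
  define \<gamma> where "\<gamma> = (\<lambda>t. (h z * sin t, snd z))"
  note X = h_sin_in_X[OF z]
  have \<gamma>X: "\<gamma> t \<in> X" for t using X by (simp add: \<gamma>_def)
  have d\<gamma>: "((\<lambda>t. F (\<gamma> t)) has_real_derivative h z * cos t * ddir (1, 0) F (\<gamma> t)) (at t)"
    if "smooth_on X F" for F t
  proof -
    note F = smooth_on_differentiable[OF that \<gamma>X[of t]]
    have "(\<gamma> has_vector_derivative (h z * cos t, 0)) (at t)"
      by (auto simp: has_vector_derivative_def \<gamma>_def intro!: derivative_eq_intros)
    from ddir_vector_derivative[OF F this] show ?thesis
      using ddir_scaleR[OF F, of "h z * cos t" "(1, 0)"] by simp
  qed
  define N where "N = (\<lambda>t. cos t * (V * sin t * G (\<gamma> t) + 2 * h z * M (snd j) (\<gamma> t)))"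
  define N' where "N' = (\<lambda>t. cos t * (V * (cos t * G (\<gamma> t) + sin t * (h z * cos t * ddir (1, 0) G (\<gamma> t)))
     + 2 * h z * (h z * cos t * ddir (1, 0) (M (snd j)) (\<gamma> t)))
     - sin t * (V * sin t * G (\<gamma> t) + 2 * h z * M (snd j) (\<gamma> t)))"
  have "(N has_real_derivative N' t) (at t)" for t
    unfolding N_def N'_def
    by (rule derivative_eq_intros refl d\<gamma>[OF smooth_G] d\<gamma>[OF smooth_M] | simp add: algebra_simps)+
  then have "(N' has_integral N (pi / 2) - N (- (pi / 2))) {- (pi / 2)..pi / 2}"
    by (intro fundamental_theorem_of_calculus)
       (auto simp: has_real_derivative_iff_has_vector_derivative has_vector_derivative_at_within)
  \<comment> \<open>The factor \<open>cos t\<close> of \<open>N\<close> vanishes at both end points: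
    no boundary term remains.\<close>
  then have N0: "(N' has_integral 0) (cbox (- (pi / 2)) (pi / 2))" by (simp add: N_def)
  let ?F = "\<lambda>y. 2 * (h (fst y))\<^sup>2 * (cos (snd y))\<^sup>2 * G (h (fst y) * sin (snd y), snd (fst y))"
  have F: "ddir (j, 0) ?F (z, t) = \<Phi> j (\<gamma> t) + N' t" for t
  proof -
    have zt: "(z, t) \<in> T" using Om_T[of t t] z by auto
    note dG = smooth_on_differentiable[OF smooth_lift[OF smooth_G] zt]
    have h': "((\<lambda>y. h (fst y)) has_derivative (\<lambda>y. ddir (fst y) h z)) (at (z, t))"
      by (rule has_derivative_compose[OF bounded_linear_imp_has_derivative[OF bounded_linear_fst], where x="(z, t)", simplified])
         (rule smooth_on_has_derivative[OF smooth_h z])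
    have hc: "((\<lambda>y. 2 * (h (fst y))\<^sup>2 * (cos (snd y))\<^sup>2) has_derivative
        (\<lambda>y. 4 * h z * ddir (fst y) h z * (cos t)\<^sup>2 - 4 * (h z)\<^sup>2 * cos t * sin t * snd y)) (at (z, t))"
      by (rule derivative_eq_intros h' refl ext | simp add: algebra_simps)+
    have "ddir (j, 0) ?F (z, t) = 2 * (h z)\<^sup>2 * (cos t)\<^sup>2 * (V / (2 * h z) * sin t * ddir (1, 0) G (\<gamma> t) + ddir (0, snd j) G (\<gamma> t))
       + 2 * V * (cos t)\<^sup>2 * G (\<gamma> t)"
      unfolding ddir_mult[OF differentiableI[OF hc] dG]
      using h_pos[OF z] by (simp add: ddir_eqI[OF hc] ddir_lift[OF smooth_G z] ddir_h[OF z] \<gamma>_def V_def)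
    also have "\<dots> = h z * (cos t)\<^sup>2 * V * sin t * ddir (1, 0) G (\<gamma> t) + 2 * (h z)\<^sup>2 * (cos t)\<^sup>2 * ddir (1, 0) (M (snd j)) (\<gamma> t)
       + 2 * V * (cos t)\<^sup>2 * G (\<gamma> t)"
      using h_pos[OF z] by (simp add: ddir_G_M[OF \<gamma>X] power2_eq_square algebra_simps)
    \<comment> \<open>\<open>2 cos^2 = (cos^2 + sin^2) + (cos^2 - sin^2)\<close>: the second part
      belongs to the total derivative, the first leaves exactly the \<open>V G\<close> from which
      \<open>M_eq\<close> rebuilds \<open>\<Phi> j\<close>.\<close>
    also have "\<dots> = V * G (\<gamma> t) * ((cos t)\<^sup>2 + (sin t)\<^sup>2) + 2 * (h z * sin t) * M (snd j) (\<gamma> t) + N' t"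
      by (simp add: N'_def power2_eq_square algebra_simps
          del: sin_cos_squared_add sin_cos_squared_add2 sin_cos_squared_add3)
    also have "\<dots> = \<Phi> j (\<gamma> t) + N' t"
      using M_eq[OF \<gamma>X[of t], of j] by (simp add: V_def \<gamma>_def)
    finally show ?thesis .
  qed
  have "continuous_on (cbox (- (pi / 2)) (pi / 2)) (\<lambda>t. \<Phi> j (\<gamma> t))"
    by (intro continuous_at_imp_continuous_on ballI DERIV_isCont[OF d\<gamma>[OF smooth_\<Phi>]])
  then have "(\<lambda>t. \<Phi> j (\<gamma> t)) integrable_on cbox (- (pi / 2)) (pi / 2)" by (rule integrable_continuous)
  then have "integral (cbox (- (pi / 2)) (pi / 2)) (\<lambda>t. \<Phi> j (\<gamma> t) + N' t) = integral (cbox (- (pi / 2)) (pi / 2)) (\<lambda>t. \<Phi> j (\<gamma> t)) + 0"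
    using N0 by (subst integral_add) (auto simp: integral_unique)
  then show ?thesis using ddir_action_integrand[OF z] by (simp add: F \<gamma>_def)
qed

lemma ddir2_action:
  assumes z: "z \<in> Om"
  shows "ddir i (ddir j \<Theta>) z = integral (cbox (- (pi / 2)) (pi / 2)) (\<lambda>t.
     Vf i (v0 (snd z), snd z) / (2 * h z) * sin t * ddir (1, 0) (\<Phi> j) (h z * sin t, snd z)
      + ddir (0, snd i) (\<Phi> j) (h z * sin t, snd z))"
proof -
  let ?F = "\<lambda>y. \<Phi> j (h (fst y) * sin (snd y), snd (fst y))"
  have "ddir i (ddir j \<Theta>) z = ddir i (\<lambda>z. integral (cbox (- (pi / 2)) (pi / 2)) (\<lambda>t. ?F (z, t))) z"
    by (rule ddir_cong[OF open_Om z]) (simp add: ddir_action)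
  also have "\<dots> = integral (cbox (- (pi / 2)) (pi / 2)) (\<lambda>t. ddir (i, 0) ?F (z, t))"
    by (rule smooth_on_parametric(2)[OF open_Om Om_T smooth_lift[OF smooth_\<Phi>] z])
  finally show ?thesis by (simp add: ddir_lift[OF smooth_\<Phi> z])
qed

end

section \<open>Small amplitudes\<close>

lemma slope_bound:
  fixes f :: "real \<Rightarrow> real"
  assumes "\<And>y. \<bar>y\<bar> \<le> \<bar>x\<bar> \<Longrightarrow> (f has_real_derivative f' y) (at y)" "\<And>y. \<bar>y\<bar> \<le> \<bar>x\<bar> \<Longrightarrow> \<bar>f' y\<bar> \<le> C"
  shows "\<bar>f x - f 0\<bar> \<le> C * \<bar>x\<bar>"
proof -
  have "norm (f x - f 0) \<le> C * norm (x - 0)"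
    by (rule field_differentiable_bound[of "{- \<bar>x\<bar>..\<bar>x\<bar>}" f f'])
       (use assms in \<open>auto intro: has_field_derivative_at_within simp: abs_le_iff\<close>)
  then show ?thesis by simp
qed

text \<open>The mean value inequality applied twice. The factor 1/2 of Taylor's theorem is given
  away, since only the order in \<open>x\<close> matters.\<close>

lemma taylor_bound:
  fixes f :: "real \<Rightarrow> real"
  assumes f: "\<And>y. \<bar>y\<bar> \<le> \<bar>x\<bar> \<Longrightarrow> (f has_real_derivative f' y) (at y)"
    and f': "\<And>y. \<bar>y\<bar> \<le> \<bar>x\<bar> \<Longrightarrow> (f' has_real_derivative f'' y) (at y)"
    and bd: "\<And>y. \<bar>y\<bar> \<le> \<bar>x\<bar> \<Longrightarrow> \<bar>f'' y\<bar> \<le> C" and C: "C \<ge> 0"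
  shows "\<bar>f x - f 0 - x * f' 0\<bar> \<le> C * x\<^sup>2"
proof -
  have "\<bar>f' y - f' 0\<bar> \<le> C * \<bar>x\<bar>" if "\<bar>y\<bar> \<le> \<bar>x\<bar>" for y
    using slope_bound[of y f' f'' C] f' bd that mult_left_mono[OF that C] by force
  then have "\<bar>(f x - x * f' 0) - (f 0 - 0 * f' 0)\<bar> \<le> (C * \<bar>x\<bar>) * \<bar>x\<bar>"
    by (intro slope_bound[where f'="\<lambda>y. f' y - f' 0"]) (auto intro!: derivative_eq_intros f)
  then show ?thesis by (simp add: power2_eq_square algebra_simps)
qed

lemma integral_sin_half_turn: "(sin has_integral 0) {- (pi / 2)..pi / 2}"
proof -
  have "(sin has_integral (- cos (pi / 2)) - (- cos (- (pi / 2)))) {- (pi / 2)..pi / 2}"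
    by (rule fundamental_theorem_of_calculus)
       (auto intro!: derivative_eq_intros simp flip: has_real_derivative_iff_has_vector_derivative)
  then show ?thesis by simp
qed

lemma integral_sin_squared_half_turn: "((\<lambda>t. (sin t)\<^sup>2) has_integral pi / 2) {- (pi / 2)..pi / 2}"
proof -
  let ?F = "\<lambda>t. (t - sin t * cos t) / 2"
  have "(?F has_real_derivative (sin t)\<^sup>2) (at t within S)" for t S
    by (auto intro!: derivative_eq_intros simp: cos_squared_eq power2_eq_square[symmetric] field_simps)
  then have "((\<lambda>t. (sin t)\<^sup>2) has_integral ?F (pi / 2) - ?F (- (pi / 2))) {- (pi / 2)..pi / 2}"
    by (intro fundamental_theorem_of_calculus) (auto simp flip: has_real_derivative_iff_has_vector_derivative)
  then show ?thesis by simp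
qed

text \<open>Serves to differentiate an identity that holds on an open set; the result is again an
  identity there, so the step can be iterated.\<close>

lemma deriv_zero_on_open:
  assumes "open N" "x \<in> N" "\<And>y. y \<in> N \<Longrightarrow> f y = 0" "(f has_real_derivative d) (at x)"
  shows "d = 0"
proof -
  have "((\<lambda>_. 0) has_real_derivative d) (at x)"
    by (rule has_field_derivative_transform_within_open[OF assms(4,1,2,3)])
  then show ?thesis using DERIV_unique DERIV_const by blast
qed

text \<open>\<open>P1\<close>, \<open>P2\<close>, ... stand for the derivatives of
  \<open>\<psi>\<close> in \<open>x\<close> and \<open>U1\<close>, \<open>U2\<close>, ... for those
  of the potential in \<open>v\<close> along \<open>\<psi>\<close>. Differentiating
  \<open>U1 P1 = 2 x\<close> three times gives the coefficients 3 and 1, 6, 3, 4 of Faa di Bruno's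
  formula. In each identity the highest derivative of \<open>\<psi>\<close> is multiplied by
  \<open>U1\<close>, which vanishes at 0, so the values at 0 can be solved for one after the
  other.\<close>

lemma inverse_profile_identities:
  fixes P1 P2 P3 P4 U1 U2 U3 U4 :: "real \<Rightarrow> real"
  assumes N: "open N" "0 \<in> N"
    and P: "\<And>x. x \<in> N \<Longrightarrow> (P1 has_real_derivative P2 x) (at x)"
      "\<And>x. x \<in> N \<Longrightarrow> (P2 has_real_derivative P3 x) (at x)"
      "\<And>x. x \<in> N \<Longrightarrow> (P3 has_real_derivative P4 x) (at x)"
    and U: "\<And>x. x \<in> N \<Longrightarrow> (U1 has_real_derivative U2 x * P1 x) (at x)"
      "\<And>x. x \<in> N \<Longrightarrow> (U2 has_real_derivative U3 x * P1 x) (at x)"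
      "\<And>x. x \<in> N \<Longrightarrow> (U3 has_real_derivative U4 x * P1 x) (at x)"
    and id: "\<And>x. x \<in> N \<Longrightarrow> U1 x * P1 x = 2 * x" and U0: "U1 0 = 0"
  shows "U2 0 * (P1 0)\<^sup>2 = 2"
    and "U3 0 * P1 0 ^ 3 + 3 * U2 0 * P1 0 * P2 0 = 0"
    and "U4 0 * P1 0 ^ 4 + 6 * U3 0 * (P1 0)\<^sup>2 * P2 0 + U2 0 * (3 * (P2 0)\<^sup>2 + 4 * P1 0 * P3 0) = 0"
proof -
  note d = derivative_eq_intros P U refl
  have 1: "U2 x * (P1 x)\<^sup>2 + U1 x * P2 x - 2 = 0" if x: "x \<in> N" for x
    by (rule deriv_zero_on_open[OF N(1) x, of "\<lambda>x. U1 x * P1 x - 2 * x"])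
       (use id in simp, (rule d x)+, simp add: power2_eq_square)
  have 2: "U3 x * P1 x ^ 3 + 3 * U2 x * P1 x * P2 x + U1 x * P3 x = 0" if x: "x \<in> N" for x
    by (rule deriv_zero_on_open[OF N(1) x 1], assumption)
       ((rule d x)+, simp add: power2_eq_square power3_eq_cube algebra_simps)
  have 3: "U4 x * P1 x ^ 4 + 6 * U3 x * (P1 x)\<^sup>2 * P2 x + U2 x * (3 * (P2 x)\<^sup>2 + 4 * P1 x * P3 x) + U1 x * P4 x = 0"
    if x: "x \<in> N" for x
    by (rule deriv_zero_on_open[OF N(1) x 2], assumption)
       ((rule d x)+, simp add: power2_eq_square power3_eq_cube power4_eq_xxxx algebra_simps)
  show "U2 0 * (P1 0)\<^sup>2 = 2" "U3 0 * P1 0 ^ 3 + 3 * U2 0 * P1 0 * P2 0 = 0"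
    "U4 0 * P1 0 ^ 4 + 6 * U3 0 * (P1 0)\<^sup>2 * P2 0 + U2 0 * (3 * (P2 0)\<^sup>2 + 4 * P1 0 * P3 0) = 0"
    using 1[OF N(2)] 2[OF N(2)] 3[OF N(2)] U0 by simp_all
qed

lemma second_deriv_on_open:
  fixes F F1 E :: "real \<Rightarrow> real"
  assumes "open N" "0 \<in> N" "\<And>x. x \<in> N \<Longrightarrow> (F has_real_derivative F1 x) (at x)"
    and "\<And>x. x \<in> N \<Longrightarrow> (F has_real_derivative E x) (at x)"
    and "(F1 has_real_derivative d) (at 0)" "(E has_real_derivative e) (at 0)"
  shows "d = e"
proof -
  have "F1 x = E x" if "x \<in> N" for x using DERIV_unique assms(3,4) that by blast
  from has_field_derivative_transform_within_open[OF assms(5,1,2) this] show ?thesis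
    using DERIV_unique assms(6) by blast
qed

section \<open>Derivatives at the bottom of the well\<close>

context potential_well begin

definition u3 where "u3 = ddir (1, 0) u2"
definition u4 where "u4 = ddir (1, 0) u3"
definition k1 where "k1 = ddir 1 k"
definition k2 where "k2 = ddir 1 k1"
definition a where "a p = sqrt (2 / u2 (v0 p, p))"
definition Wf :: "real \<times> 'p \<Rightarrow> real \<times> 'p \<Rightarrow> real" where "Wf j = ddir (1, 0) (Vf j)"
definition Zf :: "real \<times> 'p \<Rightarrow> real \<times> 'p \<Rightarrow> real" where "Zf j = ddir (1, 0) (Wf j)"
text \<open>The second parameter derivative of the potential at fixed \<open>v\<close>. It becomes
  \<open>T\<^sub>0 \<otimes> T\<^sub>0\<close>, which for \<open>N = 1\<close> is zero because the
  potential is affine in its parameters.\<close>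

definition Sf :: "real \<times> 'p \<Rightarrow> real \<times> 'p \<Rightarrow> real \<times> 'p \<Rightarrow> real" where
  "Sf i j = ddir (0, snd i) (ddir (0, snd j) u)"

lemma smooth_u3: "smooth_on (I \<times> L) u3" and smooth_u4: "smooth_on (I \<times> L) u4"
  using smooth_u2 by (auto simp: u3_def u4_def intro: smooth_on_ddir)

lemma smooth_k1: "smooth_on I k1"
  unfolding k1_def by (rule smooth_on_ddir[OF smooth_k])

lemma smooth_Wf: "smooth_on (I \<times> L) (Wf j)"
  unfolding Wf_def by (rule smooth_on_ddir[OF smooth_Vf])

lemma v0_in_IL: "p \<in> L \<Longrightarrow> (v0 p, p) \<in> I \<times> L"
  using v0_in_D D_subset by blast

lemma u2_pos: "p \<in> L \<Longrightarrow> u2 (v0 p, p) > 0"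
  using nondeg by (simp add: u2_def u1_def)

lemma a_pos: "p \<in> L \<Longrightarrow> a p > 0" and u2_eq: "p \<in> L \<Longrightarrow> u2 (v0 p, p) = 2 / (a p)\<^sup>2"
  using u2_pos[of p] by (simp_all add: a_def)

lemma deriv_X: "smooth_on X F \<Longrightarrow> (x, p) \<in> X \<Longrightarrow> ((\<lambda>x. F (x, p)) has_real_derivative ddir (1, 0) F (x, p)) (at x)"
  by (intro has_real_derivative_fst smooth_on_differentiable)

lemma deriv_\<psi>: "(x, p) \<in> X \<Longrightarrow> ((\<lambda>x. \<psi> (x, p)) has_real_derivative \<psi>x (x, p)) (at x)"
  unfolding \<psi>x_def by (rule deriv_X[OF smooth_\<psi>])

lemma deriv_comp_\<psi>:
  assumes "smooth_on (I \<times> L) F" "(x, p) \<in> X"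
  shows "((\<lambda>x. F (\<psi> (x, p), p)) has_real_derivative ddir (1, 0) F (\<psi> (x, p), p) * \<psi>x (x, p)) (at x)"
proof -
  have "(\<psi> (x, p), p) \<in> I \<times> L" using \<psi>_in_D[OF assms(2)] D_subset by auto
  then show ?thesis
    using DERIV_chain2[where f="\<lambda>v. F (v, p)", OF has_real_derivative_fst deriv_\<psi>[OF assms(2)]]
      smooth_on_differentiable[OF assms(1)] by blast
qed

lemma deriv_kind_\<psi>:
  assumes "smooth_on I F" "(x, p) \<in> X"
  shows "((\<lambda>x. F (\<psi> (x, p))) has_real_derivative ddir 1 F (\<psi> (x, p)) * \<psi>x (x, p)) (at x)"
  by (rule DERIV_chain2[where f=F, OF ddir_real_has_field_derivative deriv_\<psi>[OF assms(2)]])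
     (rule smooth_on_differentiable[OF assms(1) \<psi>_in_I[OF assms(2)]])

lemma open_slice_X: "open {x. (x, p) \<in> X}"
  using open_preimage[OF open_UNIV _ open_X, of "\<lambda>x. (x, p)"] by (simp add: continuous_intros)

definition \<psi>2 where "\<psi>2 = ddir (1, 0) \<psi>x"
definition \<psi>3 where "\<psi>3 = ddir (1, 0) \<psi>2"

lemma smooth_\<psi>2: "smooth_on X \<psi>2" and smooth_\<psi>3: "smooth_on X \<psi>3"
  using smooth_\<psi>x by (auto simp: \<psi>2_def \<psi>3_def intro: smooth_on_ddir)

text \<open>Differentiating \<open>\<phi> (\<psi> (x, p), p) = x\<close> gives
  \<open>\<phi>1 \<psi>x = 1\<close>.\<close>

lemma \<psi>x_pos: assumes "(x, p) \<in> X" shows "\<psi>x (x, p) > 0"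
proof -
  have vD: "(\<psi> (x, p), p) \<in> D" using \<psi>_in_D[OF assms] by simp
  have "((\<lambda>x. \<phi> (\<psi> (x, p), p)) has_real_derivative \<phi>1 (\<psi> (x, p), p) * \<psi>x (x, p)) (at x)"
    by (rule DERIV_chain2[where f="\<lambda>v. \<phi> (v, p)", OF deriv_\<phi>[OF vD] deriv_\<psi>[OF assms]])
  then have "((\<lambda>x. \<phi> (\<psi> (x, p), p) - x) has_real_derivative \<phi>1 (\<psi> (x, p), p) * \<psi>x (x, p) - 1) (at x)"
    by (intro DERIV_diff DERIV_ident)
  from deriv_zero_on_open[OF open_slice_X _ _ this] have "\<phi>1 (\<psi> (x, p), p) * \<psi>x (x, p) = 1"
    using assms \<phi>_\<psi> by fastforce
  then show ?thesis using \<phi>1_pos[OF vD] by (metis zero_less_mult_pos zero_less_one)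
qed

text \<open>The identities for the inverse profile are solved in turn with
  \<open>u2 = 2 / a^2\<close>. The first determines \<open>\<psi>x\<close> only up to sign, which
  \<open>\<psi>x_pos\<close> fixes.\<close>

lemma
  assumes p: "p \<in> L"
  shows \<psi>x_zero: "\<psi>x (0, p) = a p"
    and \<psi>2_zero: "\<psi>2 (0, p) = - u3 (v0 p, p) * a p ^ 4 / 6"
    and \<psi>3_zero: "\<psi>3 (0, p) = - (a p / 8) * (u4 (v0 p, p) * a p ^ 4 - 5 / 6 * (u3 (v0 p, p))\<^sup>2 * a p ^ 6)"
proof -
  define N where "N = {x. (x, p) \<in> X}"
  have N: "open N" "0 \<in> N" using open_slice_X zero_in_X[OF p] by (simp_all add: N_def)
  have P: "((\<lambda>x. \<psi>x (x, p)) has_real_derivative \<psi>2 (x, p)) (at x)"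
    "((\<lambda>x. \<psi>2 (x, p)) has_real_derivative \<psi>3 (x, p)) (at x)"
    "((\<lambda>x. \<psi>3 (x, p)) has_real_derivative ddir (1, 0) \<psi>3 (x, p)) (at x)" if "x \<in> N" for x
    using that deriv_X[OF smooth_\<psi>x, of x p] deriv_X[OF smooth_\<psi>2, of x p] deriv_X[OF smooth_\<psi>3, of x p]
    by (simp_all add: N_def \<psi>2_def \<psi>3_def)
  have U: "((\<lambda>x. u1 (\<psi> (x, p), p)) has_real_derivative u2 (\<psi> (x, p), p) * \<psi>x (x, p)) (at x)"
    "((\<lambda>x. u2 (\<psi> (x, p), p)) has_real_derivative u3 (\<psi> (x, p), p) * \<psi>x (x, p)) (at x)"
    "((\<lambda>x. u3 (\<psi> (x, p), p)) has_real_derivative u4 (\<psi> (x, p), p) * \<psi>x (x, p)) (at x)" if "x \<in> N" for x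
    using that deriv_comp_\<psi>[OF smooth_u1, of x p] deriv_comp_\<psi>[OF smooth_u2, of x p] deriv_comp_\<psi>[OF smooth_u3, of x p]
    by (simp_all add: N_def u2_def u3_def u4_def)
  have id: "u1 (\<psi> (x, p), p) * \<psi>x (x, p) = 2 * x" if "x \<in> N" for x
    using ddir_u_\<psi>(1)[of "(x, p)"] that by (simp add: N_def)
  have U0: "u1 (\<psi> (0, p), p) = 0" using crit[OF p] by (simp add: \<psi>_zero[OF p] u1_def)
  note * = inverse_profile_identities[OF N P U id U0, unfolded \<psi>_zero[OF p]]
  show 1: "\<psi>x (0, p) = a p"
  proof (rule power2_eq_imp_eq)
    show "(\<psi>x (0, p))\<^sup>2 = (a p)\<^sup>2"
      using *(1) a_pos[OF p] unfolding u2_eq[OF p] by (simp add: field_simps)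
  qed (use a_pos[OF p] \<psi>x_pos[of 0 p] zero_in_X[OF p] in simp_all)
  show 2: "\<psi>2 (0, p) = - u3 (v0 p, p) * a p ^ 4 / 6"
    using *(2) a_pos[OF p] unfolding 1 u2_eq[OF p]
    by (simp add: field_simps power2_eq_square power3_eq_cube power4_eq_xxxx)
  show "\<psi>3 (0, p) = - (a p / 8) * (u4 (v0 p, p) * a p ^ 4 - 5 / 6 * (u3 (v0 p, p))\<^sup>2 * a p ^ 6)"
  proof -
    \<comment> \<open>The coefficient of \<open>\<psi>3\<close> is \<open>4 u2 a = 8 / a\<close>,
      hence the 1/8. With \<open>\<psi>2 = - u3 a^4 / 6\<close> the two terms quadratic in
      \<open>u3\<close> are \<open>- u3^2 a^6\<close> and \<open>u3^2 a^6 / 6\<close>, hence the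
      5/6.\<close>
    have "a p * \<psi>3 (0, p) = a p * (- (a p / 8) * (u4 (v0 p, p) * a p ^ 4 - 5 / 6 * (u3 (v0 p, p))\<^sup>2 * a p ^ 6))"
      using *(3) a_pos[OF p] unfolding 1 2 u2_eq[OF p]
      by (simp add: field_simps power2_eq_square power4_eq_xxxx eval_nat_numeral)
    moreover have "a p \<noteq> 0" using a_pos[OF p] by simp
    ultimately show ?thesis using mult_left_cancel by blast
  qed
qed

lemma G_zero: "p \<in> L \<Longrightarrow> G (0, p) = k (v0 p) * a p"
  by (simp add: G_def \<psi>_zero \<psi>x_zero)

text \<open>Leibniz' rule for \<open>G\<close> times \<open>Vf j\<close> along
  \<open>\<psi>\<close>: the coefficients of \<open>Vf\<close>, \<open>Wf\<close> and
  \<open>Zf\<close> are \<open>G''\<close>, \<open>2 G' \<psi>' + G \<psi>''\<close> and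
  \<open>G \<psi>'^2\<close> at \<open>x = 0\<close>.\<close>

lemma ddir2_\<Phi>_zero:
  assumes p: "p \<in> L"
  shows "ddir (1, 0) (ddir (1, 0) (\<Phi> j)) (0, p) =
    (k2 (v0 p) * a p ^ 3 + 3 * k1 (v0 p) * a p * \<psi>2 (0, p) + k (v0 p) * \<psi>3 (0, p)) * Vf j (v0 p, p)
    + (2 * (k1 (v0 p) * (a p)\<^sup>2 + k (v0 p) * \<psi>2 (0, p)) * a p + k (v0 p) * a p * \<psi>2 (0, p)) * Wf j (v0 p, p)
    + k (v0 p) * a p * (a p)\<^sup>2 * Zf j (v0 p, p)"
proof (rule second_deriv_on_open[OF open_slice_X[of p], of "\<lambda>x. \<Phi> j (x, p)" "\<lambda>x. ddir (1, 0) (\<Phi> j) (x, p)"])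
  note P = deriv_X[OF smooth_\<psi>x, folded \<psi>2_def] deriv_X[OF smooth_\<psi>2, folded \<psi>3_def]
  note K = deriv_kind_\<psi>[OF smooth_k, folded k1_def] deriv_kind_\<psi>[OF smooth_k1, folded k2_def]
  note V = deriv_comp_\<psi>[OF smooth_Vf, folded Wf_def] deriv_comp_\<psi>[OF smooth_Wf, folded Zf_def]
  let ?k = "\<lambda>x. k (\<psi> (x, p))" and ?k1 = "\<lambda>x. k1 (\<psi> (x, p))" and ?P = "\<lambda>x. \<psi>x (x, p)" and ?P2 = "\<lambda>x. \<psi>2 (x, p)"
    and ?V = "\<lambda>x. Vf j (\<psi> (x, p), p)" and ?W = "\<lambda>x. Wf j (\<psi> (x, p), p)"
  show "0 \<in> {x. (x, p) \<in> X}" using zero_in_X[OF p] by simp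
  show "((\<lambda>x. \<Phi> j (x, p)) has_real_derivative ddir (1, 0) (\<Phi> j) (x, p)) (at x)" if "x \<in> {x. (x, p) \<in> X}" for x
    using deriv_X[OF smooth_\<Phi>] that by simp
  show "((\<lambda>x. ddir (1, 0) (\<Phi> j) (x, p)) has_real_derivative ddir (1, 0) (ddir (1, 0) (\<Phi> j)) (0, p)) (at 0)"
    by (rule deriv_X[OF smooth_on_ddir[OF smooth_\<Phi>] zero_in_X[OF p]])
  show "((\<lambda>x. \<Phi> j (x, p)) has_real_derivative
    (?k1 x * ?P x * ?P x + ?k x * ?P2 x) * ?V x + ?k x * ?P x * (?W x * ?P x)) (at x)"
    if "x \<in> {x. (x, p) \<in> X}" for x
  proof -
    have x: "(x, p) \<in> X" using that by simp
    show ?thesis unfolding \<Phi>_def G_def fst_conv snd_conv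
      by (rule derivative_eq_intros refl P[OF x] K[OF x] V[OF x])+ (simp add: algebra_simps)
  qed
  note z = zero_in_X[OF p]
  show "((\<lambda>x. (?k1 x * ?P x * ?P x + ?k x * ?P2 x) * ?V x + ?k x * ?P x * (?W x * ?P x)) has_real_derivative
    (k2 (v0 p) * a p ^ 3 + 3 * k1 (v0 p) * a p * \<psi>2 (0, p) + k (v0 p) * \<psi>3 (0, p)) * Vf j (v0 p, p)
    + (2 * (k1 (v0 p) * (a p)\<^sup>2 + k (v0 p) * \<psi>2 (0, p)) * a p + k (v0 p) * a p * \<psi>2 (0, p)) * Wf j (v0 p, p)
    + k (v0 p) * a p * (a p)\<^sup>2 * Zf j (v0 p, p)) (at 0)"
    by (rule derivative_eq_intros refl P[OF z] K[OF z] V[OF z])+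
       (simp add: \<psi>x_zero[OF p] \<psi>_zero[OF p] power2_eq_square power3_eq_cube algebra_simps)
qed

lemma ddir_comp_v0:
  assumes F: "smooth_on (I \<times> L) F" and p: "p \<in> L"
  shows "ddir q (\<lambda>p. F (v0 p, p)) p = ddir q v0 p * ddir (1, 0) F (v0 p, p) + ddir (0, q) F (v0 p, p)"
proof -
  note F' = smooth_on_differentiable[OF F v0_in_IL[OF p]]
  have "((\<lambda>p. (v0 p, p)) has_derivative (\<lambda>q. (ddir q v0 p, q))) (at p)"
    by (intro has_derivative_Pair has_derivative_ident smooth_on_has_derivative[OF smooth_v0 p])
  from ddir_compose[where g=F and \<Gamma>="\<lambda>p. (v0 p, p)", OF F' this, of q]
  show ?thesis using ddir_prod_split[OF F', of "ddir q v0 p" q] by simp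
qed

lemma smooth_comp_v0: "smooth_on (I \<times> L) F \<Longrightarrow> smooth_on L (\<lambda>p. F (v0 p, p))"
  by (rule smooth_on_compose[where g=F, OF _ open_L smooth_map_Pair[OF _ smooth_map_id]])
     (use smooth_v0 v0_in_IL open_L in auto)

lemma Wf_eq: "y \<in> I \<times> L \<Longrightarrow> Wf i y = - ddir (0, snd i) u1 y"
proof -
  assume y: "y \<in> I \<times> L"
  have "Wf i y = ddir (1, 0) (\<lambda>y. fst i) y - ddir (1, 0) (ddir (0, snd i) u) y"
    unfolding Wf_def Vf_def[abs_def]
    by (rule ddir_diff) (auto intro: smooth_on_differentiable[OF smooth_on_ddir[OF smooth_u] y])
  also have "\<dots> = - ddir (0, snd i) u1 y"
    unfolding u1_def by (simp add: ddir_eqI[OF has_derivative_const] ddir_commute[OF open_IL y smooth_u])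
  finally show ?thesis .
qed

lemma Zf_eq: "y \<in> I \<times> L \<Longrightarrow> Zf i y = - ddir (0, snd i) u2 y"
proof -
  assume y: "y \<in> I \<times> L"
  have "Zf i y = ddir (1, 0) (\<lambda>y. 0 - ddir (0, snd i) u1 y) y"
    unfolding Zf_def by (rule ddir_cong[OF open_IL y]) (simp add: Wf_eq)
  also have "\<dots> = ddir (1, 0) (\<lambda>y. 0) y - ddir (1, 0) (ddir (0, snd i) u1) y"
    by (rule ddir_diff) (auto intro: smooth_on_differentiable[OF smooth_on_ddir[OF smooth_u1] y])
  also have "\<dots> = - ddir (0, snd i) u2 y"
    unfolding u2_def by (simp add: ddir_eqI[OF has_derivative_const] ddir_commute[OF open_IL y smooth_u1])
  finally show ?thesis .
qed

text \<open>Implicit differentiation of \<open>u1 (v0 p, p) = 0\<close>.\<close>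

lemma ddir_v0: "p \<in> L \<Longrightarrow> ddir (snd i) v0 p = Wf i (v0 p, p) / u2 (v0 p, p)"
proof -
  assume p: "p \<in> L"
  have "ddir (snd i) (\<lambda>p. u1 (v0 p, p)) p = ddir (snd i) (\<lambda>p. 0) p"
    by (rule ddir_cong[OF open_L p]) (simp add: u1_def crit)
  then show ?thesis
    using ddir_comp_v0[OF smooth_u1 p, of "snd i"] Wf_eq[OF v0_in_IL[OF p], of i] u2_pos[OF p]
    by (simp add: ddir_eqI[OF has_derivative_const] field_simps flip: u2_def)
qed

text \<open>On \<open>x = 0\<close> the function \<open>\<Phi> j\<close> reduces to
  \<open>k (v0 p) * a p * Vf j (v0 p, p)\<close>. The motion of \<open>v0\<close> produces the terms
  with \<open>Wf i\<close>; \<open>Zf i\<close> enters through the explicit parameter dependence of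
  \<open>u2\<close> inside \<open>a\<close>, and \<open>Sf\<close> through that of
  \<open>Vf j\<close>.\<close>

lemma ddir_\<Phi>_zero:
  assumes p: "p \<in> L"
  shows "ddir (0, snd i) (\<Phi> j) (0, p) = k (v0 p) * a p *
    (((k1 (v0 p) / k (v0 p) * (a p)\<^sup>2 / 2 - u3 (v0 p, p) * a p ^ 4 / 8) * Wf i (v0 p, p) + (a p)\<^sup>2 / 4 * Zf i (v0 p, p)) * Vf j (v0 p, p)
     + (a p)\<^sup>2 / 2 * Wf i (v0 p, p) * Wf j (v0 p, p) - Sf i j (v0 p, p))"
proof -
  let ?q = "snd i"
  note y = v0_in_IL[OF p]
  have v0_I: "v0 p \<in> I" using y by simp
  have k: "k (v0 p) > 0" using k_pos[OF v0_I] .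
  note dv0 = smooth_on_has_derivative[OF smooth_v0 p]
  have dk: "((\<lambda>p. k (v0 p)) has_derivative (\<lambda>q. k1 (v0 p) * ddir q v0 p)) (at p)"
    using has_derivative_compose[OF dv0, of k "\<lambda>h. k1 (v0 p) * h"]
      ddir_real_has_field_derivative[OF smooth_on_differentiable[OF smooth_k v0_I]]
    by (simp add: has_field_derivative_def k1_def mult_commute_abs)
  have du2: "((\<lambda>p. u2 (v0 p, p)) has_derivative (\<lambda>q. ddir q (\<lambda>p. u2 (v0 p, p)) p)) (at p)"
    by (rule smooth_on_has_derivative[OF smooth_comp_v0[OF smooth_u2] p])
  \<comment> \<open>As a function of \<open>s = u2\<close>, \<open>a\<close> is a multiple of
    \<open>s^(-1/2)\<close>, so its derivative is \<open>- a / (2 s)\<close>, and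
    \<open>s = 2 / a^2\<close>.\<close>
  have ds: "((\<lambda>s. sqrt (2 / s)) has_real_derivative (- (a p ^ 3) / 4)) (at (u2 (v0 p, p)))"
  proof -
    have "((\<lambda>s. sqrt (2 / s)) has_real_derivative (- (2 / (u2 (v0 p, p))\<^sup>2) * (inverse (sqrt (2 / u2 (v0 p, p))) / 2))) (at (u2 (v0 p, p)))"
      using u2_pos[OF p] by (auto intro!: derivative_eq_intros simp: power2_eq_square)
    also have "- (2 / (u2 (v0 p, p))\<^sup>2) * (inverse (sqrt (2 / u2 (v0 p, p))) / 2) = - (a p ^ 3) / 4"
      unfolding a_def[symmetric] unfolding u2_eq[OF p] using a_pos[OF p]
      by (simp add: field_simps power2_eq_square power3_eq_cube)
    finally show ?thesis .
  qed
  have da: "(a has_derivative (\<lambda>q. - (a p ^ 3) / 4 * ddir q (\<lambda>p. u2 (v0 p, p)) p)) (at p)"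
    using has_derivative_compose[OF du2 ds[unfolded has_field_derivative_def]] by (simp add: a_def[abs_def])
  have dV: "((\<lambda>p. Vf j (v0 p, p)) has_derivative (\<lambda>q. ddir q (\<lambda>p. Vf j (v0 p, p)) p)) (at p)"
    by (rule smooth_on_has_derivative[OF smooth_comp_v0[OF smooth_Vf] p])
  have "ddir (0, ?q) (\<Phi> j) (0, p) = ddir ?q (\<lambda>p. \<Phi> j (0, p)) p"
    by (rule ddir_snd[symmetric]) (rule smooth_on_differentiable[OF smooth_\<Phi> zero_in_X[OF p]])
  also have "\<dots> = ddir ?q (\<lambda>p. k (v0 p) * a p * Vf j (v0 p, p)) p"
    by (rule ddir_cong[OF open_L p]) (simp add: \<Phi>_def G_zero \<psi>_zero)
  also have "\<dots> = k (v0 p) * a p * ddir ?q (\<lambda>p. Vf j (v0 p, p)) p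
     + (k (v0 p) * (- (a p ^ 3) / 4 * ddir ?q (\<lambda>p. u2 (v0 p, p)) p) + k1 (v0 p) * ddir ?q v0 p * a p) * Vf j (v0 p, p)"
    by (rule ddir_eqI[OF has_derivative_mult[OF has_derivative_mult[OF dk da] dV]])
  also have "ddir ?q (\<lambda>p. u2 (v0 p, p)) p = u3 (v0 p, p) * Wf i (v0 p, p) * (a p)\<^sup>2 / 2 - Zf i (v0 p, p)"
    using ddir_comp_v0[OF smooth_u2 p] Zf_eq[OF y, of i] a_pos[OF p] by (simp add: u3_def ddir_v0[OF p] u2_eq[OF p])
  also have "ddir ?q (\<lambda>p. Vf j (v0 p, p)) p = Wf i (v0 p, p) * Wf j (v0 p, p) * (a p)\<^sup>2 / 2 - Sf i j (v0 p, p)"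
  proof -
    have "ddir (0, ?q) (Vf j) (v0 p, p) = ddir (0, ?q) (\<lambda>y. fst j) (v0 p, p) - Sf i j (v0 p, p)"
      unfolding Vf_def[abs_def] Sf_def
      by (rule ddir_diff) (auto intro: smooth_on_differentiable[OF smooth_on_ddir[OF smooth_u] y])
    then show ?thesis
      using ddir_comp_v0[OF smooth_Vf p, of ?q j]
      by (simp add: ddir_v0[OF p] u2_eq[OF p] ddir_eqI[OF has_derivative_const] flip: Wf_def)
  qed
  also have "ddir ?q v0 p = Wf i (v0 p, p) * (a p)\<^sup>2 / 2"
    by (simp add: ddir_v0[OF p] u2_eq[OF p])
  finally have eq: "ddir (0, ?q) (\<Phi> j) (0, p) = k (v0 p) * a p * (Wf i (v0 p, p) * Wf j (v0 p, p) * (a p)\<^sup>2 / 2 - Sf i j (v0 p, p))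
     + (k (v0 p) * (- (a p ^ 3) / 4 * (u3 (v0 p, p) * Wf i (v0 p, p) * (a p)\<^sup>2 / 2 - Zf i (v0 p, p)))
        + k1 (v0 p) * (Wf i (v0 p, p) * (a p)\<^sup>2 / 2) * a p) * Vf j (v0 p, p)" .
  define \<rho> where "\<rho> = k1 (v0 p) / k (v0 p)"
  have k1: "k1 (v0 p) = \<rho> * k (v0 p)" using k by (simp add: \<rho>_def)
  show ?thesis
    unfolding eq \<rho>_def[symmetric] k1
    by (simp add: field_simps power2_eq_square power3_eq_cube power4_eq_xxxx)
qed

text \<open>\<open>A\<close> and \<open>B\<close> are \<open>\<alpha>\<^sub>0\<close> and \<open>\<beta>\<^sub>0\<close> in terms of the derivatives of \<open>u\<close> and \<open>k\<close> at \<open>v0\<close>.\<close>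

definition A :: "'p \<Rightarrow> real" where
  "A p = (k2 (v0 p) * a p ^ 3 / 4 - k1 (v0 p) * u3 (v0 p, p) * a p ^ 5 / 8
     + k (v0 p) * (5 / 192 * (u3 (v0 p, p))\<^sup>2 * a p ^ 7 - u4 (v0 p, p) * a p ^ 5 / 32)) / (k (v0 p) * a p)"

definition B :: "'p \<Rightarrow> real" where
  "B p = k1 (v0 p) / k (v0 p) * (a p)\<^sup>2 / 2 - u3 (v0 p, p) * a p ^ 4 / 8"

definition H :: "real \<times> 'p \<Rightarrow> real \<times> 'p \<Rightarrow> 'p \<Rightarrow> real" where
  "H i j p = A p * Vf i (v0 p, p) * Vf j (v0 p, p)
    + B p * (Vf i (v0 p, p) * Wf j (v0 p, p) + Wf i (v0 p, p) * Vf j (v0 p, p))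
    + (a p)\<^sup>2 / 2 * Wf i (v0 p, p) * Wf j (v0 p, p) - Sf i j (v0 p, p)
    + (a p)\<^sup>2 / 4 * (Vf i (v0 p, p) * Zf j (v0 p, p) + Zf i (v0 p, p) * Vf j (v0 p, p))"

text \<open>The two summands are not symmetric in \<open>i\<close> and \<open>j\<close>: the second
  \<open>x\<close>-derivative of \<open>\<Phi> j\<close> supplies the terms
  \<open>V\<^sub>i V\<^sub>j\<close>, \<open>V\<^sub>i W\<^sub>j\<close> and
  \<open>V\<^sub>i Z\<^sub>j\<close>, the parameter derivative supplies
  \<open>W\<^sub>i V\<^sub>j\<close>, \<open>Z\<^sub>i V\<^sub>j\<close>,
  \<open>W\<^sub>i W\<^sub>j\<close> and \<open>Sf\<close>. The coefficients of mirrored terms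
  agree, as the symmetry of the Hessian demands.\<close>

lemma H_eq:
  assumes p: "p \<in> L"
  shows "Vf i (v0 p, p) / 4 * ddir (1, 0) (ddir (1, 0) (\<Phi> j)) (0, p) + ddir (0, snd i) (\<Phi> j) (0, p) = k (v0 p) * a p * H i j p"
proof -
  have k: "k (v0 p) > 0" using k_pos v0_in_IL[OF p] by blast
  have A: "(k2 (v0 p) * a p ^ 3 + 3 * k1 (v0 p) * a p * \<psi>2 (0, p) + k (v0 p) * \<psi>3 (0, p)) = 4 * (k (v0 p) * a p) * A p"
  proof -
    have "k (v0 p) * a p * A p = k2 (v0 p) * a p ^ 3 / 4 - k1 (v0 p) * u3 (v0 p, p) * a p ^ 5 / 8
       + k (v0 p) * (5 / 192 * (u3 (v0 p, p))\<^sup>2 * a p ^ 7 - u4 (v0 p, p) * a p ^ 5 / 32)"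
      using k a_pos[OF p] by (simp add: A_def)
    then show ?thesis by (simp add: \<psi>2_zero[OF p] \<psi>3_zero[OF p] eval_nat_numeral algebra_simps)
  qed
  have B: "2 * (k1 (v0 p) * (a p)\<^sup>2 + k (v0 p) * \<psi>2 (0, p)) * a p + k (v0 p) * a p * \<psi>2 (0, p) = 4 * (k (v0 p) * a p) * B p"
    using k a_pos[OF p] by (simp add: B_def \<psi>2_zero[OF p] field_simps eval_nat_numeral)
  show ?thesis
    unfolding ddir2_\<Phi>_zero[OF p] ddir_\<Phi>_zero[OF p] A B H_def B_def[of p, symmetric]
    by (simp add: algebra_simps)
qed

end

section \<open>Uniform estimates near the bottom\<close>

context well_action begin

abbreviation near_bottom :: "'p \<Rightarrow> (real \<times> 'p) filter" where
  "near_bottom p \<equiv> at (\<mu>0 p, p) within Om"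

lemma tendsto_h:
  assumes p0: "p0 \<in> L" shows "(h \<longlongrightarrow> 0) (near_bottom p0)"
proof -
  \<comment> \<open>\<open>sqrt\<close> is continuous on the whole real line, also at the negative
    arguments below the bottom. Thus \<open>h\<close> is continuous around the limit point, which
    lies outside \<open>Om\<close>, and the limit is found by evaluation.\<close>
  have "continuous_on (UNIV \<times> L) h" unfolding h_def[abs_def]
    by (intro continuous_intros continuous_on_compose2[OF smooth_on_continuous_on[OF smooth_\<mu>0]]) auto
  then have "isCont h (\<mu>0 p0, p0)"
    using p0 open_L by (subst (asm) continuous_on_eq_continuous_at) (auto intro!: open_Times)
  moreover have "h (\<mu>0 p0, p0) = 0" by (simp add: h_def)
  ultimately show ?thesis
    unfolding isCont_def by (metis tendsto_within_subset subset_UNIV)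
qed

text \<open>The source of uniform constants: near the limit point every segment from
  \<open>-h\<close> to \<open>h\<close>, over whatever parameter it lies, stays in one compact part
  of \<open>X\<close>.\<close>

lemma eventually_in_compact:
  assumes p0: "p0 \<in> L"
  shows "\<exists>K. compact K \<and> K \<subseteq> X \<and> (\<forall>\<^sub>F z in near_bottom p0. z \<in> Om \<and> (\<forall>x. \<bar>x\<bar> \<le> h z \<longrightarrow> (x, snd z) \<in> K))"
proof -
  obtain e where e: "e > 0" "cball (0, p0) e \<subseteq> X"
    using open_X zero_in_X[OF p0] open_contains_cball by blast
  \<comment> \<open>The product distance is at most the sum of the two distances, hence half of
    \<open>e\<close> for each factor.\<close>
  define r where "r = e / 2"
  define K where "K = {-r..r} \<times> cball p0 r"
  have r: "r > 0" using e by (simp add: r_def)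
  have "K \<subseteq> X"
  proof
    fix z assume "z \<in> K"
    then have z: "\<bar>fst z\<bar> \<le> r" "dist p0 (snd z) \<le> r" by (auto simp: K_def)
    have "dist (0, p0) (fst z, snd z) \<le> dist 0 (fst z) + dist p0 (snd z)"
      unfolding dist_Pair_Pair by (rule sqrt_sum_squares_le_sum) auto
    then show "z \<in> X" using z e by (auto simp: r_def)
  qed
  moreover have "compact K" unfolding K_def by (intro compact_Times compact_cball) simp
  moreover have "\<forall>\<^sub>F z in near_bottom p0. z \<in> Om \<and> (\<forall>x. \<bar>x\<bar> \<le> h z \<longrightarrow> (x, snd z) \<in> K)"
  proof -
    have 1: "\<forall>\<^sub>F z in near_bottom p0. h z < r"
      by (rule order_tendstoD(2)[OF tendsto_h[OF p0] r])
    have "(snd \<longlongrightarrow> p0) (near_bottom p0)"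
      by (rule tendsto_eq_intros refl | simp)+
    then have 2: "\<forall>\<^sub>F z in near_bottom p0. snd z \<in> ball p0 r"
      using r by (intro topological_tendstoD) auto
    have 3: "\<forall>\<^sub>F z in near_bottom p0. z \<in> Om" by (simp add: eventually_at_filter)
    show ?thesis using 1 2 3 by eventually_elim (auto simp: K_def)
  qed
  ultimately show ?thesis by blast
qed

lemma compact_bound:
  assumes "smooth_on X F" "compact K" "K \<subseteq> X" shows "\<exists>C\<ge>0. \<forall>z\<in>K. \<bar>F z\<bar> \<le> C"
proof -
  have "continuous_on K F" using smooth_on_continuous_on[OF assms(1)] assms(3) by (rule continuous_on_subset)
  from compact_imp_bounded[OF compact_continuous_image[OF this assms(2)]]
  obtain C where "\<forall>x\<in>F ` K. norm x \<le> C" by (auto simp: bounded_iff)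
  then show ?thesis by (intro exI[of _ "max C 0"]) force
qed

text \<open>\<open>v3 - v2 = \<psi> (h) - \<psi> (-h) = 2 h \<psi>x\<close> at an intermediate
  point, and both \<open>\<psi>x\<close> and its inverse are bounded on the compact set.\<close>

lemma h_comparable_width:
  assumes p0: "p0 \<in> L"
  shows "\<exists>C. \<forall>\<^sub>F z in near_bottom p0. h z \<le> C * ((v3 z - v2 z) / 2) \<and> (v3 z - v2 z) / 2 \<le> C * h z"
proof -
  obtain K where K: "compact K" "K \<subseteq> X"
    and near: "\<forall>\<^sub>F z in near_bottom p0. z \<in> Om \<and> (\<forall>x. \<bar>x\<bar> \<le> h z \<longrightarrow> (x, snd z) \<in> K)"
    using eventually_in_compact[OF p0] by blast
  have pos: "\<psi>x y > 0" if "y \<in> X" for y using \<psi>x_pos[of "fst y" "snd y"] that by simp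
  have inv: "smooth_on X (\<lambda>y. inverse (\<psi>x y))"
    by (intro smooth_on_inverse open_X smooth_\<psi>x) (use pos in force)
  obtain C1 where C1: "C1 \<ge> 0" "\<And>y. y \<in> K \<Longrightarrow> \<bar>\<psi>x y\<bar> \<le> C1" using compact_bound[OF smooth_\<psi>x K] by blast
  obtain C2 where C2: "C2 \<ge> 0" "\<And>y. y \<in> K \<Longrightarrow> \<bar>inverse (\<psi>x y)\<bar> \<le> C2" using compact_bound[OF inv K] by blast
  show ?thesis
  proof (rule exI[of _ "max C1 C2"], use near in eventually_elim)
    case (elim z)
    then have z: "z \<in> Om" and inK: "\<And>x. \<bar>x\<bar> \<le> h z \<Longrightarrow> (x, snd z) \<in> K" by auto
    have h: "h z > 0" by (rule h_pos[OF z])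
    obtain x where x: "- h z < x" "x < h z"
      and eq: "\<psi> (h z, snd z) - \<psi> (- h z, snd z) = (h z - - h z) * \<psi>x (x, snd z)"
      using MVT2[of "- h z" "h z" "\<lambda>x. \<psi> (x, snd z)" "\<lambda>x. \<psi>x (x, snd z)"] h deriv_\<psi> inK K(2)
      by (auto simp: abs_le_iff subset_iff)
    have xK: "(x, snd z) \<in> K" using x by (intro inK) auto
    have P: "\<psi>x (x, snd z) > 0" using xK K(2) pos by blast
    have \<delta>: "(v3 z - v2 z) / 2 = h z * \<psi>x (x, snd z)" using eq by (simp add: \<psi>_h[OF z])
    have "\<psi>x (x, snd z) \<le> max C1 C2" using C1(2)[OF xK] by simp
    moreover have "inverse (\<psi>x (x, snd z)) \<le> max C1 C2" using C2(2)[OF xK] P by simp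
    then have "1 \<le> max C1 C2 * \<psi>x (x, snd z)" using P by (simp add: field_simps inverse_eq_divide)
    then have "h z * 1 \<le> h z * (max C1 C2 * \<psi>x (x, snd z))" using h by (intro mult_left_mono) auto
    ultimately show ?case unfolding \<delta> using h by (auto simp: mult.commute mult.left_commute intro: mult_left_mono)
  qed
qed

text \<open>The integrand \<open>f\<close> of the second derivative is replaced by its expansion
  \<open>g\<close> in \<open>x = h sin t\<close>, whose integral is exactly \<open>\<pi>\<close>
  times the expression of \<open>H_eq\<close>. The difference is of order \<open>h\<close>
  pointwise, and the interval has length \<open>\<pi>\<close>.\<close>

lemma hessian_asymptotics:
  assumes p0: "p0 \<in> L"
  shows "\<exists>C. \<forall>\<^sub>F z in near_bottom p0.
    \<bar>ddir i (ddir j \<Theta>) z - pi * (k (v0 (snd z)) * a (snd z) * H i j (snd z))\<bar> \<le> C * h z"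
proof -
  obtain K where K: "compact K" "K \<subseteq> X"
    and near: "\<forall>\<^sub>F z in near_bottom p0. z \<in> Om \<and> (\<forall>x. \<bar>x\<bar> \<le> h z \<longrightarrow> (x, snd z) \<in> K)"
    using eventually_in_compact[OF p0] by blast
  note bound = compact_bound[OF _ K] and KX = K(2)
  let ?\<Phi> = "\<Phi> j" and ?\<Phi>q = "ddir (0, snd i) (\<Phi> j)"
  let ?\<Phi>x = "ddir (1, 0) ?\<Phi>" let ?\<Phi>xx = "ddir (1, 0) ?\<Phi>x" let ?\<Phi>xxx = "ddir (1, 0) ?\<Phi>xx"
  have sm: "smooth_on X ?\<Phi>x" "smooth_on X ?\<Phi>xx" "smooth_on X ?\<Phi>xxx" "smooth_on X ?\<Phi>q" "smooth_on X (ddir (1, 0) ?\<Phi>q)"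
    by (intro smooth_on_ddir smooth_\<Phi>)+
  obtain C1 where C1: "C1 \<ge> 0" "\<And>z. z \<in> K \<Longrightarrow> \<bar>?\<Phi>xxx z\<bar> \<le> C1" using bound[OF sm(3)] by blast
  obtain C2 where C2: "C2 \<ge> 0" "\<And>z. z \<in> K \<Longrightarrow> \<bar>ddir (1, 0) ?\<Phi>q z\<bar> \<le> C2" using bound[OF sm(5)] by blast
  have sV: "smooth_on X (\<lambda>z. Vf i (v0 (snd z), snd z))"
    by (rule smooth_map_snd_compose[OF smooth_comp_v0[OF smooth_Vf] open_X, of UNIV]) (use X_subset in auto)
  obtain C3 where C3: "C3 \<ge> 0" "\<And>z. z \<in> K \<Longrightarrow> \<bar>Vf i (v0 (snd z), snd z)\<bar> \<le> C3" using bound[OF sV] by blast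
  let ?C = "(C3 / 2 * C1 + C2) * pi"
  show ?thesis
  proof (rule exI[of _ ?C], use near in eventually_elim)
    case (elim z)
    then have z: "z \<in> Om" and inK': "\<And>x. \<bar>x\<bar> \<le> h z \<Longrightarrow> (x, snd z) \<in> K" by auto
    define p V where "p = snd z" and "V = Vf i (v0 p, p)"
    have p: "p \<in> L" using Om_L[OF z] by (simp add: p_def)
    have hp: "h z > 0" by (rule h_pos[OF z])
    have inK: "(x, p) \<in> K" if "\<bar>x\<bar> \<le> h z" for x using inK'[OF that] by (simp add: p_def)
    have V: "\<bar>V\<bar> \<le> C3" using C3(2)[OF inK[of 0]] hp by (simp add: V_def)
    define f where "f = (\<lambda>t. V / (2 * h z) * sin t * ?\<Phi>x (h z * sin t, p) + ?\<Phi>q (h z * sin t, p))"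
    \<comment> \<open>The first-order term of the expansion carries another factor
      \<open>h sin t\<close>, which cancels the singular \<open>1 / h\<close> and leaves
      \<open>sin^2\<close>; the zeroth-order term keeps \<open>1 / h\<close> but integrates to
      zero.\<close>
    define g where "g = (\<lambda>t. (V / (2 * h z) * ?\<Phi>x (0, p)) * sin t + (V / 2 * ?\<Phi>xx (0, p)) * (sin t)\<^sup>2 + ?\<Phi>q (0, p))"
    have g: "(g has_integral (V / (2 * h z) * ?\<Phi>x (0, p)) * 0 + (V / 2 * ?\<Phi>xx (0, p)) * (pi / 2) + pi * ?\<Phi>q (0, p)) {- (pi / 2)..pi / 2}"
      unfolding g_def
      using has_integral_const_real[of "?\<Phi>q (0, p)" "- (pi / 2)" "pi / 2"]
      by (intro has_integral_add has_integral_mult_right integral_sin_half_turn integral_sin_squared_half_turn) simp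
    have cont: "continuous_on S (\<lambda>t. F (h z * sin t, p))" if "smooth_on X F" for F S
      by (rule continuous_on_compose2[OF smooth_on_continuous_on[OF that]])
         (use h_sin_in_X[OF z] in \<open>auto simp: p_def intro!: continuous_intros\<close>)
    have cf: "continuous_on {- (pi / 2)..pi / 2} f"
      unfolding f_def by (intro continuous_intros cont sm) (use hp in auto)
    have cg: "continuous_on {- (pi / 2)..pi / 2} g"
      unfolding g_def by (intro continuous_intros)
    have diff: "\<bar>f t - g t\<bar> \<le> (C3 / 2 * C1 + C2) * h z" for t
    proof -
      define x where "x = h z * sin t"
      have x: "\<bar>x\<bar> \<le> h z" unfolding x_def by (rule abs_h_sin[OF z])
      have K': "(y, p) \<in> K" "(y, p) \<in> X" if "\<bar>y\<bar> \<le> \<bar>x\<bar>" for y using inK[of y] KX that x by auto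
      let ?r1 = "?\<Phi>x (x, p) - ?\<Phi>x (0, p) - x * ?\<Phi>xx (0, p)" and ?r2 = "?\<Phi>q (x, p) - ?\<Phi>q (0, p)"
      have t1: "\<bar>?r1\<bar> \<le> C1 * x\<^sup>2"
        by (rule taylor_bound[of x "\<lambda>x. ?\<Phi>x (x, p)" "\<lambda>x. ?\<Phi>xx (x, p)" "\<lambda>x. ?\<Phi>xxx (x, p)"])
           (use K' C1 deriv_X[OF sm(1)] deriv_X[OF sm(2)] in auto)
      have t2: "\<bar>?r2\<bar> \<le> C2 * \<bar>x\<bar>"
        by (rule slope_bound[of x "\<lambda>x. ?\<Phi>q (x, p)" "\<lambda>x. ddir (1, 0) ?\<Phi>q (x, p)"])
           (use K' C2 deriv_X[OF sm(4)] in auto)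
      have eq: "f t - g t = V / (2 * h z) * sin t * ?r1 + ?r2"
        using hp by (simp add: f_def g_def x_def field_simps power2_eq_square)
      have "\<bar>f t - g t\<bar> \<le> \<bar>V / (2 * h z) * sin t * ?r1\<bar> + \<bar>?r2\<bar>"
        unfolding eq by (rule abs_triangle_ineq)
      \<comment> \<open>The quadratic remainder is divided by \<open>h\<close> once, so it ends up
        of order \<open>h\<close>, like the remainder of the regular term.\<close>
      also have "\<dots> \<le> C3 / (2 * h z) * 1 * (C1 * (h z)\<^sup>2) + C2 * h z"
      proof (rule add_mono)
        have "C1 * x\<^sup>2 \<le> C1 * (h z)\<^sup>2" using x C1(1) by (intro mult_left_mono power2_le_iff_abs_le[THEN iffD2]) (use hp in auto)
        then show "\<bar>V / (2 * h z) * sin t * ?r1\<bar> \<le> C3 / (2 * h z) * 1 * (C1 * (h z)\<^sup>2)"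
          unfolding abs_mult abs_divide using t1 V hp C1 C3
          by (intro mult_mono) (auto intro: divide_right_mono)
        show "\<bar>?r2\<bar> \<le> C2 * h z" using t2 mult_left_mono[OF x C2(1)] by linarith
      qed
      also have "\<dots> = (C3 / 2 * C1 + C2) * h z" using hp by (simp add: field_simps power2_eq_square)
      finally show ?thesis .
    qed
    have "ddir i (ddir j \<Theta>) z = integral {- (pi / 2)..pi / 2} f"
      unfolding ddir2_action[OF z] by (simp add: f_def V_def p_def)
    moreover have "pi * (k (v0 p) * a p * H i j p) = integral {- (pi / 2)..pi / 2} g"
      unfolding H_eq[OF p, symmetric] integral_unique[OF g] by (simp add: V_def algebra_simps)
    ultimately have "ddir i (ddir j \<Theta>) z - pi * (k (v0 p) * a p * H i j p) = integral {- (pi / 2)..pi / 2} (\<lambda>t. f t - g t)"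
      using cf cg by (simp add: integral_diff integrable_continuous_real)
    also have "\<bar>\<dots>\<bar> \<le> ((C3 / 2 * C1 + C2) * h z) * (pi / 2 - (- (pi / 2)))"
      using integral_bound[of "- (pi / 2)" "pi / 2" "\<lambda>t. f t - g t" "(C3 / 2 * C1 + C2) * h z"] diff cf cg
      by (auto intro!: continuous_intros)
    finally show ?case by (simp add: p_def algebra_simps)
  qed
qed

end

context well_action begin

text \<open>The normalising factor \<open>k a\<close> is \<open>G (0, p)\<close>, positive and hence
  bounded away from 0 on the compact set; \<open>h\<close> is then exchanged for the width.\<close>

lemma normalized_hessian_asymptotics:
  assumes p0: "p0 \<in> L"
  shows "\<exists>C. \<forall>\<^sub>F z in near_bottom p0. z \<in> Om \<and>
    \<bar>1 / (pi * (k (v0 (snd z)) * a (snd z))) * ddir i (ddir j \<Theta>) z - H i j (snd z)\<bar> \<le> C * \<bar>(v3 z - v2 z) / 2\<bar>"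
proof -
  obtain K where K: "compact K" "K \<subseteq> X"
    and near: "\<forall>\<^sub>F z in near_bottom p0. z \<in> Om \<and> (\<forall>x. \<bar>x\<bar> \<le> h z \<longrightarrow> (x, snd z) \<in> K)"
    using eventually_in_compact[OF p0] by blast
  have G_pos: "G y > 0" if "y \<in> X" for y
    using \<psi>x_pos[of "fst y" "snd y"] k_pos[OF \<psi>_in_I[OF that]] that by (simp add: G_def)
  have "smooth_on X (\<lambda>y. inverse (G y))"
    by (intro smooth_on_inverse open_X smooth_G) (use G_pos in force)
  from compact_bound[OF this K] obtain C1 where C1: "C1 \<ge> 0" "\<And>y. y \<in> K \<Longrightarrow> \<bar>inverse (G y)\<bar> \<le> C1" by blast
  obtain C2 where C2: "\<forall>\<^sub>F z in near_bottom p0. h z \<le> C2 * ((v3 z - v2 z) / 2) \<and> (v3 z - v2 z) / 2 \<le> C2 * h z"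
    using h_comparable_width[OF p0] by blast
  obtain C3 where C3: "\<forall>\<^sub>F z in near_bottom p0.
    \<bar>ddir i (ddir j \<Theta>) z - pi * (k (v0 (snd z)) * a (snd z) * H i j (snd z))\<bar> \<le> C3 * h z"
    using hessian_asymptotics[OF p0] by blast
  show ?thesis
  proof (rule exI[of _ "C1 / pi * (\<bar>C3\<bar> * C2)"], use near C2 C3 in eventually_elim)
    case (elim z)
    then have z: "z \<in> Om" and zK: "(0, snd z) \<in> K" using h_pos[of z] by auto
    define g D where "g = k (v0 (snd z)) * a (snd z)" and "D = ddir i (ddir j \<Theta>) z"
    have g: "g = G (0, snd z)" using G_zero[OF Om_L[OF z]] by (simp add: g_def)
    have gp: "g > 0" using G_pos zK K(2) unfolding g by blast
    have gb: "inverse g \<le> C1" using C1(2)[OF zK] gp by (simp add: g)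
    have "\<bar>D - pi * (g * H i j (snd z))\<bar> \<le> C3 * h z" using elim(3) by (simp add: g_def D_def)
    also have "\<dots> \<le> \<bar>C3\<bar> * h z" using h_pos[OF z] by (intro mult_right_mono) auto
    also have "\<dots> \<le> \<bar>C3\<bar> * (C2 * ((v3 z - v2 z) / 2))" using elim(2) by (intro mult_left_mono) auto
    finally have "\<bar>D - pi * (g * H i j (snd z))\<bar> \<le> \<bar>C3\<bar> * C2 * ((v3 z - v2 z) / 2)" by (simp add: mult.assoc)
    then have "inverse g / pi * \<bar>D - pi * (g * H i j (snd z))\<bar> \<le> C1 / pi * (\<bar>C3\<bar> * C2 * ((v3 z - v2 z) / 2))"
      using gb gp C1(1) by (intro mult_mono divide_right_mono) auto
    moreover have "1 / (pi * g) * D - H i j (snd z) = inverse g / pi * (D - pi * (g * H i j (snd z)))"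
      using gp by (simp add: field_simps)
    then have "\<bar>1 / (pi * g) * D - H i j (snd z)\<bar> = inverse g / pi * \<bar>D - pi * (g * H i j (snd z))\<bar>"
      using gp by (simp add: abs_mult)
    moreover have "\<bar>(v3 z - v2 z) / 2\<bar> = (v3 z - v2 z) / 2" using v2_v0[OF z] v0_v3[OF z] by simp
    ultimately show ?case using z by (simp add: g_def D_def mult.assoc)
  qed
qed

lemma tendsto_width:
  assumes p0: "p0 \<in> L"
  shows "((\<lambda>z. (v3 z - v2 z) / 2) \<longlongrightarrow> 0) (near_bottom p0)"
proof -
  obtain C where C: "\<forall>\<^sub>F z in near_bottom p0. h z \<le> C * ((v3 z - v2 z) / 2) \<and> (v3 z - v2 z) / 2 \<le> C * h z"
    using h_comparable_width[OF p0] by blast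
  have "((\<lambda>z. C * h z) \<longlongrightarrow> C * 0) (near_bottom p0)"
    by (intro tendsto_mult tendsto_const tendsto_h p0)
  then have lim: "((\<lambda>z. C * h z) \<longlongrightarrow> 0) (near_bottom p0)" by simp
  have "\<forall>\<^sub>F z in near_bottom p0. z \<in> Om" by (simp add: eventually_at_filter)
  then have "\<forall>\<^sub>F z in near_bottom p0. 0 \<le> (v3 z - v2 z) / 2"
    by eventually_elim (use v2_v0 v0_v3 in force)
  then show ?thesis
    by (rule tendsto_sandwich[OF _ _ tendsto_const lim]) (use C in eventually_elim, simp)
qed

end

section \<open>The kernel \<open>R\<close> and its derivatives on the diagonal\<close>

text \<open>The argument \<open>w + t (z - w) + t s (v - z)\<close> in barycentric form, with
  weights \<open>1 - t\<close>, \<open>t (1 - s)\<close> and \<open>t s\<close> at \<open>w\<close>,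
  \<open>z\<close> and \<open>v\<close>.\<close>

definition simplex_point :: "real \<times> real \<Rightarrow> real \<Rightarrow> real \<Rightarrow> real \<Rightarrow> real" where
  "simplex_point y v w z = (1 - fst y) * w + fst y * (1 - snd y) * z + fst y * snd y * v"

text \<open>For the weight \<open>t\<close>, the Jacobian of the triangle coordinates, this is the
  Hermite-Genocchi integral of a second divided difference. A general \<open>\<omega>\<close> keeps
  derivatives in the family: each multiplies \<open>\<omega>\<close> by a barycentric weight and
  replaces \<open>g\<close> by its derivative.\<close>

definition simplex_mean :: "(real \<times> real \<Rightarrow> real) \<Rightarrow> (real \<Rightarrow> real) \<Rightarrow> real \<Rightarrow> real \<Rightarrow> real \<Rightarrow> real" where
  "simplex_mean \<omega> g v w z = integral (cbox (0, 0) (1, 1)) (\<lambda>y. \<omega> y * g (simplex_point y v w z))"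

lemma box_unit: "y \<in> cbox (0, 0) (1, 1) \<longleftrightarrow> fst y \<in> {0..1::real} \<and> snd y \<in> {0..1::real}"
  by (cases y) (auto simp: cbox_Pair_eq)

lemma simplex_point_in:
  assumes "is_interval I" "v \<in> I" "w \<in> I" "z \<in> I" "y \<in> cbox (0, 0) (1, 1)"
  shows "simplex_point y v w z \<in> I"
proof -
  have cvx: "convex I" using assms(1) by (rule is_interval_convex)
  have y: "0 \<le> fst y" "fst y \<le> 1" "0 \<le> snd y" "snd y \<le> 1" using assms(5) by (auto simp: box_unit)
  have "(1 - snd y) *\<^sub>R z + snd y *\<^sub>R v \<in> I" using cvx assms y by (auto simp: convex_def)
  then have "(1 - fst y) *\<^sub>R w + fst y *\<^sub>R ((1 - snd y) *\<^sub>R z + snd y *\<^sub>R v) \<in> I"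
    using cvx assms y by (auto simp: convex_def)
  then show ?thesis by (simp add: simplex_point_def algebra_simps)
qed

lemma simplex_mean_diag: "simplex_mean \<omega> g c c c = g c * integral (cbox (0, 0) (1, 1)) \<omega>"
proof -
  have "simplex_point y c c c = c" for y by (simp add: simplex_point_def algebra_simps)
  then show ?thesis by (simp add: simplex_mean_def mult.commute)
qed

text \<open>The barycentric point is affine in each of \<open>v\<close>, \<open>w\<close>,
  \<open>z\<close>. Isolating one of them as \<open>\<alpha> + \<beta> x\<close> treats the three
  derivatives by the same Leibniz rule.\<close>

lemma simplex_mean_deriv_aux:
  fixes \<alpha> \<beta> \<omega> :: "real \<times> real \<Rightarrow> real"
  assumes I: "open I" and U: "open U" "convex U" "x \<in> U"
    and g: "\<And>v. v \<in> I \<Longrightarrow> (g has_real_derivative g' v) (at v)" "continuous_on I g'"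
    and c: "continuous_on UNIV \<alpha>" "continuous_on UNIV \<beta>" "continuous_on UNIV \<omega>"
    and sub: "\<And>(y :: real \<times> real) x. y \<in> cbox (0, 0) (1, 1) \<Longrightarrow> x \<in> U \<Longrightarrow> \<alpha> y + \<beta> y * x \<in> I"
  shows "((\<lambda>x. integral (cbox (0, 0) (1, 1)) (\<lambda>y. \<omega> y * g (\<alpha> y + \<beta> y * x))) has_real_derivative
    integral (cbox (0, 0) (1, 1)) (\<lambda>y. (\<omega> y * \<beta> y) * g' (\<alpha> y + \<beta> y * x))) (at x)"
proof -
  have cg: "continuous_on I g" using g(1) by (intro continuous_at_imp_continuous_on ballI DERIV_isCont) blast
  have "((\<lambda>x. integral (cbox (0, 0) (1, 1)) (\<lambda>y. \<omega> y * g (\<alpha> y + \<beta> y * x))) has_real_derivative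
    integral (cbox (0, 0) (1, 1)) (\<lambda>y. (\<omega> y * \<beta> y) * g' (\<alpha> y + \<beta> y * x))) (at x within U)"
  proof (rule leibniz_rule_field_derivative[OF _ _ _ U(3,2), where fx="\<lambda>x y. (\<omega> y * \<beta> y) * g' (\<alpha> y + \<beta> y * x)"])
    fix x and y :: "real \<times> real" assume x: "x \<in> U" and y: "y \<in> cbox (0, 0) (1, 1)"
    have "((\<lambda>x. \<alpha> y + \<beta> y * x) has_real_derivative \<beta> y) (at x)" by (auto intro!: derivative_eq_intros)
    note * = DERIV_cmult[OF DERIV_chain2[where f=g, OF g(1)[OF sub[OF y x]] this], of "\<omega> y"]
    show "((\<lambda>x. \<omega> y * g (\<alpha> y + \<beta> y * x)) has_real_derivative (\<omega> y * \<beta> y) * g' (\<alpha> y + \<beta> y * x)) (at x within U)"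
      by (rule has_field_derivative_at_within) (use * in \<open>simp add: mult_ac\<close>)
  next
    fix x assume x: "x \<in> U"
    show "(\<lambda>y. \<omega> y * g (\<alpha> y + \<beta> y * x)) integrable_on cbox (0, 0) (1, 1)"
      by (intro integrable_continuous continuous_intros continuous_on_compose2[OF cg] continuous_on_subset[OF c(1)]
          continuous_on_subset[OF c(2)] continuous_on_subset[OF c(3)]) (use sub x in auto)
  next
    have c': "continuous_on (U \<times> cbox (0, 0) (1, 1)) (\<lambda>z. f (snd z))" if "continuous_on UNIV f" for f :: "real \<times> real \<Rightarrow> real"
      by (rule continuous_on_compose2[OF that]) (auto intro: continuous_intros)
    show "continuous_on (U \<times> cbox (0, 0) (1, 1)) (\<lambda>(x, y). (\<omega> y * \<beta> y) * g' (\<alpha> y + \<beta> y * x))"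
      unfolding split_beta
      by (intro continuous_on_mult continuous_on_add c'[OF c(1)] c'[OF c(2)] c'[OF c(3)] continuous_on_compose2[OF g(2)]
          continuous_on_fst continuous_on_id) (use sub in auto)
  qed
  then show ?thesis using at_within_open[OF U(3,1)] by simp
qed

context
  fixes I :: "real set" and g g' :: "real \<Rightarrow> real" and \<omega> :: "real \<times> real \<Rightarrow> real" and v w z :: real
  assumes I: "open I" "is_interval I" and vwz: "v \<in> I" "w \<in> I" "z \<in> I"
    and g: "\<And>v. v \<in> I \<Longrightarrow> (g has_real_derivative g' v) (at v)" "continuous_on I g'"
    and \<omega>: "continuous_on UNIV \<omega>"
begin

lemma simplex_mean_deriv_v:
  "((\<lambda>v. simplex_mean \<omega> g v w z) has_real_derivative simplex_mean (\<lambda>y. \<omega> y * (fst y * snd y)) g' v w z) (at v)"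
proof -
  note * = simplex_mean_deriv_aux[OF I(1) I(1) is_interval_convex[OF I(2)] vwz(1) g _ _ \<omega>,
      where \<alpha>="\<lambda>y. (1 - fst y) * w + fst y * (1 - snd y) * z" and \<beta>="\<lambda>y. fst y * snd y"]
  show ?thesis unfolding simplex_mean_def simplex_point_def
    by (rule *) (use simplex_point_in[OF I(2) _ vwz(2,3)] in \<open>auto intro!: continuous_intros simp: simplex_point_def\<close>)
qed

lemma simplex_mean_deriv_w:
  "((\<lambda>w. simplex_mean \<omega> g v w z) has_real_derivative simplex_mean (\<lambda>y. \<omega> y * (1 - fst y)) g' v w z) (at w)"
proof -
  have eq: "simplex_point y v w z = (fst y * (1 - snd y) * z + fst y * snd y * v) + (1 - fst y) * w" for y w
    by (simp add: simplex_point_def)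
  note * = simplex_mean_deriv_aux[OF I(1) I(1) is_interval_convex[OF I(2)] vwz(2) g _ _ \<omega>,
      where \<alpha>="\<lambda>y. fst y * (1 - snd y) * z + fst y * snd y * v" and \<beta>="\<lambda>y. 1 - fst y"]
  show ?thesis unfolding simplex_mean_def eq
    by (rule *) (use simplex_point_in[OF I(2) vwz(1) _ vwz(3)] in \<open>auto intro!: continuous_intros simp: eq\<close>)
qed

lemma simplex_mean_deriv_z:
  "((\<lambda>z. simplex_mean \<omega> g v w z) has_real_derivative simplex_mean (\<lambda>y. \<omega> y * (fst y * (1 - snd y))) g' v w z) (at z)"
proof -
  have eq: "simplex_point y v w z = ((1 - fst y) * w + fst y * snd y * v) + fst y * (1 - snd y) * z" for y z
    by (simp add: simplex_point_def)
  note * = simplex_mean_deriv_aux[OF I(1) I(1) is_interval_convex[OF I(2)] vwz(3) g _ _ \<omega>,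
      where \<alpha>="\<lambda>y. (1 - fst y) * w + fst y * snd y * v" and \<beta>="\<lambda>y. fst y * (1 - snd y)"]
  show ?thesis unfolding simplex_mean_def eq
    by (rule *) (use simplex_point_in[OF I(2) vwz(1,2)] in \<open>auto intro!: continuous_intros simp: eq\<close>)
qed

lemma RR_eq_simplex_mean:
  "RR W v w z p = simplex_mean fst g v w z" if "\<And>v. v \<in> I \<Longrightarrow> dW 2 W v p = g v" for W :: "real \<Rightarrow> real \<times> 'l \<Rightarrow> real" and p
proof -
  have cg: "continuous_on I g" using g(1) by (intro continuous_at_imp_continuous_on ballI DERIV_isCont) blast
  have "continuous_on (cbox (0, 0) (1, 1)) (\<lambda>y. fst y * g (simplex_point y v w z))"
    by (intro continuous_on_mult continuous_on_fst continuous_on_id continuous_on_compose2[OF cg])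
       (use simplex_point_in[OF I(2) vwz] in \<open>auto simp: simplex_point_def intro!: continuous_intros\<close>)
  from integral_prod_continuous[OF this]
  have "simplex_mean fst g v w z = integral {0..1} (\<lambda>t. integral {0..1} (\<lambda>s. t * g (simplex_point (t, s) v w z)))"
    by (simp add: simplex_mean_def)
  also have "\<dots> = RR W v w z p"
    unfolding RR_def
  proof (intro integral_cong)
    fix t s :: real assume "t \<in> {0..1}" "s \<in> {0..1}"
    then have "simplex_point (t, s) v w z \<in> I" by (intro simplex_point_in[OF I(2) vwz]) (auto simp: box_unit)
    moreover have "w + t * (z - w) + t * s * (v - z) = simplex_point (t, s) v w z"
      by (simp add: simplex_point_def algebra_simps)
    ultimately show "t * g (simplex_point (t, s) v w z) = t * dW 2 W (w + t * (z - w) + t * s * (v - z)) p"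
      using that by simp
  qed
  finally show ?thesis by simp
qed

end

lemma integral_box_product:
  fixes f g :: "real \<Rightarrow> real"
  assumes "continuous_on UNIV f" "continuous_on UNIV g"
  shows "integral (cbox (0, 0) (1, 1)) (\<lambda>y. f (fst y) * g (snd y)) = integral {0..1} f * integral {0..1} g"
proof -
  have "continuous_on (cbox (0, 0) (1, 1)) (\<lambda>y. f (fst y) * g (snd y))"
    by (intro continuous_on_mult continuous_on_compose2[OF assms(1)] continuous_on_compose2[OF assms(2)] continuous_on_fst
        continuous_on_snd continuous_on_id) auto
  from integral_prod_continuous[OF this] show ?thesis by simp
qed

lemma integral_power: "integral {0..1::real} (\<lambda>t. t ^ n) = 1 / real (Suc n)"
  and integral_power_reflect: "integral {0..1::real} (\<lambda>t. (1 - t) ^ n) = 1 / real (Suc n)"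
proof -
  have "((\<lambda>t::real. t ^ n) has_integral 1 ^ Suc n / real (Suc n) - 0 ^ Suc n / real (Suc n)) {0..1}"
    by (rule fundamental_theorem_of_calculus)
       (auto intro!: derivative_eq_intros simp del: power_Suc of_nat_Suc simp flip: has_real_derivative_iff_has_vector_derivative)
  then show "integral {0..1::real} (\<lambda>t. t ^ n) = 1 / real (Suc n)" by (simp add: integral_unique)
  have "((\<lambda>t::real. (1 - t) ^ n) has_integral - ((1 - 1) ^ Suc n) / real (Suc n) - - ((1 - 0) ^ Suc n) / real (Suc n)) {0..1}"
    by (rule fundamental_theorem_of_calculus)
       (auto intro!: derivative_eq_intros simp del: power_Suc of_nat_Suc simp flip: has_real_derivative_iff_has_vector_derivative)
  then show "integral {0..1::real} (\<lambda>t. (1 - t) ^ n) = 1 / real (Suc n)" by (simp add: integral_unique)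
qed

text \<open>Moments of the barycentric weights over the triangle: area 1/2, first moments 1/6,
  squares 1/12, mixed products 1/24. On the diagonal they are the only numbers through which the
  derivatives of \<open>R\<close> differ.\<close>

lemma simplex_mean_weights:
  "integral (cbox (0, 0) (1, 1)) (fst :: real \<times> real \<Rightarrow> real) = 1 / 2"
  "integral (cbox (0, 0) (1, 1)) (\<lambda>y :: real \<times> real. fst y * (fst y * snd y)) = 1 / 6"
  "integral (cbox (0, 0) (1, 1)) (\<lambda>y :: real \<times> real. fst y * (fst y * (1 - snd y))) = 1 / 6"
  "integral (cbox (0, 0) (1, 1)) (\<lambda>y :: real \<times> real. fst y * (1 - fst y)) = 1 / 6"
  "integral (cbox (0, 0) (1, 1)) (\<lambda>y :: real \<times> real. fst y * (fst y * snd y) * (fst y * snd y)) = 1 / 12"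
  "integral (cbox (0, 0) (1, 1)) (\<lambda>y :: real \<times> real. fst y * (fst y * (1 - snd y)) * (fst y * (1 - snd y))) = 1 / 12"
  "integral (cbox (0, 0) (1, 1)) (\<lambda>y :: real \<times> real. fst y * (1 - fst y) * (fst y * (1 - snd y))) = 1 / 24"
proof -
  have *: "integral (cbox (0, 0) (1, 1)) f = integral {0..1} F * integral {0..1} G"
    if "\<And>y. f y = F (fst y) * G (snd y)" "continuous_on UNIV F" "continuous_on UNIV G"
    for f :: "real \<times> real \<Rightarrow> real" and F G :: "real \<Rightarrow> real"
  proof -
    have "f = (\<lambda>y. F (fst y) * G (snd y))" using that(1) by (rule ext)
    then show ?thesis using integral_box_product[OF that(2,3)] by simp
  qed
  have m: "integral {0..1} (\<lambda>t::real. t ^ 0) = 1" "integral {0..1} (\<lambda>t::real. t ^ 1) = 1 / 2"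
    "integral {0..1} (\<lambda>t::real. t ^ 2) = 1 / 3" "integral {0..1} (\<lambda>t::real. t ^ 3) = 1 / 4"
    "integral {0..1} (\<lambda>t::real. (1 - t) ^ 1) = 1 / 2" "integral {0..1} (\<lambda>t::real. (1 - t) ^ 2) = 1 / 3"
    using integral_power[of 0] integral_power[of 1] integral_power[of 2] integral_power[of 3]
      integral_power_reflect[of 1] integral_power_reflect[of 2] by simp_all
  have d: "integral {0..1} (\<lambda>t::real. t ^ 1 - t ^ 2) = integral {0..1} (\<lambda>t::real. t ^ 1) - integral {0..1} (\<lambda>t::real. t ^ 2)"
    "integral {0..1} (\<lambda>t::real. t ^ 2 - t ^ 3) = integral {0..1} (\<lambda>t::real. t ^ 2) - integral {0..1} (\<lambda>t::real. t ^ 3)"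
    by (intro integral_diff integrable_continuous_real continuous_intros)+
  \<comment> \<open>The variants cover the integrands in the order \<open>t^m s^n\<close>,
    \<open>t^m (1 - s)^n\<close>, and the same with \<open>t^m - t^n\<close> in place of the power
    of \<open>t\<close>; the instantiations below supply the exponents.\<close>
  note ** = *[OF _ continuous_on_power[OF continuous_on_id] continuous_on_power[OF continuous_on_id]]
    *[OF _ continuous_on_power[OF continuous_on_id] continuous_on_power[OF continuous_on_diff[OF continuous_on_const continuous_on_id]]]
    *[OF _ continuous_on_diff[OF continuous_on_power[OF continuous_on_id] continuous_on_power[OF continuous_on_id]]
      continuous_on_power[OF continuous_on_id]]
    *[OF _ continuous_on_diff[OF continuous_on_power[OF continuous_on_id] continuous_on_power[OF continuous_on_id]]
      continuous_on_power[OF continuous_on_diff[OF continuous_on_const continuous_on_id]]]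
  note e = power2_eq_square power3_eq_cube
  show "integral (cbox (0, 0) (1, 1)) (fst :: real \<times> real \<Rightarrow> real) = 1 / 2"
    by (subst **(1)[of _ 1 0], simp, unfold m, simp)
  show "integral (cbox (0, 0) (1, 1)) (\<lambda>y :: real \<times> real. fst y * (fst y * snd y)) = 1 / 6"
    by (subst **(1)[of _ 2 1], simp add: e, unfold m, simp)
  show "integral (cbox (0, 0) (1, 1)) (\<lambda>y :: real \<times> real. fst y * (fst y * (1 - snd y))) = 1 / 6"
    by (subst **(2)[of _ 2 1 1], simp add: e, unfold m, simp)
  show "integral (cbox (0, 0) (1, 1)) (\<lambda>y :: real \<times> real. fst y * (1 - fst y)) = 1 / 6"
    by (subst **(3)[of _ 1 2 0], simp add: e algebra_simps, unfold d m, simp)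
  show "integral (cbox (0, 0) (1, 1)) (\<lambda>y :: real \<times> real. fst y * (fst y * snd y) * (fst y * snd y)) = 1 / 12"
    by (subst **(1)[of _ 3 2], simp add: e mult_ac, unfold m, simp)
  show "integral (cbox (0, 0) (1, 1)) (\<lambda>y :: real \<times> real. fst y * (fst y * (1 - snd y)) * (fst y * (1 - snd y))) = 1 / 12"
    by (subst **(2)[of _ 3 1 2], simp add: e mult_ac, unfold m, simp)
  show "integral (cbox (0, 0) (1, 1)) (\<lambda>y :: real \<times> real. fst y * (1 - fst y) * (fst y * (1 - snd y))) = 1 / 24"
    by (subst **(4)[of _ 2 3 1 1], simp add: e algebra_simps, unfold d m, simp)
qed

subsection \<open>Derivatives of \<open>Y\<close>\<close>

text \<open>Along a coordinate line \<open>Y\<close> is \<open>K * r^(-1/2)\<close>. The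
  coefficients come from \<open>(r^(-1/2))' = - r^(-3/2) r' / 2\<close> and
  \<open>(r^(-1/2))'' = 3/4 r^(-5/2) r'^2 - r^(-3/2) r'' / 2\<close>.\<close>

lemma deriv_quotient_sqrt:
  fixes r r1 K K1 :: "real \<Rightarrow> real"
  assumes N: "open N" "c \<in> N" and r: "\<And>x. x \<in> N \<Longrightarrow> r x > 0"
    and dr: "\<And>x. x \<in> N \<Longrightarrow> (r has_real_derivative r1 x) (at x)" "(r1 has_real_derivative r2) (at c)"
    and dK: "\<And>x. x \<in> N \<Longrightarrow> (K has_real_derivative K1 x) (at x)" "(K1 has_real_derivative K2) (at c)"
    and f: "\<And>x. x \<in> N \<Longrightarrow> f x = K x * inverse (sqrt (r x))"
  defines "s \<equiv> inverse (sqrt (r c))"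
  shows "deriv f c = K1 c * s - K c * s ^ 3 * r1 c / 2"
    and "(deriv ^^ 2) f c = K2 * s - K1 c * s ^ 3 * r1 c + K c * (3 / 4 * s ^ 5 * (r1 c)\<^sup>2 - s ^ 3 * r2 / 2)"
proof -
  define \<sigma> where "\<sigma> = (\<lambda>x. inverse (sqrt (r x)))"
  have d\<sigma>: "(\<sigma> has_real_derivative - (\<sigma> x ^ 3) * r1 x / 2) (at x)" if x: "x \<in> N" for x
    unfolding \<sigma>_def using r[OF x]
    by (auto intro!: derivative_eq_intros dr(1)[OF x] simp: field_simps power3_eq_cube)
  define f1 where "f1 = (\<lambda>x. K1 x * \<sigma> x - K x * \<sigma> x ^ 3 * r1 x / 2)"
  have df: "(f has_real_derivative f1 x) (at x)" if x: "x \<in> N" for x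
  proof -
    have "((\<lambda>x. K x * \<sigma> x) has_real_derivative f1 x) (at x)"
      unfolding f1_def by (rule derivative_eq_intros dK(1)[OF x] d\<sigma>[OF x] refl)+ simp
    then show ?thesis
      by (rule has_field_derivative_transform_within_open[OF _ N(1) x]) (simp add: f \<sigma>_def)
  qed
  show "deriv f c = K1 c * s - K c * s ^ 3 * r1 c / 2"
    using DERIV_imp_deriv[OF df[OF N(2)]] by (simp add: f1_def s_def \<sigma>_def)
  have "(f1 has_real_derivative K2 * \<sigma> c - K1 c * \<sigma> c ^ 3 * r1 c + K c * (3 / 4 * \<sigma> c ^ 5 * (r1 c)\<^sup>2 - \<sigma> c ^ 3 * r2 / 2)) (at c)"
  proof -
    have "((\<lambda>x. \<sigma> x ^ 3) has_real_derivative 3 * (\<sigma> c)\<^sup>2 * (- (\<sigma> c ^ 3) * r1 c / 2)) (at c)"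
      using DERIV_power[OF d\<sigma>[OF N(2)], of 3] by (simp add: mult_ac)
    from DERIV_diff[OF DERIV_mult[OF dK(2) d\<sigma>[OF N(2)]]
        DERIV_cdivide[OF DERIV_mult[OF DERIV_mult[OF dK(1)[OF N(2)] this] dr(2)], of 2]]
    show ?thesis unfolding f1_def
      by (rule DERIV_cong) (simp add: eval_nat_numeral field_simps)
  qed
  then have "(deriv f has_real_derivative K2 * \<sigma> c - K1 c * \<sigma> c ^ 3 * r1 c + K c * (3 / 4 * \<sigma> c ^ 5 * (r1 c)\<^sup>2 - \<sigma> c ^ 3 * r2 / 2)) (at c)"
    by (rule has_field_derivative_transform_within_open[OF _ N]) (simp add: DERIV_imp_deriv[OF df])
  from DERIV_imp_deriv[OF this]
  show "(deriv ^^ 2) f c = K2 * s - K1 c * s ^ 3 * r1 c + K c * (3 / 4 * s ^ 5 * (r1 c)\<^sup>2 - s ^ 3 * r2 / 2)"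
    by (simp add: s_def \<sigma>_def numeral_2_eq_2)
qed

text \<open>One parameter value is frozen, so only functions of one variable remain:
  \<open>g\<close>, \<open>g1\<close>, \<open>g2\<close> are the second to fourth
  \<open>v\<close>-derivatives of the potential and \<open>c\<close> is the bottom.\<close>

locale well_point =
  fixes I :: "real set" and \<kappa> k k1 k2 g g1 g2 :: "real \<Rightarrow> real" and c :: real
    and W :: "real \<Rightarrow> real \<times> 'l \<Rightarrow> real" and p :: "real \<times> 'l"
  assumes I: "open I" "is_interval I" "c \<in> I"
    and g: "\<And>v. v \<in> I \<Longrightarrow> (g has_real_derivative g1 v) (at v)" "\<And>v. v \<in> I \<Longrightarrow> (g1 has_real_derivative g2 v) (at v)"
      "continuous_on I g2"
    and k: "\<And>v. v \<in> I \<Longrightarrow> (k has_real_derivative k1 v) (at v)" "\<And>v. v \<in> I \<Longrightarrow> (k1 has_real_derivative k2 v) (at v)"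
    and k_eq: "\<And>v. v \<in> I \<Longrightarrow> k v = sqrt (2 * \<kappa> v)"
    and W: "\<And>v. v \<in> I \<Longrightarrow> dW 2 W v p = g v" and g_pos: "g c > 0"
begin

abbreviation "r v w z \<equiv> simplex_mean fst g v w z"

lemma cg1: "continuous_on I g1"
  using g(2) by (intro continuous_at_imp_continuous_on ballI DERIV_isCont) blast

lemma YY_eq: "v \<in> I \<Longrightarrow> w \<in> I \<Longrightarrow> z \<in> I \<Longrightarrow> r v w z > 0 \<Longrightarrow> YY \<kappa> W v w z p = k v * inverse (sqrt (r v w z))"
  using RR_eq_simplex_mean[OF I(1,2) _ _ _ g(1) cg1 _ W, of v w z fst]
  by (simp add: YY_def k_eq real_sqrt_divide inverse_eq_divide continuous_intros continuous_on_fst)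

lemma r_diag: "r c c c = g c / 2"
  by (simp add: simplex_mean_diag simplex_mean_weights)

text \<open>The value of \<open>R^(-1/2)\<close> on the diagonal, which is
  \<open>a\<^sub>0\<close>.\<close>

definition s :: real where "s = inverse (sqrt (g c / 2))"

lemma Y_at: "YY \<kappa> W c c c p = k c * s"
  using YY_eq[of c c c] I g_pos by (simp add: r_diag s_def)

lemma simplex_mean_pos_near:
  assumes "\<And>x. x \<in> I \<Longrightarrow> (f has_real_derivative f' x) (at x)" "f c > 0"
  shows "open {x \<in> I. f x > (0::real)}" "c \<in> {x \<in> I. f x > 0}"
proof -
  have "continuous_on I f" using assms(1) by (intro continuous_at_imp_continuous_on ballI DERIV_isCont) blast
  from open_preimage[OF I(1) this open_greaterThan] show "open {x \<in> I. f x > (0::real)}" by simp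
qed (use assms I in simp)

lemmas cont_weights = continuous_intros continuous_on_fst continuous_on_snd

lemma Y_v: "deriv (\<lambda>v. YY \<kappa> W v c c p) c = k1 c * s - k c * s ^ 3 * (g1 c / 6) / 2"
  and Y_vv: "(deriv ^^ 2) (\<lambda>v. YY \<kappa> W v c c p) c
    = k2 c * s - k1 c * s ^ 3 * (g1 c / 6) + k c * (3 / 4 * s ^ 5 * (g1 c / 6)\<^sup>2 - s ^ 3 * (g2 c / 12) / 2)"
proof -
  have d1: "((\<lambda>v. r v c c) has_real_derivative simplex_mean (\<lambda>y. fst y * (fst y * snd y)) g1 v c c) (at v)" if "v \<in> I" for v
    by (rule simplex_mean_deriv_v[OF I(1,2) that I(3) I(3) g(1) cg1]) (auto intro!: cont_weights)
  have d2: "((\<lambda>v. simplex_mean (\<lambda>y. fst y * (fst y * snd y)) g1 v c c) has_real_derivative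
      simplex_mean (\<lambda>y. fst y * (fst y * snd y) * (fst y * snd y)) g2 c c c) (at c)"
    by (rule simplex_mean_deriv_v[OF I(1,2) I(3) I(3) I(3) g(2) g(3)]) (auto intro!: cont_weights)
  define N where "N = {v \<in> I. r v c c > 0}"
  have pos: "r c c c > 0" using g_pos by (simp add: r_diag)
  have N: "open N" "c \<in> N"
    using simplex_mean_pos_near[of "\<lambda>v. r v c c", OF d1 pos] by (auto simp: N_def)
  have N_I: "x \<in> I" if "x \<in> N" for x using that by (simp add: N_def)
  have N_pos: "0 < (\<lambda>v. r v c c) x" if "x \<in> N" for x using that by (simp add: N_def)
  have Y: "(\<lambda>v. YY \<kappa> W v c c p) x = k x * inverse (sqrt ((\<lambda>v. r v c c) x))" if "x \<in> N" for x
    using YY_eq N_I[OF that] N_pos[OF that] I(3) by simp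
  note * = deriv_quotient_sqrt[OF N N_pos d1[OF N_I] d2 k(1)[OF N_I] k(2)[OF I(3)] Y, unfolded r_diag, folded s_def]
  show "deriv (\<lambda>v. YY \<kappa> W v c c p) c = k1 c * s - k c * s ^ 3 * (g1 c / 6) / 2"
    using * by (simp add: simplex_mean_diag simplex_mean_weights)
  show "(deriv ^^ 2) (\<lambda>v. YY \<kappa> W v c c p) c
    = k2 c * s - k1 c * s ^ 3 * (g1 c / 6) + k c * (3 / 4 * s ^ 5 * (g1 c / 6)\<^sup>2 - s ^ 3 * (g2 c / 12) / 2)"
    using * by (simp add: simplex_mean_diag simplex_mean_weights)
qed

text \<open>\<open>\<kappa>\<close> depends on the first argument of \<open>Y\<close> only, so the
  numerator is constant here and just the terms with derivatives of \<open>R\<close>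
  survive.\<close>

lemma Y_z: "deriv (\<lambda>z. YY \<kappa> W c c z p) c = - k c * s ^ 3 * (g1 c / 6) / 2"
  and Y_zz: "(deriv ^^ 2) (\<lambda>z. YY \<kappa> W c c z p) c
    = k c * (3 / 4 * s ^ 5 * (g1 c / 6)\<^sup>2 - s ^ 3 * (g2 c / 12) / 2)"
proof -
  have d1: "((\<lambda>z. r c c z) has_real_derivative simplex_mean (\<lambda>y. fst y * (fst y * (1 - snd y))) g1 c c z) (at z)" if "z \<in> I" for z
    by (rule simplex_mean_deriv_z[OF I(1,2) I(3) I(3) that g(1) cg1]) (auto intro!: cont_weights)
  have d2: "((\<lambda>z. simplex_mean (\<lambda>y. fst y * (fst y * (1 - snd y))) g1 c c z) has_real_derivative
      simplex_mean (\<lambda>y. fst y * (fst y * (1 - snd y)) * (fst y * (1 - snd y))) g2 c c c) (at c)"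
    by (rule simplex_mean_deriv_z[OF I(1,2) I(3) I(3) I(3) g(2) g(3)]) (auto intro!: cont_weights)
  define N where "N = {z \<in> I. r c c z > 0}"
  have pos: "r c c c > 0" using g_pos by (simp add: r_diag)
  have N: "open N" "c \<in> N"
    using simplex_mean_pos_near[of "\<lambda>z. r c c z", OF d1 pos] by (auto simp: N_def)
  have N_I: "x \<in> I" if "x \<in> N" for x using that by (simp add: N_def)
  have N_pos: "0 < (\<lambda>z. r c c z) x" if "x \<in> N" for x using that by (simp add: N_def)
  have Y: "(\<lambda>z. YY \<kappa> W c c z p) x = (\<lambda>_. k c) x * inverse (sqrt ((\<lambda>z. r c c z) x))" if "x \<in> N" for x
    using YY_eq N_I[OF that] N_pos[OF that] I(3) by simp
  note * = deriv_quotient_sqrt[OF N N_pos d1[OF N_I] d2 DERIV_const DERIV_const Y, unfolded r_diag, folded s_def]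
  show "deriv (\<lambda>z. YY \<kappa> W c c z p) c = - k c * s ^ 3 * (g1 c / 6) / 2"
    using * by (simp add: simplex_mean_diag simplex_mean_weights)
  show "(deriv ^^ 2) (\<lambda>z. YY \<kappa> W c c z p) c
    = k c * (3 / 4 * s ^ 5 * (g1 c / 6)\<^sup>2 - s ^ 3 * (g2 c / 12) / 2)"
    using * by (simp add: simplex_mean_diag simplex_mean_weights)
qed

text \<open>The inner derivative is needed as a function of \<open>z\<close>, so it is computed off
  the diagonal, for every \<open>z\<close> near \<open>c\<close>, before the outer derivative is
  taken.\<close>

lemma Y_wz: "deriv (\<lambda>z. deriv (\<lambda>w. YY \<kappa> W c w z p) c) c = k c * (3 / 4 * s ^ 5 * (g1 c / 6)\<^sup>2 - s ^ 3 * (g2 c / 24) / 2)"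
proof -
  let ?rw = "simplex_mean (\<lambda>y. fst y * (1 - fst y)) g1"
  have dz: "((\<lambda>z. r c c z) has_real_derivative simplex_mean (\<lambda>y. fst y * (fst y * (1 - snd y))) g1 c c z) (at z)" if "z \<in> I" for z
    by (rule simplex_mean_deriv_z[OF I(1,2) I(3) I(3) that g(1) cg1]) (auto intro!: cont_weights)
  have dw: "((\<lambda>w. r c w z) has_real_derivative ?rw c w z) (at w)" if "w \<in> I" "z \<in> I" for w z
    by (rule simplex_mean_deriv_w[OF I(1,2) I(3) that g(1) cg1]) (auto intro!: cont_weights)
  have dwz: "((\<lambda>z. ?rw c c z) has_real_derivative
      simplex_mean (\<lambda>y. fst y * (1 - fst y) * (fst y * (1 - snd y))) g2 c c c) (at c)"
    by (rule simplex_mean_deriv_z[OF I(1,2) I(3) I(3) I(3) g(2) g(3)]) (auto intro!: cont_weights)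
  have dww: "((\<lambda>w. ?rw c w z) has_real_derivative
      simplex_mean (\<lambda>y. fst y * (1 - fst y) * (1 - fst y)) g2 c c z) (at c)" if "z \<in> I" for z
    by (rule simplex_mean_deriv_w[OF I(1,2) I(3) I(3) that g(2) g(3)]) (auto intro!: cont_weights)
  have pos: "r c c c > 0" using g_pos by (simp add: r_diag)
  note N = simplex_mean_pos_near[of "\<lambda>z. r c c z", OF dz pos]
  define \<sigma> where "\<sigma> = (\<lambda>z. inverse (sqrt (r c c z)))"
  let ?N = "{z \<in> I. r c c z > 0}"
  have eq: "deriv (\<lambda>w. YY \<kappa> W c w z p) c = - k c * \<sigma> z ^ 3 * ?rw c c z / 2" if z: "z \<in> ?N" for z
  proof -
    have zI: "z \<in> I" "r c c z > 0" using z by auto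
    define M where "M = {w \<in> I. r c w z > 0}"
    have M: "open M" "c \<in> M"
      using simplex_mean_pos_near[of "\<lambda>w. r c w z", OF dw[OF _ zI(1)] zI(2)] by (auto simp: M_def)
    have M_I: "x \<in> I" if "x \<in> M" for x using that by (simp add: M_def)
    have M_pos: "0 < (\<lambda>w. r c w z) x" if "x \<in> M" for x using that by (simp add: M_def)
    have Y: "(\<lambda>w. YY \<kappa> W c w z p) x = (\<lambda>_. k c) x * inverse (sqrt ((\<lambda>w. r c w z) x))" if "x \<in> M" for x
      using YY_eq M_I[OF that] M_pos[OF that] I(3) zI by simp
    from deriv_quotient_sqrt(1)[OF M M_pos dw[OF M_I zI(1)] dww[OF zI(1)] DERIV_const DERIV_const Y]
    show ?thesis by (simp add: \<sigma>_def)
  qed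
  have d\<sigma>: "(\<sigma> has_real_derivative - (\<sigma> c ^ 3) * (g1 c / 6) / 2) (at c)"
  proof -
    have "((\<lambda>z. r c c z) has_real_derivative g1 c / 6) (at c)"
      using dz[OF I(3)] by (simp add: simplex_mean_diag simplex_mean_weights)
    then show ?thesis unfolding \<sigma>_def using pos
      by (auto intro!: derivative_eq_intros simp: field_simps power3_eq_cube)
  qed
  have \<sigma>c: "\<sigma> c = s" by (simp add: \<sigma>_def s_def r_diag)
  have "((\<lambda>z. - k c * \<sigma> z ^ 3 * ?rw c c z / 2) has_real_derivative
      k c * (3 / 4 * s ^ 5 * (g1 c / 6)\<^sup>2 - s ^ 3 * (g2 c / 24) / 2)) (at c)"
  proof -
    have "((\<lambda>x. \<sigma> x ^ 3) has_real_derivative 3 * s\<^sup>2 * (- (s ^ 3) * (g1 c / 6) / 2)) (at c)"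
      using DERIV_power[OF d\<sigma>, of 3] by (simp add: mult_ac \<sigma>c)
    from DERIV_cdivide[OF DERIV_mult[OF DERIV_cmult[OF this, of "- k c"] dwz], of 2]
    show ?thesis
      unfolding simplex_mean_diag simplex_mean_weights \<sigma>c
      by (rule DERIV_cong) (simp add: eval_nat_numeral field_simps)
  qed
  then have "((\<lambda>z. deriv (\<lambda>w. YY \<kappa> W c w z p) c) has_real_derivative
      k c * (3 / 4 * s ^ 5 * (g1 c / 6)\<^sup>2 - s ^ 3 * (g2 c / 24) / 2)) (at c)"
    by (rule has_field_derivative_transform_within_open[OF _ N(1) N(2)]) (use eq pos in auto)
  then show ?thesis by (rule DERIV_imp_deriv)
qed

end

section \<open>Wells of a parametrized potential\<close>

text \<open>The Hessian is taken with respect to \<open>(\<mu>, l, c)\<close>, whereas the potential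
  and the analysis of the well use the parameter pair \<open>(c, l)\<close>.\<close>

definition reorder :: "real \<times> 'l::euclidean_space \<times> real \<Rightarrow> real \<times> (real \<times> 'l)" where
  "reorder z = (fst z, (snd (snd z), fst (snd z)))"

lemma reorder_simp [simp]: "reorder (\<mu>, l, c) = (\<mu>, (c, l))"
  by (simp add: reorder_def)

lemma bounded_linear_reorder: "bounded_linear reorder"
  unfolding reorder_def[abs_def]
  by (intro bounded_linear_Pair bounded_linear_fst bounded_linear_fst_comp bounded_linear_snd_comp bounded_linear_snd bounded_linear_ident)

lemma deriv_slice:
  fixes F :: "real \<times> 'p::euclidean_space \<Rightarrow> real"
  assumes "smooth_on (I \<times> L) F" "v \<in> I" "p \<in> L"
  shows "deriv (\<lambda>v. F (v, p)) v = ddir (1, 0) F (v, p)"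
  by (rule DERIV_imp_deriv[OF has_real_derivative_fst[OF smooth_on_differentiable[OF assms(1)]]]) (use assms in simp)

lemma deriv_cong_open:
  fixes f g :: "real \<Rightarrow> real"
  assumes "open I" "v \<in> I" "\<And>x. x \<in> I \<Longrightarrow> f x = g x" shows "deriv f v = deriv g v"
  by (rule deriv_cong_ev[OF eventually_mono[OF eventually_nhds_in_open[OF assms(1,2)] assms(3)] refl])

text \<open>\<open>deriv\<close> depends on a whole neighbourhood, so each order is established on
  all of the open set \<open>I\<close> before it is differentiated again.\<close>

lemma dW_slice:
  fixes U :: "real \<Rightarrow> real \<times> 'l::euclidean_space \<Rightarrow> real"
  assumes I: "open I" and U: "smooth_on (I \<times> L) (\<lambda>y. U (fst y) (snd y))" and vp: "v \<in> I" "p \<in> L"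
  defines "u \<equiv> \<lambda>y. U (fst y) (snd y)"
  shows "dW 1 U v p = ddir (1, 0) u (v, p)"
    and "dW 2 U v p = ddir (1, 0) (ddir (1, 0) u) (v, p)"
    and "dW 3 U v p = ddir (1, 0) (ddir (1, 0) (ddir (1, 0) u)) (v, p)"
proof -
  have s: "smooth_on (I \<times> L) u" "smooth_on (I \<times> L) (ddir (1, 0) u)" "smooth_on (I \<times> L) (ddir (1, 0) (ddir (1, 0) u))"
    using U by (auto simp: u_def intro!: smooth_on_ddir)
  have 1: "deriv (\<lambda>v. U v p) v = ddir (1, 0) u (v, p)" if "v \<in> I" for v
    using deriv_slice[OF s(1) that vp(2)] by (simp add: u_def)
  have 2: "deriv (deriv (\<lambda>v. U v p)) v = ddir (1, 0) (ddir (1, 0) u) (v, p)" if "v \<in> I" for v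
    using deriv_cong_open[OF I that 1] deriv_slice[OF s(2) that vp(2)] by simp
  have 3: "deriv (deriv (deriv (\<lambda>v. U v p))) v = ddir (1, 0) (ddir (1, 0) (ddir (1, 0) u)) (v, p)" if "v \<in> I" for v
    using deriv_cong_open[OF I that 2] deriv_slice[OF s(3) that vp(2)] by simp
  show "dW 1 U v p = ddir (1, 0) u (v, p)"
    "dW 2 U v p = ddir (1, 0) (ddir (1, 0) u) (v, p)"
    "dW 3 U v p = ddir (1, 0) (ddir (1, 0) (ddir (1, 0) u)) (v, p)"
    using 1 2 3 vp(1) by (simp_all add: dW_def numeral_2_eq_2 numeral_3_eq_3)
qed

text \<open>The error expression of the claim with the four vectors left open, so that both values
  of \<open>N\<close> share one estimate.\<close>

definition hessian_defect ::
  "(real \<Rightarrow> real) \<Rightarrow> (real \<Rightarrow> real \<times> 'l::euclidean_space \<Rightarrow> real) \<Rightarrow> (real \<times> 'l \<Rightarrow> real) \<Rightarrow>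
   (real \<times> 'l \<times> real \<Rightarrow> real) \<Rightarrow> (real \<times> 'l \<Rightarrow> real \<times> 'l \<times> real) \<Rightarrow> (real \<times> 'l \<Rightarrow> real \<times> 'l \<times> real) \<Rightarrow>
   (real \<times> 'l \<Rightarrow> real \<times> 'l \<times> real) \<Rightarrow> (real \<times> 'l \<Rightarrow> real \<times> 'l \<times> real) \<Rightarrow>
   real \<times> 'l \<times> real \<Rightarrow> real \<times> 'l \<times> real \<Rightarrow> real \<times> 'l \<times> real \<Rightarrow> real" where
  "hessian_defect \<kappa> U v0 \<Theta> V W Z T i j = (\<lambda>(\<mu>, l, c). let p = (c, l) in
     1 / (pi * Y0 \<kappa> U v0 p) * hessian \<Theta> (\<mu>, l, c) i j
     - (alpha0 \<kappa> U v0 p * outer (V p) (V p) i j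
        + beta0 \<kappa> U v0 p * (outer (V p) (W p) i j + outer (W p) (V p) i j)
        + (a0 U v0 p)\<^sup>2 / 2 * outer (W p) (W p) i j
        - outer (T p) (T p) i j
        + (a0 U v0 p)\<^sup>2 / 4 * (outer (V p) (Z p) i j + outer (Z p) (V p) i j)))"

section \<open>Transfer to the potentials and the parameter order of the claim\<close>

locale param_well =
  fixes I :: "real set" and U :: "real \<Rightarrow> real \<times> 'l::euclidean_space \<Rightarrow> real" and L :: "(real \<times> 'l) set"
    and v0 vs vS :: "real \<times> 'l \<Rightarrow> real" and \<kappa> :: "real \<Rightarrow> real" and v1 v2 v3 :: "real \<times> 'l \<times> real \<Rightarrow> real"
  assumes open_I': "open I" and interval_I': "is_interval I"
    and smooth_U: "smooth_on (I \<times> L) (\<lambda>y. U (fst y) (snd y))"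
    and smooth_\<kappa>': "smooth_on I \<kappa>" and \<kappa>_pos': "\<forall>v\<in>I. \<kappa> v > 0"
    and wells: "potential_wells I U L v0 vs vS"
    and roots: "energy_roots I U L v0 vs vS v1 v2 v3"
begin

abbreviation "u \<equiv> \<lambda>y. U (fst y) (snd y)"

abbreviation "\<Omega> \<equiv> Omega U L v0 vs"

lemma well_facts:
  "open L" "smooth_on L v0" "smooth_on L vs" "smooth_on L vS"
  "p \<in> L \<Longrightarrow> v0 p \<in> I" "p \<in> L \<Longrightarrow> vs p \<in> I" "p \<in> L \<Longrightarrow> vS p \<in> I"
  "p \<in> L \<Longrightarrow> vs p < v0 p" "p \<in> L \<Longrightarrow> v0 p < vS p"
  "p \<in> L \<Longrightarrow> dW 1 U (v0 p) p = 0" "p \<in> L \<Longrightarrow> 0 < dW 2 U (v0 p) p"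
  "p \<in> L \<Longrightarrow> vs p < v \<Longrightarrow> v < v0 p \<Longrightarrow> dW 1 U v p < 0"
  "p \<in> L \<Longrightarrow> v0 p < v \<Longrightarrow> v \<le> vS p \<Longrightarrow> dW 1 U v p > 0"
  using wells unfolding potential_wells_def by auto

lemma root_facts:
  assumes "(\<mu>, l, c) \<in> \<Omega>"
  shows "vs (c, l) < v2 (\<mu>, l, c)" "v2 (\<mu>, l, c) < v0 (c, l)" "v0 (c, l) < v3 (\<mu>, l, c)" "v3 (\<mu>, l, c) < vS (c, l)"
    "U (v2 (\<mu>, l, c)) (c, l) = \<mu>" "U (v3 (\<mu>, l, c)) (c, l) = \<mu>"
  using roots assms unfolding energy_roots_def by auto

lemma in_I_between: "p \<in> L \<Longrightarrow> vs p < v \<Longrightarrow> v < vS p \<Longrightarrow> v \<in> I"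
  using well_facts(6,7)[of p] interval_I'[unfolded is_interval_1] by (meson less_imp_le)

sublocale potential_well I u L v0 vs vS \<kappa>
proof
  fix p assume p: "p \<in> L"
  note d = dW_slice[OF open_I' smooth_U _ p]
  show "ddir (1, 0) u (v0 p, p) = 0" using d(1)[of "v0 p"] well_facts(5,10)[OF p] by simp
  show "ddir (1, 0) (ddir (1, 0) u) (v0 p, p) > 0" using d(2)[of "v0 p"] well_facts(5,11)[OF p] by simp
  fix v
  show "ddir (1, 0) u (v, p) < 0" if v: "vs p < v" "v < v0 p"
    using d(1)[of v] well_facts(12)[OF p v] in_I_between[OF p, of v] well_facts(9)[OF p] v by simp
  show "ddir (1, 0) u (v, p) > 0" if v: "v0 p < v" "v < vS p"
    using d(1)[of v] well_facts(13)[OF p v(1)] in_I_between[OF p, of v] well_facts(8)[OF p] v by simp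
qed (use well_facts open_I' interval_I' smooth_U smooth_\<kappa>' \<kappa>_pos' smooth_on_continuous_on in auto)

definition Om :: "(real \<times> (real \<times> 'l)) set" where
  "Om = {z \<in> UNIV \<times> L. \<mu>0 (snd z) < fst z \<and> fst z < U (vs (snd z)) (snd z)}"

lemma reorder_in_Om: "x \<in> \<Omega> \<longleftrightarrow> reorder x \<in> Om"
  by (cases x) (auto simp: Omega_def Om_def \<mu>0_def)

lemma continuous_U_at:
  assumes "continuous_on L w" "\<And>p. p \<in> L \<Longrightarrow> w p \<in> I" shows "continuous_on L (\<lambda>p. U (w p) p)"
proof -
  have "continuous_on L (\<lambda>p. u (w p, p))"
    by (rule continuous_on_compose2[OF smooth_on_continuous_on[OF smooth_u] continuous_on_Pair[OF assms(1) continuous_on_id]])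
       (use assms(2) in blast)
  then show ?thesis by simp
qed

lemma open_Om': "open Om"
proof -
  have s: "continuous_on (UNIV \<times> L) (\<lambda>z. f (snd z))" if "continuous_on L f" for f :: "real \<times> 'l \<Rightarrow> real"
    by (rule continuous_on_compose2[OF that]) (auto intro!: continuous_intros)
  have "Om = {z \<in> UNIV \<times> L. (fst z - \<mu>0 (snd z), U (vs (snd z)) (snd z) - fst z) \<in> {0<..} \<times> {0<..}}"
    by (auto simp: Om_def)
  moreover have "continuous_on L (\<lambda>p. U (vs p) p)"
    by (rule continuous_U_at[OF cont_vs]) (rule well_facts)
  from s[OF this] s[OF smooth_on_continuous_on[OF smooth_\<mu>0]]
  have "open {z \<in> UNIV \<times> L. (fst z - \<mu>0 (snd z), U (vs (snd z)) (snd z) - fst z) \<in> {0<..} \<times> {0<..}}"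
    by (intro open_preimage open_Times open_UNIV open_L open_greaterThan continuous_intros)
  ultimately show ?thesis by simp
qed

definition v2' :: "real \<times> (real \<times> 'l) \<Rightarrow> real" where "v2' z = v2 (fst z, snd (snd z), fst (snd z))"
definition v3' :: "real \<times> (real \<times> 'l) \<Rightarrow> real" where "v3' z = v3 (fst z, snd (snd z), fst (snd z))"

sublocale well_action I u L v0 vs vS \<kappa> Om v2' v3'
proof
  show "open Om" by (rule open_Om')
  fix z assume z: "z \<in> Om"
  obtain \<mu> c l where zz: "z = (\<mu>, (c, l))" by (cases z) auto
  have "(\<mu>, l, c) \<in> \<Omega>" using z by (simp add: reorder_in_Om zz)
  note f = root_facts[OF this]
  have p: "(c, l) \<in> L" using z by (simp add: Om_def zz)
  show "snd z \<in> L" "(v2' z, snd z) \<in> D" "(v3' z, snd z) \<in> D" "v2' z < v0 (snd z)" "v0 (snd z) < v3' z"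
    "U (fst (v2' z, snd z)) (snd (v2' z, snd z)) = fst z" "U (fst (v3' z, snd z)) (snd (v3' z, snd z)) = fst z"
    using f p well_facts(8,9)[OF p] by (auto simp: zz v2'_def v3'_def D_def)
qed

lemma action_reorder: "action \<kappa> U v2 v3 x = \<Theta> (reorder x)"
  by (cases x) (simp add: \<Theta>_def v2'_def v3'_def)

lemma open_Omega: "open \<Omega>"
proof -
  have "\<Omega> = reorder -` Om" using reorder_in_Om by auto
  then show ?thesis using open_vimage[OF open_Om] linear_continuous_on[OF bounded_linear_reorder] by metis
qed

lemma smooth_action': "smooth_on \<Omega> (action \<kappa> U v2 v3)"
  unfolding action_reorder[abs_def]
  by (rule smooth_on_compose[OF smooth_action open_Omega smooth_map_bounded_linear[OF open_Omega bounded_linear_reorder]])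
     (simp add: reorder_in_Om)

lemma twice_differentiable_action: "twice_differentiable_on \<Omega> (action \<kappa> U v2 v3)"
  unfolding twice_differentiable_on_def
  using smooth_on_differentiable[OF smooth_action'] smooth_on_differentiable[OF smooth_on_ddir[OF smooth_action']]
  by (simp add: ddir_def[abs_def])

lemma hessian_action:
  assumes "x \<in> \<Omega>"
  shows "hessian (action \<kappa> U v2 v3) x i j = ddir (reorder i) (ddir (reorder j) \<Theta>) (reorder x)"
proof -
  have d: "(reorder has_derivative reorder) (at y)" for y :: "real \<times> 'l \<times> real"
    by (rule bounded_linear_imp_has_derivative[OF bounded_linear_reorder])
  have "hessian (action \<kappa> U v2 v3) x i j = ddir i (ddir j (\<lambda>x. \<Theta> (reorder x))) x"
    unfolding hessian_def ddir_def action_reorder[abs_def] ..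
  also have "\<dots> = ddir i (\<lambda>y. ddir (reorder j) \<Theta> (reorder y)) x"
  proof (rule ddir_cong[OF open_Omega assms])
    fix y assume "y \<in> \<Omega>"
    then show "ddir j (\<lambda>x. \<Theta> (reorder x)) y = ddir (reorder j) \<Theta> (reorder y)"
      by (intro ddir_compose[OF _ d] smooth_on_differentiable[OF smooth_action]) (simp add: reorder_in_Om)
  qed
  also have "\<dots> = ddir (reorder i) (ddir (reorder j) \<Theta>) (reorder x)"
    by (intro ddir_compose[where g="ddir (reorder j) \<Theta>", OF _ d] smooth_on_differentiable[OF smooth_on_ddir[OF smooth_action]])
       (use assms in \<open>simp add: reorder_in_Om\<close>)
  finally show ?thesis .
qed

text \<open>Carries the asymptotics over to the filter of the claim; \<open>reorder\<close> sends
  points other than the limit point to points other than its image.\<close>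

lemma filterlim_reorder:
  "filterlim reorder (near_bottom (c, l)) (at (U (v0 (c, l)) (c, l), l, c) within \<Omega>)"
  unfolding filterlim_at
proof
  have "isCont reorder (U (v0 (c, l)) (c, l), l, c)" by (rule linear_continuous_at[OF bounded_linear_reorder])
  then have "reorder \<midarrow>(U (v0 (c, l)) (c, l), l, c)\<rightarrow> (\<mu>0 (c, l), (c, l))"
    by (simp add: isCont_def \<mu>0_def)
  then show "(reorder \<longlongrightarrow> (\<mu>0 (c, l), (c, l))) (at (U (v0 (c, l)) (c, l), l, c) within \<Omega>)"
    by (rule tendsto_within_subset) simp
  show "\<forall>\<^sub>F x in at (U (v0 (c, l)) (c, l), l, c) within \<Omega>. reorder x \<in> Om \<and> reorder x \<noteq> (\<mu>0 (c, l), (c, l))"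
    unfolding eventually_at_filter
    by (rule eventuallyI) (auto simp: reorder_in_Om reorder_def \<mu>0_def)
qed

text \<open>Since \<open>s = a\<close>, all derivatives of \<open>Y\<close> at the bottom are
  polynomials in \<open>a\<close>, in \<open>k\<close> and its derivatives, and in \<open>u3\<close>
  and \<open>u4\<close>; the comparison of coefficients is then pure algebra.\<close>

lemma
  assumes p: "p \<in> L"
  shows Y0_eq: "Y0 \<kappa> U v0 p = k (v0 p) * a p" and a0_eq: "a0 U v0 p = a p"
    and alpha0_eq: "alpha0 \<kappa> U v0 p = A p" and beta0_eq: "beta0 \<kappa> U v0 p = B p"
proof -
  have d: "((\<lambda>v. F (v, p)) has_real_derivative ddir (1, 0) F (v, p)) (at v)" if "smooth_on (I \<times> L) F" "v \<in> I" for F v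
    by (rule has_real_derivative_fst[OF smooth_on_differentiable[OF that(1)]]) (use that p in simp)
  have dk: "(F has_real_derivative ddir 1 F v) (at v)" if "smooth_on I F" "v \<in> I" for F v
    by (rule ddir_real_has_field_derivative[OF smooth_on_differentiable[OF that]])
  have W2: "dW 2 U v p = u2 (v, p)" if "v \<in> I" for v
    using dW_slice(2)[OF open_I smooth_u that p] by (simp add: u2_def u1_def)
  have W3: "dW 3 U v p = u3 (v, p)" if "v \<in> I" for v
    using dW_slice(3)[OF open_I smooth_u that p] by (simp add: u3_def u2_def u1_def)
  have c4: "continuous_on I (\<lambda>v. u4 (v, p))"
    by (rule continuous_on_compose2[OF smooth_on_continuous_on[OF smooth_u4]]) (use p in \<open>auto intro!: continuous_intros\<close>)
  have vI: "v0 p \<in> I" using v0_in_IL[OF p] by simp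
  interpret wp: well_point I \<kappa> k k1 k2 "\<lambda>v. u2 (v, p)" "\<lambda>v. u3 (v, p)" "\<lambda>v. u4 (v, p)" "v0 p" U p
    by unfold_locales
       (use open_I interval_I vI d[OF smooth_u2] d[OF smooth_u3] c4 dk[OF smooth_k] dk[OF smooth_k1] W2 u2_pos[OF p] in
         \<open>simp_all add: u3_def u4_def k1_def k2_def k_def\<close>)
  have s: "wp.s = a p"
    by (simp add: wp.s_def a_def real_sqrt_divide)
  have k: "k (v0 p) > 0" using k_pos[OF vI] .
  note ap = a_pos[OF p]
  show Y: "Y0 \<kappa> U v0 p = k (v0 p) * a p"
    unfolding Y0_def wp.Y_at s ..
  show a: "a0 U v0 p = a p" by (simp add: a0_def a_def W2[OF vI])
  have b: "b0 U v0 p = - u3 (v0 p, p) * a p ^ 4 / 12"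
    using ap by (simp add: b0_def W2[OF vI] W3[OF vI] u2_eq[OF p] field_simps power4_eq_xxxx power2_eq_square)
  note Ys = Y0_v_def Y0_vv_def Y0_z_def Y0_zz_def Y0_wz_def wp.Y_v wp.Y_vv wp.Y_z wp.Y_zz wp.Y_wz s
  define K K1 K2 c3 c4 e where "K = k (v0 p)" and "K1 = k1 (v0 p)" and "K2 = k2 (v0 p)"
    and "c3 = u3 (v0 p, p)" and "c4 = u4 (v0 p, p)" and "e = a p"
  note fold = K_def[symmetric] K1_def[symmetric] K2_def[symmetric] c3_def[symmetric] c4_def[symmetric] e_def[symmetric]
  have pos: "K > 0" "e > 0" using k ap by (simp_all add: K_def e_def)
  \<comment> \<open>Both sides are \<open>Y\<^sup>0 \<alpha>\<^sub>0\<close>. The squares of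
    \<open>c3\<close> in the \<open>zz\<close> and \<open>wz\<close> terms cancel; of the 5/192, the
    part 4/192 comes from the product with \<open>b\<^sub>0\<close> and 1/192 from the
    \<open>vv\<close> term.\<close>
  have "- c3 * e ^ 4 / 12 * (K1 * e - K * e ^ 3 * (c3 / 6) / 2 + 2 * (- K * e ^ 3 * (c3 / 6) / 2)) +
      e\<^sup>2 * ((K2 * e - K1 * e ^ 3 * (c3 / 6) + K * (3 / 4 * e ^ 5 * (c3 / 6)\<^sup>2 - e ^ 3 * (c4 / 12) / 2)) / 4 +
        K * (3 / 4 * e ^ 5 * (c3 / 6)\<^sup>2 - e ^ 3 * (c4 / 12) / 2) -
        K * (3 / 4 * e ^ 5 * (c3 / 6)\<^sup>2 - e ^ 3 * (c4 / 24) / 2)) =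
      K2 * e ^ 3 / 4 - K1 * c3 * e ^ 5 / 8 + K * (5 / 192 * c3\<^sup>2 * e ^ 7 - c4 * e ^ 5 / 32)"
    by (simp add: eval_nat_numeral field_simps)
  then show "alpha0 \<kappa> U v0 p = A p"
    unfolding alpha0_def A_def Y a b Ys fold by simp
  show "beta0 \<kappa> U v0 p = B p"
    unfolding beta0_def B_def Y a b Ys fold using pos
    by (simp add: eval_nat_numeral field_simps)
qed

text \<open>For a concrete potential it remains to recognise \<open>Vf\<close>, \<open>Wf\<close>,
  \<open>Zf\<close> and \<open>Sf\<close> at the bottom as components of explicit vectors. Only the
  two directions \<open>i\<close> and \<open>j\<close> matter, because the estimate is made entry by
  entry.\<close>

theorem hessian_small_amplitude:
  assumes p: "(cs, ls) \<in> L"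
    and Vv: "\<And>p. p \<in> L \<Longrightarrow> Vf (reorder i) (v0 p, p) = Vv p \<bullet> i" "\<And>p. p \<in> L \<Longrightarrow> Vf (reorder j) (v0 p, p) = Vv p \<bullet> j"
    and Wv: "\<And>p. p \<in> L \<Longrightarrow> Wf (reorder i) (v0 p, p) = Wv p \<bullet> i" "\<And>p. p \<in> L \<Longrightarrow> Wf (reorder j) (v0 p, p) = Wv p \<bullet> j"
    and Zv: "\<And>p. p \<in> L \<Longrightarrow> Zf (reorder i) (v0 p, p) = Zv p \<bullet> i" "\<And>p. p \<in> L \<Longrightarrow> Zf (reorder j) (v0 p, p) = Zv p \<bullet> j"
    and Tv: "\<And>p. p \<in> L \<Longrightarrow> Sf (reorder i) (reorder j) (v0 p, p) = outer (Tv p) (Tv p) i j"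
  defines "F \<equiv> at (U (v0 (cs, ls)) (cs, ls), ls, cs) within \<Omega>"
  shows "((\<lambda>x. (v3 x - v2 x) / 2) \<longlongrightarrow> 0) F"
    and "hessian_defect \<kappa> U v0 (action \<kappa> U v2 v3) Vv Wv Zv Tv i j \<in> O[F](\<lambda>x. (v3 x - v2 x) / 2)"
proof -
  have \<delta>: "(v3' (reorder x) - v2' (reorder x)) / 2 = (v3 x - v2 x) / 2" for x
    by (cases x) (simp add: v2'_def v3'_def)
  note lim = filterlim_reorder[of cs ls, folded F_def]
  show "((\<lambda>x. (v3 x - v2 x) / 2) \<longlongrightarrow> 0) F"
    using filterlim_compose[OF tendsto_width[OF p] lim] by (simp only: \<delta>)
  obtain C where C: "\<forall>\<^sub>F z in near_bottom (cs, ls). z \<in> Om \<and>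
    \<bar>1 / (pi * (k (v0 (snd z)) * a (snd z))) * ddir (reorder i) (ddir (reorder j) \<Theta>) z - H (reorder i) (reorder j) (snd z)\<bar>
      \<le> C * \<bar>(v3' z - v2' z) / 2\<bar>"
    using normalized_hessian_asymptotics[OF p] by blast
  show "hessian_defect \<kappa> U v0 (action \<kappa> U v2 v3) Vv Wv Zv Tv i j \<in> O[F](\<lambda>x. (v3 x - v2 x) / 2)"
  proof (rule bigoI[of _ C], use eventually_compose_filterlim[OF C lim] in eventually_elim)
    case (elim x)
    obtain \<mu> l c where x: "x = (\<mu>, l, c)" by (cases x) auto
    have xO: "x \<in> \<Omega>" using elim by (simp add: reorder_in_Om)
    then have pL: "(c, l) \<in> L" by (simp add: x Omega_def)
    have H: "H (reorder i) (reorder j) (c, l) =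
      alpha0 \<kappa> U v0 (c, l) * outer (Vv (c, l)) (Vv (c, l)) i j
         + beta0 \<kappa> U v0 (c, l) * (outer (Vv (c, l)) (Wv (c, l)) i j + outer (Wv (c, l)) (Vv (c, l)) i j)
         + (a0 U v0 (c, l))\<^sup>2 / 2 * outer (Wv (c, l)) (Wv (c, l)) i j
         - outer (Tv (c, l)) (Tv (c, l)) i j
         + (a0 U v0 (c, l))\<^sup>2 / 4 * (outer (Vv (c, l)) (Zv (c, l)) i j + outer (Zv (c, l)) (Vv (c, l)) i j)"
      unfolding H_def alpha0_eq[OF pL] beta0_eq[OF pL] a0_eq[OF pL] Vv[OF pL] Wv[OF pL] Zv[OF pL] Tv[OF pL]
      by (simp add: outer_def mult.assoc)
    show ?case
      using elim unfolding \<delta> hessian_action[OF xO, symmetric]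
      by (simp add: x H Y0_eq[OF pL] hessian_defect_def Let_def)
  qed
qed

end

section \<open>The potentials for \<open>N = 1\<close> and \<open>N = 2\<close>\<close>

context potential_well begin

lemma Vf_slice: "v \<in> I \<Longrightarrow> p \<in> L \<Longrightarrow> Vf i (v, p) = fst i - ddir (snd i) (\<lambda>p. u (v, p)) p"
  unfolding Vf_def by (subst ddir_snd) (auto intro: smooth_on_differentiable[OF smooth_u])

lemma Sf_slice:
  assumes "v \<in> I" "p \<in> L" shows "Sf i j (v, p) = - ddir (snd i) (\<lambda>p. Vf j (v, p)) p"
proof -
  have s: "smooth_on (I \<times> L) (\<lambda>y. - Vf j y)" by (intro smooth_on_minus open_IL smooth_Vf)
  have "Sf i j (v, p) = ddir (0, snd i) (\<lambda>y. fst j - Vf j y) (v, p)"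
    unfolding Sf_def Vf_def by simp
  also have "\<dots> = ddir (0, snd i) (\<lambda>y. fst j) (v, p) - ddir (0, snd i) (Vf j) (v, p)"
    by (rule ddir_diff) (use assms in \<open>auto intro: smooth_on_differentiable[OF smooth_Vf]\<close>)
  also have "\<dots> = - ddir (snd i) (\<lambda>p. Vf j (v, p)) p"
    using assms by (subst ddir_snd) (auto simp: ddir_eqI[OF has_derivative_const] intro: smooth_on_differentiable[OF smooth_Vf])
  finally show ?thesis .
qed

text \<open>The shape of \<open>Vf\<close> in both cases: constant and linear terms for
  \<open>\<mu>\<close> and the first component of \<open>\<lambda>\<close>, then \<open>e2\<close>
  for \<open>g\<close> (zero when \<open>N = 1\<close>) and \<open>e3\<close> for
  \<open>q\<close>.\<close>

lemma Wf_Zf_slice: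
  assumes p: "p \<in> L" and V: "\<And>v. v \<in> I \<Longrightarrow> Vf i (v, p) = m0 + v * m1 + e2 v * m2 + e3 v * m3"
    and e2: "smooth_on I e2" and e3: "smooth_on I e3" and v: "v \<in> I"
  shows "Wf i (v, p) = m1 + deriv e2 v * m2 + deriv e3 v * m3"
    and "Zf i (v, p) = (deriv ^^ 2) e2 v * m2 + (deriv ^^ 2) e3 v * m3"
proof -
  note G' = smooth_on_deriv[OF open_I e2] and Q' = smooth_on_deriv[OF open_I e3]
  note G'' = smooth_on_deriv[OF open_I G'(1)] and Q'' = smooth_on_deriv[OF open_I Q'(1)]
  have W: "Wf i (v, p) = m1 + deriv e2 v * m2 + deriv e3 v * m3" if v: "v \<in> I" for v
  proof -
    have d: "((\<lambda>v. m0 + v * m1 + e2 v * m2 + e3 v * m3) has_real_derivative m1 + deriv e2 v * m2 + deriv e3 v * m3) (at v)"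
      by (rule derivative_eq_intros refl G'(2)[OF v] Q'(2)[OF v])+ simp
    have "deriv (\<lambda>v. Vf i (v, p)) v = m1 + deriv e2 v * m2 + deriv e3 v * m3"
      by (rule trans[OF deriv_cong_open[OF open_I v V] DERIV_imp_deriv[OF d]])
    then show ?thesis using deriv_slice[OF smooth_Vf v p] by (simp add: Wf_def)
  qed
  show "Wf i (v, p) = m1 + deriv e2 v * m2 + deriv e3 v * m3" by (rule W[OF v])
  have d: "((\<lambda>v. m1 + deriv e2 v * m2 + deriv e3 v * m3) has_real_derivative deriv (deriv e2) v * m2 + deriv (deriv e3) v * m3) (at v)"
    by (rule derivative_eq_intros refl G''(2)[OF v] Q''(2)[OF v])+ simp
  have "deriv (\<lambda>v. Wf i (v, p)) v = deriv (deriv e2) v * m2 + deriv (deriv e3) v * m3"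
    by (rule trans[OF deriv_cong_open[OF open_I v W] DERIV_imp_deriv[OF d]])
  then show "Zf i (v, p) = (deriv ^^ 2) e2 v * m2 + (deriv ^^ 2) e3 v * m3"
    using deriv_slice[OF smooth_Wf v p] by (simp add: Zf_def numeral_2_eq_2)
qed

end

lemma smooth_comp_fst:
  assumes "smooth_on I f" "open L" "open I" shows "smooth_on (I \<times> L) (\<lambda>y. f (fst y))"
  by (rule smooth_on_compose[OF assms(1) open_Times[OF assms(3,2)] smooth_map_fst[OF open_Times[OF assms(3,2)]]]) auto

lemma smooth_on_W1:
  assumes "smooth_on I f" "open L" "open I" "b \<noteq> 0"
  shows "smooth_on (I \<times> L) (\<lambda>y. W1 b f (fst y) (snd y))"
proof -
  have O: "open (I \<times> L)" using assms by (simp add: open_Times)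
  have "W1 b f (fst y) (snd y) = - f (fst y) - fst (snd y) * (1 / (2 * b)) * (fst y)\<^sup>2 - snd (snd y) * fst y" for y
    by (cases y) auto
  then show ?thesis
    by (simp only:) (intro smooth_on_diff[OF O] smooth_on_minus[OF O] smooth_on_mult[OF O] smooth_on_power[OF O]
        smooth_on_const[OF O] smooth_comp_fst[OF assms(1-3)] smooth_on_bounded_linear[OF O bounded_linear_fst]
        smooth_on_bounded_linear[OF O bounded_linear_fst_comp[OF bounded_linear_snd]]
        smooth_on_bounded_linear[OF O bounded_linear_snd_comp[OF bounded_linear_snd]])
qed

lemma smooth_on_W2:
  fixes L :: "(real \<times> (real \<times> real)) set"
  assumes "smooth_on I f" "smooth_on I \<tau>" "\<forall>v\<in>I. \<tau> v > 0" "open L" "open I" "b \<noteq> 0"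
  shows "smooth_on (I \<times> L) (\<lambda>y. W2 b f \<tau> (fst y) (snd y))"
proof -
  have O: "open (I \<times> L)" using assms by (simp add: open_Times)
  have eq: "W2 b f \<tau> (fst y) (snd y) = - f (fst y)
     + (1 / 2 * \<tau> (fst y)) * (- (fst (snd y) * (1 / b) * fst y + snd (snd (snd y))) / \<tau> (fst y))\<^sup>2
     - fst (snd (snd y)) * fst y" for y :: "real \<times> (real \<times> (real \<times> real))"
    by (cases y) (auto simp: g2_def)
  have nz: "\<And>y. y \<in> I \<times> L \<Longrightarrow> \<tau> (fst y) \<noteq> 0" using assms(3) by fastforce
  show ?thesis
    unfolding eq
    by (intro smooth_on_diff[OF O] smooth_on_add[OF O] smooth_on_minus[OF O] smooth_on_divide[OF O] smooth_on_mult[OF O] smooth_on_power[OF O]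
        smooth_on_const[OF O] smooth_comp_fst[OF assms(1,4,5)] smooth_comp_fst[OF assms(2,4,5)] nz
        smooth_on_bounded_linear[OF O bounded_linear_fst]
        smooth_on_bounded_linear[OF O bounded_linear_fst_comp[OF bounded_linear_snd]]
        smooth_on_bounded_linear[OF O bounded_linear_snd_comp[OF bounded_linear_snd_comp[OF bounded_linear_snd]]]
        smooth_on_bounded_linear[OF O bounded_linear_fst_comp[OF bounded_linear_snd_comp[OF bounded_linear_snd]]])
qed

lemma small_amplitude_W1:
  fixes b :: real and I :: "real set" and f \<kappa> :: "real \<Rightarrow> real" and L :: "(real \<times> real) set"
  assumes b: "b \<noteq> 0" and I: "open I" "is_interval I" and s: "smooth_on I f" "smooth_on I \<kappa>" and \<kappa>: "\<forall>v\<in>I. \<kappa> v > 0"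
    and pw: "potential_wells I (W1 b f) L v0 vs vS" and er: "energy_roots I (W1 b f) L v0 vs vS v1 v2 v3"
    and p0: "(cs, ls) \<in> L"
  defines "F \<equiv> at (W1 b f (v0 (cs, ls)) (cs, ls), ls, cs) within Omega (W1 b f) L v0 vs"
  shows "twice_differentiable_on (Omega (W1 b f) L v0 vs) (action \<kappa> (W1 b f) v2 v3)"
    and "((\<lambda>p. (v3 p - v2 p) / 2) \<longlongrightarrow> 0) F"
    and "hessian_defect \<kappa> (W1 b f) v0 (action \<kappa> (W1 b f) v2 v3) (\<lambda>p. V_N1 b (v0 p)) (\<lambda>p. W_N1 b (v0 p)) (\<lambda>p. Z_N1 b (v0 p)) (\<lambda>p. T_N1) i j
      \<in> O[F](\<lambda>p. (v3 p - v2 p) / 2)"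
proof -
  have L: "open L" using pw by (simp add: potential_wells_def)
  interpret param_well I "W1 b f" L v0 vs vS \<kappa> v1 v2 v3
    by unfold_locales (use assms smooth_on_W1[OF s(1) L I(1) b] in auto)
  show "twice_differentiable_on (Omega (W1 b f) L v0 vs) (action \<kappa> (W1 b f) v2 v3)"
    by (rule twice_differentiable_action)
  have q: "smooth_on I (q1 b)" unfolding q1_def[abs_def] divide_inverse
    by (intro smooth_on_mult smooth_on_power smooth_on_const I smooth_on_bounded_linear[OF I(1) bounded_linear_ident])
  \<comment> \<open>The summand \<open>0 * 0\<close> fills the place that \<open>g\<close> has for
    \<open>N = 2\<close>.\<close>
  have Vs: "Vf (reorder i) (v, p) = fst i + v * fst (snd i) + 0 * 0 + q1 b v * snd (snd i)" if "v \<in> I" "p \<in> L" for i v p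
  proof -
    have "((\<lambda>p. W1 b f v p) has_derivative (\<lambda>q. - fst q * (v\<^sup>2 / (2 * b)) - snd q * v)) (at p)"
    proof -
      have "W1 b f v = (\<lambda>p. - f v - fst p * (v\<^sup>2 / (2 * b)) - snd p * v)" by (rule ext, case_tac p) simp
      then show ?thesis by (auto intro!: derivative_eq_intros simp: b algebra_simps)
    qed
    from ddir_eqI[OF this] show ?thesis
      by (simp add: Vf_slice[OF that] reorder_def q1_def)
  qed
  have v0I: "v0 p \<in> I" if "p \<in> L" for p using v0_in_IL[OF that] by simp
  have V: "Vf (reorder i) (v0 p, p) = V_N1 b (v0 p) \<bullet> i" if "p \<in> L" for i p
    using Vs[OF v0I[OF that] that, of i] by (cases i) (simp add: V_N1_def)
  have WZ: "Wf (reorder i) (v0 p, p) = W_N1 b (v0 p) \<bullet> i" "Zf (reorder i) (v0 p, p) = Z_N1 b (v0 p) \<bullet> i" if "p \<in> L" for i p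
    using Wf_Zf_slice[OF that Vs[OF _ that] smooth_on_const[OF I(1)] q v0I[OF that], of i]
    by (cases i; simp add: W_N1_def Z_N1_def)+
  \<comment> \<open>At fixed \<open>v\<close> the potential is affine in
    \<open>(c, \<lambda>)\<close>, so its gradient does not depend on the parameters and the second
    derivative vanishes.\<close>
  have S: "Sf (reorder i) (reorder j) (v0 p, p) = outer T_N1 T_N1 i j" if p: "p \<in> L" for p
  proof -
    have "ddir q (\<lambda>p. Vf (reorder j) (v0 p', p)) p = 0" if "v0 p' \<in> I" for q p'
      using ddir_cong[where h=q, OF L p Vs[where i=j, OF that]] by (simp add: ddir_eqI[OF has_derivative_const])
    then show ?thesis using Sf_slice[OF v0I[OF p] p] v0I[OF p] by (simp add: T_N1_def outer_def)
  qed
  note * = hessian_small_amplitude[where Vv="\<lambda>p. V_N1 b (v0 p)" and Wv="\<lambda>p. W_N1 b (v0 p)" and Zv="\<lambda>p. Z_N1 b (v0 p)"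
      and Tv="\<lambda>p. T_N1" and i=i and j=j, OF p0 V V WZ(1) WZ(1) WZ(2) WZ(2) S, folded F_def]
  show "((\<lambda>p. (v3 p - v2 p) / 2) \<longlongrightarrow> 0) F" by (rule *(1))
  show "hessian_defect \<kappa> (W1 b f) v0 (action \<kappa> (W1 b f) v2 v3) (\<lambda>p. V_N1 b (v0 p)) (\<lambda>p. W_N1 b (v0 p)) (\<lambda>p. Z_N1 b (v0 p)) (\<lambda>p. T_N1) i j
      \<in> O[F](\<lambda>p. (v3 p - v2 p) / 2)"
    by (rule *(2))
qed

lemma has_derivative_g2:
  assumes "b \<noteq> 0" "\<tau> v \<noteq> 0"
  shows "((\<lambda>p. g2 b \<tau> (fst p) (snd (snd p)) v) has_derivative (\<lambda>q. - (fst q * (v / b) + snd (snd q)) / \<tau> v)) (at p)"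
  unfolding g2_def using assms by (auto intro!: derivative_eq_intros simp: field_simps)

lemma small_amplitude_W2:
  fixes b :: real and I :: "real set" and f \<kappa> \<tau> :: "real \<Rightarrow> real" and L :: "(real \<times> (real \<times> real)) set"
  assumes b: "b \<noteq> 0" and I: "open I" "is_interval I" and s: "smooth_on I f" "smooth_on I \<kappa>" and \<kappa>: "\<forall>v\<in>I. \<kappa> v > 0"
    and \<tau>: "smooth_on I \<tau>" "\<forall>v\<in>I. \<tau> v > 0"
    and pw: "potential_wells I (W2 b f \<tau>) L v0 vs vS" and er: "energy_roots I (W2 b f \<tau>) L v0 vs vS v1 v2 v3"
    and p0: "(cs, ls) \<in> L"
  defines "F \<equiv> at (W2 b f \<tau> (v0 (cs, ls)) (cs, ls), ls, cs) within Omega (W2 b f \<tau>) L v0 vs"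
  shows "twice_differentiable_on (Omega (W2 b f \<tau>) L v0 vs) (action \<kappa> (W2 b f \<tau>) v2 v3)"
    and "((\<lambda>p. (v3 p - v2 p) / 2) \<longlongrightarrow> 0) F"
    and "hessian_defect \<kappa> (W2 b f \<tau>) v0 (action \<kappa> (W2 b f \<tau>) v2 v3) (\<lambda>p. V_N2 b \<tau> (v0 p) p) (\<lambda>p. W_N2 b \<tau> (v0 p) p)
       (\<lambda>p. Z_N2 b \<tau> (v0 p) p) (\<lambda>p. T_N2 b \<tau> (v0 p)) i j
      \<in> O[F](\<lambda>p. (v3 p - v2 p) / 2)"
proof -
  have L: "open L" using pw by (simp add: potential_wells_def)
  interpret param_well I "W2 b f \<tau>" L v0 vs vS \<kappa> v1 v2 v3
    by unfold_locales (use assms smooth_on_W2[OF s(1) \<tau> L I(1) b] in auto)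
  show "twice_differentiable_on (Omega (W2 b f \<tau>) L v0 vs) (action \<kappa> (W2 b f \<tau>) v2 v3)"
    by (rule twice_differentiable_action)
  have nz: "\<And>v. v \<in> I \<Longrightarrow> \<tau> v \<noteq> 0" using \<tau>(2) by fastforce
  have g: "smooth_on I (g2 b \<tau> c l)" for c l
    unfolding g2_def[abs_def]
    by (intro smooth_on_divide smooth_on_minus smooth_on_add smooth_on_mult smooth_on_const I \<tau> nz
        smooth_on_bounded_linear[OF I(1) bounded_linear_ident])
  have q: "smooth_on I (q2 b \<tau> c l)" for c l
    unfolding q2_def[abs_def] using b
    by (intro smooth_on_divide smooth_on_mult smooth_on_const I g smooth_on_bounded_linear[OF I(1) bounded_linear_ident])
  have Vs: "Vf (reorder i) (v, p) = fst i + v * fst (fst (snd i)) + g2 b \<tau> (fst p) (snd (snd p)) v * snd (fst (snd i))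
      + q2 b \<tau> (fst p) (snd (snd p)) v * snd (snd i)" if "v \<in> I" "p \<in> L" for i v p
  proof -
    let ?g = "g2 b \<tau> (fst p) (snd (snd p)) v"
    \<comment> \<open>The factor \<open>\<tau>\<close> in front of \<open>g^2 / 2\<close> cancels
      the \<open>1 / \<tau>\<close> in the derivative of \<open>g\<close>. What remains gives
      \<open>g\<close> and \<open>v g / b = q\<close> as the last two components of
      \<open>V\<^sub>0\<close>.\<close>
    have "((\<lambda>p. - f v + 1 / 2 * \<tau> v * (g2 b \<tau> (fst p) (snd (snd p)) v)\<^sup>2 - fst (snd p) * v) has_derivative
       (\<lambda>q. - ?g * (fst q * (v / b) + snd (snd q)) - fst (snd q) * v)) (at p)"
      by (auto intro!: derivative_eq_intros has_derivative_g2 b nz[OF that(1)] simp: nz[OF that(1)] field_simps)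
    moreover have "W2 b f \<tau> v = (\<lambda>p. - f v + 1 / 2 * \<tau> v * (g2 b \<tau> (fst p) (snd (snd p)) v)\<^sup>2 - fst (snd p) * v)"
      by (rule ext, case_tac p) auto
    ultimately have "((\<lambda>p. W2 b f \<tau> v p) has_derivative (\<lambda>q. - ?g * (fst q * (v / b) + snd (snd q)) - fst (snd q) * v)) (at p)"
      by simp
    from ddir_eqI[OF this, of "snd (reorder i)"] show ?thesis
      by (simp add: Vf_slice[OF that] reorder_def q2_def algebra_simps)
  qed
  have v0I: "v0 p \<in> I" if "p \<in> L" for p using v0_in_IL[OF that] by simp
  have V: "Vf (reorder i) (v0 p, p) = V_N2 b \<tau> (v0 p) p \<bullet> i" if "p \<in> L" for i p
    using Vs[OF v0I[OF that] that, of i] by (cases p; cases i) auto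
  have WZ: "Wf (reorder i) (v0 p, p) = W_N2 b \<tau> (v0 p) p \<bullet> i" "Zf (reorder i) (v0 p, p) = Z_N2 b \<tau> (v0 p) p \<bullet> i" if "p \<in> L" for i p
    using Wf_Zf_slice[OF that Vs[OF _ that] g q v0I[OF that], of i]
    by (cases p; cases i; auto)+
  \<comment> \<open>\<open>g\<close> is linear in \<open>(c, \<lambda>\<^sub>2)\<close> with
    gradient \<open>- (v / b, 1) / \<tau>\<close>, and in \<open>Vf\<close> it is multiplied by the
    fixed linear form with coefficients \<open>(v / b, 1)\<close>. The second derivative is
    therefore of rank one, its factor \<open>1 / \<tau>\<close> being shared between the two copies
    of \<open>T\<^sub>0\<close>.\<close>
  have S: "Sf (reorder i) (reorder j) (v0 p, p) = outer (T_N2 b \<tau> (v0 p)) (T_N2 b \<tau> (v0 p)) i j" if p: "p \<in> L" for p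
  proof -
    define v where "v = v0 p"
    have v: "v \<in> I" using v0I[OF p] by (simp add: v_def)
    have t: "\<tau> v > 0" using \<tau>(2) v by blast
    have "((\<lambda>p. fst j + v * fst (fst (snd j)) + g2 b \<tau> (fst p) (snd (snd p)) v * snd (fst (snd j))
      + v * g2 b \<tau> (fst p) (snd (snd p)) v / b * snd (snd j)) has_derivative
        (\<lambda>q. - (fst q * (v / b) + snd (snd q)) / \<tau> v * (snd (fst (snd j)) + v / b * snd (snd j)))) (at p)"
      using b t by (auto intro!: derivative_eq_intros has_derivative_g2 simp: field_simps)
    from ddir_eqI[OF this] have dd: "ddir r (\<lambda>p. Vf (reorder j) (v, p)) p
       = - (fst r * (v / b) + snd (snd r)) / \<tau> v * (snd (fst (snd j)) + v / b * snd (snd j))" for r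
      using ddir_cong[where h=r, OF L p Vs[where i=j, OF v]] by (simp add: q2_def)
    have "Sf (reorder i) (reorder j) (v, p)
       = (snd (fst (snd i)) + v / b * snd (snd i)) * (snd (fst (snd j)) + v / b * snd (snd j)) / \<tau> v"
      unfolding Sf_slice[OF v p] dd using t b by (simp add: reorder_def field_simps)
    moreover have "\<tau> v powr (- 1 / 2) * \<tau> v powr (- 1 / 2) = 1 / \<tau> v"
      using t by (simp add: powr_add[symmetric] powr_minus_divide)
    then have "outer (T_N2 b \<tau> v) (T_N2 b \<tau> v) i j
       = 1 / \<tau> v * ((snd (fst (snd i)) + v / b * snd (snd i)) * (snd (fst (snd j)) + v / b * snd (snd j)))"
      by (cases i; cases j) (auto simp: outer_def T_N2_def algebra_simps)
    ultimately show ?thesis by (simp add: v_def)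
  qed
  note * = hessian_small_amplitude[where Vv="\<lambda>p. V_N2 b \<tau> (v0 p) p" and Wv="\<lambda>p. W_N2 b \<tau> (v0 p) p" and Zv="\<lambda>p. Z_N2 b \<tau> (v0 p) p"
      and Tv="\<lambda>p. T_N2 b \<tau> (v0 p)" and i=i and j=j, OF p0 V V WZ(1) WZ(1) WZ(2) WZ(2) S, folded F_def]
  show "((\<lambda>p. (v3 p - v2 p) / 2) \<longlongrightarrow> 0) F" by (rule *(1))
  show "hessian_defect \<kappa> (W2 b f \<tau>) v0 (action \<kappa> (W2 b f \<tau>) v2 v3) (\<lambda>p. V_N2 b \<tau> (v0 p) p) (\<lambda>p. W_N2 b \<tau> (v0 p) p)
       (\<lambda>p. Z_N2 b \<tau> (v0 p) p) (\<lambda>p. T_N2 b \<tau> (v0 p)) i j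
      \<in> O[F](\<lambda>p. (v3 p - v2 p) / 2)"
    by (rule *(2))
qed

theorem theorem4:
  fixes b :: real and I :: "real set" and f \<kappa> :: "real \<Rightarrow> real"
  assumes "b \<noteq> 0"
    and "open I" and "is_interval I"
    and "smooth_on I f" and "smooth_on I \<kappa>" and "\<forall>v\<in>I. \<kappa> v > 0"
  shows
    "(\<forall>(L :: (real \<times> real) set) v0 vs vS v1 v2 v3 cs ls.
        let U = W1 b f;
            \<Omega> = Omega U L v0 vs;
            \<Theta> = action \<kappa> U v2 v3;
            \<delta> = (\<lambda>p. (v3 p - v2 p) / 2);
            F = at (U (v0 (cs, ls)) (cs, ls), ls, cs) within \<Omega>
        in potential_wells I U L v0 vs vS \<longrightarrow>
           energy_roots I U L v0 vs vS v1 v2 v3 \<longrightarrow>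
           (cs, ls) \<in> L \<longrightarrow>
           twice_differentiable_on \<Omega> \<Theta> \<and>
           (\<delta> \<longlongrightarrow> 0) F \<and>
           (\<forall>i\<in>Basis. \<forall>j\<in>Basis.
              (\<lambda>(\<mu>, l, c).
                 let p = (c, l);
                     V = V_N1 b (v0 p);
                     W = W_N1 b (v0 p);
                     Z = Z_N1 b (v0 p);
                     T = T_N1
                 in 1 / (pi * Y0 \<kappa> U v0 p) * hessian \<Theta> (\<mu>, l, c) i j
                    - (alpha0 \<kappa> U v0 p * outer V V i j
                       + beta0 \<kappa> U v0 p * (outer V W i j + outer W V i j)
                       + (a0 U v0 p)\<^sup>2 / 2 * outer W W i j
                       - outer T T i j
                       + (a0 U v0 p)\<^sup>2 / 4 * (outer V Z i j + outer Z V i j)))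
              \<in> O[F](\<delta>)))
     \<and>
     (\<forall>\<tau> (L :: (real \<times> (real \<times> real)) set) v0 vs vS v1 v2 v3 cs ls.
        let U = W2 b f \<tau>;
            \<Omega> = Omega U L v0 vs;
            \<Theta> = action \<kappa> U v2 v3;
            \<delta> = (\<lambda>p. (v3 p - v2 p) / 2);
            F = at (U (v0 (cs, ls)) (cs, ls), ls, cs) within \<Omega>
        in smooth_on I \<tau> \<longrightarrow> (\<forall>v\<in>I. \<tau> v > 0) \<longrightarrow>
           potential_wells I U L v0 vs vS \<longrightarrow>
           energy_roots I U L v0 vs vS v1 v2 v3 \<longrightarrow>
           (cs, ls) \<in> L \<longrightarrow>
           twice_differentiable_on \<Omega> \<Theta> \<and>
           (\<delta> \<longlongrightarrow> 0) F \<and>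
           (\<forall>i\<in>Basis. \<forall>j\<in>Basis.
              (\<lambda>(\<mu>, l, c).
                 let p = (c, l);
                     V = V_N2 b \<tau> (v0 p) p;
                     W = W_N2 b \<tau> (v0 p) p;
                     Z = Z_N2 b \<tau> (v0 p) p;
                     T = T_N2 b \<tau> (v0 p)
                 in 1 / (pi * Y0 \<kappa> U v0 p) * hessian \<Theta> (\<mu>, l, c) i j
                    - (alpha0 \<kappa> U v0 p * outer V V i j
                       + beta0 \<kappa> U v0 p * (outer V W i j + outer W V i j)
                       + (a0 U v0 p)\<^sup>2 / 2 * outer W W i j
                       - outer T T i j
                       + (a0 U v0 p)\<^sup>2 / 4 * (outer V Z i j + outer Z V i j)))
              \<in> O[F](\<delta>)))"
  unfolding Let_def
  using small_amplitude_W1[OF assms, unfolded hessian_defect_def Let_def] small_amplitude_W2[OF assms, unfolded hessian_defect_def Let_def]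
  by (intro conjI allI impI ballI) simp_all

end
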